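(* Let $A_1,A_2$ be real $2\times 2$ matrices with $A_i=P_iJ_iP_i^{-1}$, $J_i=\mathrm{diag}(-p_i,-q_i)$, $0<p_i<q_i$, $P_i$ real invertible ($i=1,2$), chosen so that $M=P_2^{-1}P_1=\begin{pmatrix} a&b\\c&d\end{pmatrix}$ satisfies $\det M=\pm 1$. Let $\mathcal I=\left[-\frac{p_2}{q_2-p_2},\frac{q_2}{q_2-p_2}\right]$. Define $\tau_{1,2}$ as follows. (i) If $ad\in\mathcal I$, then the switched system $\dot x(t)=A_{\sigma(t)}x(t)$ is stable for all signals $\sigma$. Let $\tau_{1,2}=0$. (ii) If $ad>q_2/(q_2-p_2)$, calculate the unique nonzero solution $(t_{sol},s_{sol})$ (in the first quadrant $t,s>0$) of the system $$\frac{(e^{p_1 t}-e^{-q_2 s})(e^{q_1 t}+e^{-q_2 s})}{(e^{p_1 t}-e^{-p_2 s})(e^{q_1 t}+e^{-p_2 s})}e^{(q_2-p_2)s}=\frac{q_2}{p_2},$$ $$\left(ad\left(e^{-p_1t-p_2s}-e^{-q_1t-q_2s}\right)-bc\left(e^{-p_1t-q_2s}-e^{-p_2s-q_1t}\right)\right)^2=\left(e^{-(p_1+q_1)t-(p_2+q_2)s}-1\right)^2.$$ (a) If $s_{sol}\ge t_{sol}$, let $\tau_{1,2}=t_{sol}$. (b) Otherwise, if $s_{sol}<t_{sol}$, let $\tau_{1,2}$ be the unique positive solution $t$ of $$\left(ad\left(e^{-p_1t-p_2t}-e^{-q_1t-q_2t}\right)-bc\left(e^{-p_1t-q_2t}-e^{-p_2t-q_1t}\right)\right)^2=\left(e^{-(p_1+q_1+p_2+q_2)t}-1\right)^2.\quad(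 * )$$ (iii) If $ad<-p_2/(q_2-p_2)$, calculate the unique nonzero solution $(t_{sol},s_{sol})$ (in the first quadrant $t,s>0$) of the system $$\frac{(e^{q_2 s+p_1 t}+1)(e^{q_2 s+q_1 t}-1)}{(e^{p_2 s+p_1 t}+1)(e^{p_2 s+q_1 t}-1)}e^{-(q_2-p_2)s}=\frac{q_2}{p_2},$$ $$\left(ad\left(e^{-p_1t-p_2s}-e^{-q_1t-q_2s}\right)-bc\left(e^{-p_1t-q_2s}-e^{-p_2s-q_1t}\right)\right)^2=\left(e^{-(p_1+q_1)t-(p_2+q_2)s}-1\right)^2.$$ (a) If $s_{sol}\ge t_{sol}$, let $\tau_{1,2}=t_{sol}$. (b) Otherwise, if $s_{sol}<t_{sol}$, let $\tau_{1,2}$ be the unique solution $t>s_{sol}$ of $( * )$. Then the switched system $\dot x(t)=A_{\sigma(t)}x(t)$ is stable for all signals $\sigma\in S_{\tau_{1,2}}$ and asymptotically stable for all signals $\sigma\in S'_{\tau_{1,2}}$.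
   Context: A signal is a right-continuous piecewise constant $\sigma:[0,\infty)\to\{1,2\}$ with $\sigma(0)=1$ and discontinuities $d_1<d_2<\cdots$, $d_k\to\infty$; put $d_0=0$. For $j\ge1$, $t_j=d_{2j-1}-d_{2j-2}>0$ and $s_j=d_{2j}-d_{2j-1}>0$ are the successive times spent in subsystems $A_1$ and $A_2$. For fixed $\sigma$ the system $\dot x(t)=A_{\sigma(t)}x(t)$ on $\mathbb R^2$ is stable if for every $\epsilon>0$ there is $\delta>0$ such that $\|x(0)\|<\delta$ implies $\|x(t)\|<\epsilon$ for all $t>0$; it is asymptotically stable if it is stable and $\|x(t)\|\to0$ as $t\to\infty$ for every $x(0)\in\mathbb R^2$. $S_\tau$ is the set of signals with $t_j\ge\tau$ and $s_j\ge\tau$ for all $j\in\mathbb N$; $S'_\tau$ is the set of $\sigma\in S_\tau$ for which there exists an infinite subset $\Gamma$ of $\mathbb N$ such that $(\tau,\tau)$ is not a limit point of the set $\{(t_\gamma,s_\gamma)\}_{\gamma\in\Gamma}$.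
   Formalization: For det M = −1, τ_{1,2} is defined by the cases of det M·ad instead of ad (the claim for ad in I is also kept as printed); with ad the statement fails: p2=1, q2=2, ad=−3/2, bc=−1/2 falls in (iii), but the second equation has no solution t,s>0. *)

theory Defs
  imports "HOL-Analysis.Analysis"
begin

text \<open>Switching signals. Time is the nonnegative part of the reals; the values of \<open>\<sigma>\<close> at
  negative times are irrelevant. \<open>d k\<close> (\<open>k \<ge> 1\<close>) is the \<open>k\<close>-th discontinuity and \<open>d 0 = 0\<close>; every
  signal has infinitely many discontinuities, and they determine \<open>d\<close>.\<close>

definition switching_times :: "(real \<Rightarrow> nat) \<Rightarrow> (nat \<Rightarrow> real) \<Rightarrow> bool" where
  "switching_times \<sigma> d \<longleftrightarrow>
     \<sigma> 0 = 1 \<and> (\<forall>t\<ge>0. \<sigma> t \<in> {1, 2}) \<and>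
     d 0 = 0 \<and> strict_mono d \<and> filterlim d at_top sequentially \<and>
     (\<forall>k. \<forall>t. d k \<le> t \<and> t < d (Suc k) \<longrightarrow> \<sigma> t = \<sigma> (d k)) \<and>
     (\<forall>k. \<sigma> (d (Suc k)) \<noteq> \<sigma> (d k))"

definition signals :: "(real \<Rightarrow> nat) set" where
  "signals = {\<sigma>. \<exists>d. switching_times \<sigma> d}"

text \<open>\<open>dur1 d j\<close> and \<open>dur2 d j\<close> are the times \<open>t\<^sub>j\<close> and \<open>s\<^sub>j\<close>; they are used for \<open>j \<ge> 1\<close> only.\<close>

definition dur1 :: "(nat \<Rightarrow> real) \<Rightarrow> nat \<Rightarrow> real" where
  "dur1 d j = d (2 * j - 1) - d (2 * j - 2)"

definition dur2 :: "(nat \<Rightarrow> real) \<Rightarrow> nat \<Rightarrow> real" where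
  "dur2 d j = d (2 * j) - d (2 * j - 1)"

definition S_dwell :: "real \<Rightarrow> (real \<Rightarrow> nat) set" where
  "S_dwell \<tau> = {\<sigma>. \<exists>d. switching_times \<sigma> d \<and> (\<forall>j\<ge>1. \<tau> \<le> dur1 d j \<and> \<tau> \<le> dur2 d j)}"

definition S_dwell' :: "real \<Rightarrow> (real \<Rightarrow> nat) set" where
  "S_dwell' \<tau> = {\<sigma>. \<exists>d. switching_times \<sigma> d \<and> (\<forall>j\<ge>1. \<tau> \<le> dur1 d j \<and> \<tau> \<le> dur2 d j) \<and>
     (\<exists>\<Gamma>\<subseteq>{1..}. infinite \<Gamma> \<and> \<not> (\<tau>, \<tau>) islimpt {(dur1 d \<gamma>, dur2 d \<gamma>) | \<gamma>. \<gamma> \<in> \<Gamma>})}"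

text \<open>A solution is continuous on \<open>[0,\<infinity>)\<close> and satisfies the differential equation at all times
  other than 0 and the discontinuities of the signal.\<close>

definition is_solution ::
  "real^2^2 \<Rightarrow> real^2^2 \<Rightarrow> (real \<Rightarrow> nat) \<Rightarrow> (real \<Rightarrow> real^2) \<Rightarrow> bool" where
  "is_solution A1 A2 \<sigma> x \<longleftrightarrow>
     continuous_on {0..} x \<and>
     (\<forall>t>0. isCont \<sigma> t \<longrightarrow>
        (x has_vector_derivative ((if \<sigma> t = 1 then A1 else A2) *v x t)) (at t))"

definition stable_for :: "real^2^2 \<Rightarrow> real^2^2 \<Rightarrow> (real \<Rightarrow> nat) \<Rightarrow> bool" where
  "stable_for A1 A2 \<sigma> \<longleftrightarrow>
     (\<forall>\<epsilon>>0. \<exists>\<delta>>0. \<forall>x. is_solution A1 A2 \<sigma> x \<longrightarrow> norm (x 0) < \<delta> \<longrightarrow>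
        (\<forall>t>0. norm (x t) < \<epsilon>))"

definition asymp_stable_for :: "real^2^2 \<Rightarrow> real^2^2 \<Rightarrow> (real \<Rightarrow> nat) \<Rightarrow> bool" where
  "asymp_stable_for A1 A2 \<sigma> \<longleftrightarrow>
     stable_for A1 A2 \<sigma> \<and>
     (\<forall>x. is_solution A1 A2 \<sigma> x \<longrightarrow> ((\<lambda>t. norm (x t)) \<longlongrightarrow> 0) at_top)"

definition diag_neg :: "real \<Rightarrow> real \<Rightarrow> real^2^2" where
  "diag_neg p q = vector [vector [- p, 0], vector [0, - q]]"

definition interval_I :: "real \<Rightarrow> real \<Rightarrow> real set" where
  "interval_I p2 q2 = {- (p2 / (q2 - p2)) .. q2 / (q2 - p2)}"

text \<open>In the equations below \<open>ad\<close> and \<open>bc\<close> are single variables, standing for the products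
  \<open>a * d\<close> and \<open>b * c\<close> of entries of \<open>M\<close>.\<close>

definition norm_eq ::
  "real \<Rightarrow> real \<Rightarrow> real \<Rightarrow> real \<Rightarrow> real \<Rightarrow> real \<Rightarrow> real \<Rightarrow> real \<Rightarrow> bool" where
  "norm_eq p1 q1 p2 q2 ad bc t s \<longleftrightarrow>
     (ad * (exp (- p1 * t - p2 * s) - exp (- q1 * t - q2 * s))
      - bc * (exp (- p1 * t - q2 * s) - exp (- p2 * s - q1 * t)))^2
     = (exp (- (p1 + q1) * t - (p2 + q2) * s) - 1)^2"

definition crit_eq_ii :: "real \<Rightarrow> real \<Rightarrow> real \<Rightarrow> real \<Rightarrow> real \<Rightarrow> real \<Rightarrow> bool" where
  "crit_eq_ii p1 q1 p2 q2 t s \<longleftrightarrow>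
     ((exp (p1 * t) - exp (- q2 * s)) * (exp (q1 * t) + exp (- q2 * s)))
     / ((exp (p1 * t) - exp (- p2 * s)) * (exp (q1 * t) + exp (- p2 * s)))
     * exp ((q2 - p2) * s) = q2 / p2"

definition crit_eq_iii :: "real \<Rightarrow> real \<Rightarrow> real \<Rightarrow> real \<Rightarrow> real \<Rightarrow> real \<Rightarrow> bool" where
  "crit_eq_iii p1 q1 p2 q2 t s \<longleftrightarrow>
     ((exp (q2 * s + p1 * t) + 1) * (exp (q2 * s + q1 * t) - 1))
     / ((exp (p2 * s + p1 * t) + 1) * (exp (p2 * s + q1 * t) - 1))
     * exp (- (q2 - p2) * s) = q2 / p2"

definition is_unique_sol :: "('a \<Rightarrow> bool) \<Rightarrow> 'a \<Rightarrow> bool" where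
  "is_unique_sol P x \<longleftrightarrow> P x \<and> (\<forall>y. P y \<longrightarrow> y = x)"

text \<open>\<open>is_tau12 p1 q1 p2 q2 M \<tau>\<close>: the number \<open>\<tau>\<close> is \<open>\<tau>\<^sub>1\<^sub>,\<^sub>2\<close>. Whenever a solution of an equation is
  referred to, its existence and its uniqueness are part of the predicate.

  The three cases are distinguished by \<open>\<kappa> = det M * (a * d)\<close>. For \<open>det M = 1\<close> this is \<open>a * d\<close>.
  The case \<open>det M = -1\<close> is reduced to \<open>det M = 1\<close> by changing the sign of the second column of
  \<open>P1\<close>, which does not change \<open>A1\<close> and replaces \<open>(ad, bc)\<close> by \<open>(-ad, -bc)\<close>; the equation
  \<open>norm_eq\<close> is invariant under this replacement, but the case distinction is not. Using the
  unsigned product when \<open>det M = -1\<close> would select the wrong critical-point equation.\<close>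

definition is_tau12 ::
  "real \<Rightarrow> real \<Rightarrow> real \<Rightarrow> real \<Rightarrow> real^2^2 \<Rightarrow> real \<Rightarrow> bool" where
  "is_tau12 p1 q1 p2 q2 M \<tau> \<longleftrightarrow>
    (let ad = M $ 1 $ 1 * M $ 2 $ 2; bc = M $ 1 $ 2 * M $ 2 $ 1; \<kappa> = det M * ad in
      (\<kappa> \<in> interval_I p2 q2 \<longrightarrow> \<tau> = 0) \<and>
      (\<kappa> > q2 / (q2 - p2) \<longrightarrow>
        (\<exists>t_sol s_sol.
          is_unique_sol (\<lambda>(t, s). t > 0 \<and> s > 0 \<and> crit_eq_ii p1 q1 p2 q2 t s
                                  \<and> norm_eq p1 q1 p2 q2 ad bc t s) (t_sol, s_sol) \<and>
          (s_sol \<ge> t_sol \<longrightarrow> \<tau> = t_sol) \<and>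
          (s_sol < t_sol \<longrightarrow>
            is_unique_sol (\<lambda>t. t > 0 \<and> norm_eq p1 q1 p2 q2 ad bc t t) \<tau>))) \<and>
      (\<kappa> < - (p2 / (q2 - p2)) \<longrightarrow>
        (\<exists>t_sol s_sol.
          is_unique_sol (\<lambda>(t, s). t > 0 \<and> s > 0 \<and> crit_eq_iii p1 q1 p2 q2 t s
                                  \<and> norm_eq p1 q1 p2 q2 ad bc t s) (t_sol, s_sol) \<and>
          (s_sol \<ge> t_sol \<longrightarrow> \<tau> = t_sol) \<and>
          (s_sol < t_sol \<longrightarrow>
            is_unique_sol (\<lambda>t. t > s_sol \<and> norm_eq p1 q1 p2 q2 ad bc t t) \<tau>))))"

end

theory Submission
  imports Defs "HOL-Real_Asymp.Real_Asymp"
begin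

text \<open>
  In eigencoordinates of \<open>A1\<close> the first flow is diagonal and the second one is
  \<open>f \<Pi> + g (1 - \<Pi>)\<close>, where \<open>\<Pi>\<close> is a projection whose upper left entry is \<open>\<kappa> = det M * (a * d)\<close>.

  If \<open>\<bar>\<kappa>\<bar> \<le> q2 / (q2 - p2)\<close>, the trajectory of the slow eigenvector of \<open>A1\<close> under the second flow
  keeps its slow coordinate in \<open>[-1, 1]\<close>. Hence the supremum of the slow coordinate along the
  second flow is nonincreasing under both flows, and a small perturbation of it decays
  exponentially for every signal. This also covers \<open>a * d \<in> I\<close> when \<open>det M = -1\<close>.

  Otherwise \<open>\<kappa> (\<kappa> - 1) > 0\<close>, so after scaling the coordinates a cycle with durations \<open>(\<tau>, s)\<close> has
  off-diagonal entries \<open>y\<close> and \<open>-y\<close>; it is a reflection times a symmetric matrix and its norm is at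
  most 1 iff \<open>(\<tau>, s)\<close> lies on the proper side of the curve \<open>norm_eq\<close>. The threshold is such that
  this holds for all \<open>s \<ge> \<tau>\<close>, and the surplus time in the first subsystem is a diagonal contraction.
  A vector whose length is preserved by a cycle is mapped to its mirror image, whose length is not
  preserved by the next cycle, so by compactness two consecutive cycles contract uniformly.
\<close>

text \<open>A matrix with rows (x, y) and (-y, z) has determinant D = x z + y^2, and its squared
  singular values have product D^2 and sum (x - z)^2 + 2 D. For 0 < D < 1 it is therefore a
  contraction iff (x - z)^2 \<le> (1 - D)^2, and \<open>norm_eq\<close> is the case of equality.

  The off-diagonal entries of a cycle share the factor f - g, so the scaling that balances them
  depends on the time in the first subsystem but not on s. This shapes the argument: the first
  duration is frozen at \<tau>, one norm then serves all s, and a longer first phase splits off as a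
  diagonal matrix. A longer second phase does not split off and has to be covered by an inequality
  for every s \<ge> \<tau>.

  Along s that inequality is controlled through \<open>H t s / sinh (b * s)\<close>, whose
  derivative changes sign at most once, from negative to positive. At t_sol its minimum over s is 0,
  attained at s_sol, so \<tau> = t_sol covers all s. If s_sol < t_sol, the dip at s_sol lies among
  durations too short to occur, and \<tau> can be lowered to a zero of \<open>H\<close> on the
  diagonal.\<close>

section \<open>The level curve of the norm of a cycle\<close>

text \<open>For half sums \<open>m1, m2\<close> and half differences \<open>a, b\<close> of the rates and \<open>\<epsilon> c = 2 \<kappa> - 1\<close>, the equation
  \<open>norm_eq\<close>, divided by the square root of the determinant of the cycle, becomes \<open>H t s = 0\<close>; the
  cycle is a contraction where \<open>H\<close> is nonnegative. Cases (ii) and (iii) are \<open>\<epsilon> = 1\<close> and \<open>\<epsilon> = -1\<close>.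
  The function \<open>\<Psi>\<close> is the numerator of the derivative of \<open>H t s / sinh (b s)\<close> in \<open>s\<close>, and the
  critical equations are \<open>\<Psi> t s = 0\<close>.\<close>

locale level_curve =
  fixes m1 m2 a b c \<epsilon> :: real
  assumes a: "0 < a" "a < m1" and b: "0 < b" "b < m2" and c: "m2 < c * b" and eps: "\<bar>\<epsilon>\<bar> = 1"
begin

definition H :: "real \<Rightarrow> real \<Rightarrow> real" where
  "H t s = sinh (m1 * t + m2 * s) - \<epsilon> * sinh (a * t) * cosh (b * s) - c * cosh (a * t) * sinh (b * s)"

definition \<Psi> :: "real \<Rightarrow> real \<Rightarrow> real" where
  "\<Psi> t s = m2 * cosh (m1 * t + m2 * s) * sinh (b * s) - b * sinh (m1 * t + m2 * s) * cosh (b * s)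
     + \<epsilon> * b * sinh (a * t)"

lemma c_gt_1: "c > 1"
proof -
  have "1 * b < c * b" using b c by linarith
  then show ?thesis using b(1) by (rule mult_right_less_imp_less[OF _ less_imp_le])
qed

lemma eps_cases: "\<epsilon> = 1 \<or> \<epsilon> = -1" using eps by linarith

lemma H_deriv_s:
  "((\<lambda>s. H t s) has_real_derivative
     m2 * cosh (m1 * t + m2 * s) - \<epsilon> * b * sinh (a * t) * sinh (b * s) - c * b * cosh (a * t) * cosh (b * s)) (at s)"
  unfolding H_def by (auto intro!: derivative_eq_intros simp: algebra_simps)

lemma H_deriv_t:
  "((\<lambda>t. H t s) has_real_derivative
     m1 * cosh (m1 * t + m2 * s) - \<epsilon> * a * cosh (a * t) * cosh (b * s) - c * a * sinh (a * t) * sinh (b * s)) (at t)"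
  unfolding H_def by (auto intro!: derivative_eq_intros simp: algebra_simps)

text \<open>Division by sinh (b s) turns the last term of \<open>H\<close> into -c cosh (a t), which
  is constant in s. Therefore c cancels in the numerator, and of \<kappa> only the sign \<epsilon>
  survives in the critical equations.\<close>

lemma \<Psi>_eq:
  "\<Psi> t s = sinh (b * s) * (m2 * cosh (m1 * t + m2 * s) - \<epsilon> * b * sinh (a * t) * sinh (b * s)
                            - c * b * cosh (a * t) * cosh (b * s)) - b * cosh (b * s) * H t s"
proof -
  have "cosh (b * s) ^ 2 = sinh (b * s) ^ 2 + 1" by (simp add: cosh_square_eq)
  then show ?thesis unfolding \<Psi>_def H_def by algebra
qed

lemma \<Psi>_deriv_s:
  "((\<lambda>s. \<Psi> t s) has_real_derivative (m2\<^sup>2 - b\<^sup>2) * sinh (m1 * t + m2 * s) * sinh (b * s)) (at s)"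
  unfolding \<Psi>_def by (auto intro!: derivative_eq_intros simp: algebra_simps power2_eq_square)

text \<open>The derivative in s is positive because b < m2. So the derivative of
  \<open>H t s / sinh (b * s)\<close> changes sign at most once, which takes the place of convexity
  in every comparison along s.\<close>

lemma \<Psi>_strict_mono:
  assumes "0 \<le> t" "0 \<le> s" "s < s'"
  shows "\<Psi> t s < \<Psi> t s'"
proof (rule DERIV_pos_imp_increasing_open[OF assms(3)])
  fix r assume r: "s < r" "r < s'"
  have "b\<^sup>2 < m2\<^sup>2" using b by (simp add: power_strict_mono)
  moreover have "0 < m1 * t + m2 * r" using a b assms r by (simp add: add_nonneg_pos)
  ultimately have "0 < (m2\<^sup>2 - b\<^sup>2) * sinh (m1 * t + m2 * r) * sinh (b * r)"
    using b assms r by simp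
  then show "\<exists>y. ((\<lambda>s. \<Psi> t s) has_real_derivative y) (at r) \<and> 0 < y"
    using \<Psi>_deriv_s by blast
next
  show "continuous_on {s..s'} (\<Psi> t)"
    unfolding \<Psi>_def by (intro continuous_intros)
qed

lemma H_div_sinh_deriv:
  assumes "s > 0"
  shows "((\<lambda>s. H t s / sinh (b * s)) has_real_derivative \<Psi> t s / (sinh (b * s))\<^sup>2) (at s)"
proof -
  have "sinh (b * s) \<noteq> 0" using assms b by simp
  moreover have "((\<lambda>s. sinh (b * s)) has_real_derivative b * cosh (b * s)) (at s)"
    by (auto intro!: derivative_eq_intros)
  ultimately show ?thesis
    by (auto simp: \<Psi>_eq power2_eq_square algebra_simps intro!: DERIV_cong[OF DERIV_divide[OF H_deriv_s]])
qed

lemma H_div_sinh_cont: "0 < s \<Longrightarrow> continuous_on {s..s'} (\<lambda>s. H t s / sinh (b * s))"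
  by (intro continuous_at_imp_continuous_on ballI DERIV_isCont[OF H_div_sinh_deriv]) auto

text \<open>At such a point the quotient by sinh (b s) has its global minimum over s > 0, and this
  minimum is 0.\<close>

lemma H_nonneg_of_crit:
  assumes "0 \<le> t" "0 < s" "H t s = 0" "\<Psi> t s = 0" "0 < s'"
  shows "0 \<le> H t s'"
proof -
  consider "s' < s" | "s' = s" | "s < s'" by linarith
  then have "0 \<le> H t s' / sinh (b * s')"
  proof cases
    case 1
    have "H t s / sinh (b * s) < H t s' / sinh (b * s')"
    proof (rule DERIV_neg_imp_decreasing_open[OF 1])
      fix r assume r: "s' < r" "r < s"
      have "\<Psi> t r < 0" using \<Psi>_strict_mono[of t r s] r assms by simp
      then have "\<Psi> t r / (sinh (b * r))\<^sup>2 < 0" using r assms b by (simp add: divide_neg_pos)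
      then show "\<exists>y. ((\<lambda>s. H t s / sinh (b * s)) has_real_derivative y) (at r) \<and> y < 0"
        using H_div_sinh_deriv[of r t] r assms by fastforce
    qed (use assms H_div_sinh_cont in auto)
    then show ?thesis using assms by simp
  next
    case 3
    have "H t s / sinh (b * s) < H t s' / sinh (b * s')"
    proof (rule DERIV_pos_imp_increasing_open[OF 3])
      fix r assume r: "s < r" "r < s'"
      have "\<Psi> t r > 0" using \<Psi>_strict_mono[of t s r] r assms by simp
      then have "\<Psi> t r / (sinh (b * r))\<^sup>2 > 0" using r assms b by simp
      then show "\<exists>y. ((\<lambda>s. H t s / sinh (b * s)) has_real_derivative y) (at r) \<and> 0 < y"
        using H_div_sinh_deriv[of r t] r assms by fastforce
    qed (use assms H_div_sinh_cont in auto)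
    then show ?thesis using assms by simp
  qed (use assms in simp)
  moreover have "0 < sinh (b * s')" using assms b by simp
  ultimately show ?thesis using zero_le_divide_iff[of "H t s'" "sinh (b * s')"] by linarith
qed

text \<open>From s1 to s2 the quotient by sinh (b s) does not drop, so \<Psi> is nonnegative
  somewhere in between; from there on the quotient increases strictly.\<close>

lemma H_pos_beyond:
  assumes "0 \<le> t" "0 < s1" "s1 < s2" "s2 < s3" "H t s1 \<le> 0" "0 \<le> H t s2"
  shows "0 < H t s3"
proof -
  let ?q = "\<lambda>s. H t s / sinh (b * s)"
  have "?q s1 \<le> 0" "0 \<le> ?q s2"
    using assms b by (auto simp: divide_nonpos_pos)
  obtain r where r: "s1 < r" "r < s2" "?q s2 - ?q s1 = (s2 - s1) * (\<Psi> t r / (sinh (b * r))\<^sup>2)"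
    using MVT2[OF assms(3), of ?q "\<lambda>r. \<Psi> t r / (sinh (b * r))\<^sup>2"] H_div_sinh_deriv assms(2) by force
  then have "0 \<le> (s2 - s1) * (\<Psi> t r / (sinh (b * r))\<^sup>2)" using \<open>?q s1 \<le> 0\<close> \<open>0 \<le> ?q s2\<close> by linarith
  then have "0 \<le> \<Psi> t r" using r assms b by (simp add: zero_le_mult_iff zero_le_divide_iff)
  have "?q s2 < ?q s3"
  proof (rule DERIV_pos_imp_increasing_open[OF assms(4)])
    fix u assume u: "s2 < u" "u < s3"
    have "\<Psi> t u > 0" using \<Psi>_strict_mono[of t r u] r u assms \<open>0 \<le> \<Psi> t r\<close> by simp
    then have "\<Psi> t u / (sinh (b * u))\<^sup>2 > 0" using u assms b by simp
    then show "\<exists>y. (?q has_real_derivative y) (at u) \<and> 0 < y"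
      using H_div_sinh_deriv[of u t] u assms by fastforce
  qed (use assms H_div_sinh_cont in auto)
  then have "0 < ?q s3" using \<open>0 \<le> ?q s2\<close> by linarith
  moreover have "0 < sinh (b * s3)" using assms b by simp
  ultimately show ?thesis using zero_less_divide_iff[of "H t s3" "sinh (b * s3)"] by linarith
qed

text \<open>Division by cosh (a t) makes the c-term constant in t. The derivative then has the
  numerator (m1 - a) cosh \<theta> cosh (a r) + a (cosh (\<theta> - a r) - \<epsilon> cosh (b s)),
  which is positive because \<theta> - a r \<ge> b s \<ge> 0.\<close>

lemma H_strict_mono_t:
  assumes "0 \<le> t" "t < t'" "0 \<le> s" "0 \<le> H t s"
  shows "0 < H t' s"
proof -
  let ?q = "\<lambda>t. H t s / cosh (a * t)"
  have "?q t < ?q t'"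
  proof (rule DERIV_pos_imp_increasing[OF assms(2)])
    fix r assume r: "t \<le> r" "r \<le> t'"
    define \<theta> where "\<theta> = m1 * r + m2 * s"
    have "b * s \<le> m2 * s" "a * r \<le> m1 * r" using a b r assms by (auto intro: mult_right_mono)
    then have "cosh (b * s) \<le> cosh (\<theta> - a * r)" using a b r assms
      by (subst cosh_real_nonneg_le_iff) (auto simp: \<theta>_def intro: add_increasing2)
    moreover have "\<epsilon> * (a * cosh (b * s)) \<le> a * cosh (b * s)"
      using eps_cases a cosh_real_nonneg[of "b * s"] by (auto intro: mult_nonneg_nonneg)
    ultimately have "\<epsilon> * (a * cosh (b * s)) \<le> a * (cosh \<theta> * cosh (a * r) - sinh \<theta> * sinh (a * r))"
      using a by (smt (verit) cosh_diff mult_left_mono)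
    moreover have "0 < (m1 - a) * (cosh \<theta> * cosh (a * r))" using a by simp
    moreover have "m1 * cosh \<theta> * cosh (a * r) - a * sinh \<theta> * sinh (a * r) - \<epsilon> * a * cosh (b * s)
        = a * (cosh \<theta> * cosh (a * r) - sinh \<theta> * sinh (a * r)) - \<epsilon> * (a * cosh (b * s))
          + (m1 - a) * (cosh \<theta> * cosh (a * r))"
      by (simp add: algebra_simps)
    ultimately have pos: "0 < m1 * cosh \<theta> * cosh (a * r) - a * sinh \<theta> * sinh (a * r) - \<epsilon> * a * cosh (b * s)"
      by linarith
    have d: "((\<lambda>t. cosh (a * t)) has_real_derivative a * sinh (a * r)) (at r)"
      by (auto intro!: derivative_eq_intros)
    have D: "(?q has_real_derivative ((m1 * cosh \<theta> - \<epsilon> * a * cosh (a * r) * cosh (b * s) - c * a * sinh (a * r) * sinh (b * s))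
            * cosh (a * r) - H r s * (a * sinh (a * r))) / (cosh (a * r) * cosh (a * r))) (at r)"
      unfolding \<theta>_def by (rule DERIV_divide[OF H_deriv_t d]) simp
    have "(m1 * cosh \<theta> - \<epsilon> * a * cosh (a * r) * cosh (b * s) - c * a * sinh (a * r) * sinh (b * s))
            * cosh (a * r) - H r s * (a * sinh (a * r)) 
          = m1 * cosh \<theta> * cosh (a * r) - a * sinh \<theta> * sinh (a * r) - \<epsilon> * a * cosh (b * s)"
    proof -
      have "cosh (a * r) ^ 2 = sinh (a * r) ^ 2 + 1" by (simp add: cosh_square_eq)
      then show ?thesis unfolding H_def \<theta>_def[symmetric] by algebra
    qed
    then have N: "0 < ((m1 * cosh \<theta> - \<epsilon> * a * cosh (a * r) * cosh (b * s) - c * a * sinh (a * r) * sinh (b * s))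
            * cosh (a * r) - H r s * (a * sinh (a * r))) / (cosh (a * r) * cosh (a * r))"
      using pos by simp
    show "\<exists>y. (?q has_real_derivative y) (at r) \<and> 0 < y"
      by (rule exI, rule conjI[OF D N])
  qed
  moreover have "0 \<le> ?q t" using assms(4) by simp
  ultimately have "0 < ?q t'" by linarith
  then show ?thesis using cosh_real_pos[of "a * t'"] zero_less_divide_iff[of "H t' s" "cosh (a * t')"] by linarith
qed

lemma continuous_H: "continuous_on S (\<lambda>z. H (fst z) (snd z))"
  unfolding H_def by (intro continuous_intros)

text \<open>The first term of \<open>H\<close> outgrows the others since a < m1 and b < m2. They are
  at most (1 + c) exp (a t + b s), and passing from 2 sinh \<theta> to exp \<theta> costs one more
  such exponential, whence 2 (1 + c) + 1 = 3 + 2 c.\<close>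

lemma H_nonpos_imp_bounded:
  assumes "0 \<le> t" "0 \<le> s" "H t s \<le> 0"
  shows "(m1 - a) * t + (m2 - b) * s \<le> ln (3 + 2 * c)"
proof -
  define \<theta> where "\<theta> = m1 * t + m2 * s"
  have pos: "0 \<le> \<theta>" "0 \<le> a * t" "0 \<le> b * s" using assms a b by (auto simp: \<theta>_def)
  have ce: "cosh u \<le> exp u" "sinh u \<le> exp u" "0 \<le> sinh u" if "0 \<le> u" for u :: real
  proof -
    have "exp (- u) \<le> exp u" using that by simp
    then show "cosh u \<le> exp u" "sinh u \<le> exp u" "0 \<le> sinh u" 
      using that exp_ge_zero[of "-u"] exp_ge_zero[of u] unfolding cosh_def sinh_def
      by (auto simp: field_simps simp del: exp_ge_zero)
  qed
  have "sinh \<theta> \<le> \<epsilon> * (sinh (a * t) * cosh (b * s)) + c * (cosh (a * t) * sinh (b * s))"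
    using assms unfolding H_def \<theta>_def by (simp add: algebra_simps)
  also have "\<epsilon> * (sinh (a * t) * cosh (b * s)) \<le> sinh (a * t) * cosh (b * s)"
    using eps_cases ce(3)[OF pos(2)] cosh_real_nonneg[of "b * s"] by (auto intro: mult_nonneg_nonneg)
  also have "sinh (a * t) * cosh (b * s) \<le> exp (a * t) * exp (b * s)"
    using ce pos by (intro mult_mono) auto
  also have "c * (cosh (a * t) * sinh (b * s)) \<le> c * (exp (a * t) * exp (b * s))"
    using ce pos c_gt_1 by (intro mult_mono mult_nonneg_nonneg) auto
  finally have "sinh \<theta> \<le> (1 + c) * exp (a * t + b * s)"
    by (simp add: exp_add algebra_simps)
  moreover have "exp (- \<theta>) \<le> exp (a * t + b * s)" using pos by simp
  moreover have "exp \<theta> = 2 * sinh \<theta> + exp (-\<theta>)" by (simp add: sinh_field_def field_simps)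
  ultimately have "exp \<theta> \<le> 2 * ((1 + c) * exp (a * t + b * s)) + exp (a * t + b * s)"
    by (smt (verit))
  also have "\<dots> = (3 + 2 * c) * exp (a * t + b * s)" by (simp add: algebra_simps)
  finally have "exp \<theta> \<le> (3 + 2 * c) * exp (a * t + b * s)" .
  then have "ln (exp \<theta>) \<le> ln ((3 + 2 * c) * exp (a * t + b * s))"
    using c_gt_1 by (subst ln_le_cancel_iff) auto
  also have "\<dots> = ln (3 + 2 * c) + (a * t + b * s)" using c_gt_1 by (subst ln_mult_pos) auto
  finally show ?thesis unfolding \<theta>_def by (simp add: algebra_simps)
qed

text \<open>The slope of \<open>H 0\<close> at s = 0 is m2 - c b. This is where \<kappa> lying
  outside the interval enters: there are cycles that fail to contract.\<close>

lemma ex_H_neg: "\<exists>s>0. H 0 s < 0"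
proof -
  have "((\<lambda>s. H 0 s) has_real_derivative m2 - c * b) (at 0)"
    using H_deriv_s[of 0 0] by simp
  then obtain d where "d > 0" "\<And>h. 0 < h \<Longrightarrow> h < d \<Longrightarrow> H 0 (0 + h) < H 0 0"
    using DERIV_neg_dec_right[of "\<lambda>s. H 0 s" "m2 - c * b" 0] c by auto
  moreover have "H 0 0 = 0" unfolding H_def by simp
  ultimately have "0 < d / 2 \<and> H 0 (d / 2) < 0" by (metis add_0 field_sum_of_halves half_gt_zero less_add_same_cancel1)
  then show ?thesis by blast
qed

lemma H_neg_extend:
  assumes "H t s < 0"
  shows "\<exists>t'>t. H t' s < 0"
proof -
  have "(\<lambda>t. H t s) \<midarrow>t\<rightarrow> H t s" using H_deriv_t DERIV_isCont isCont_def by blast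
  from order_tendstoD(2)[OF this assms] obtain d where d: "d > 0" "\<And>x. x \<noteq> t \<Longrightarrow> dist x t < d \<Longrightarrow> H x s < 0"
    unfolding eventually_at by auto
  then have "t < t + d / 2 \<and> H (t + d / 2) s < 0" by (simp add: dist_real_def)
  then show ?thesis by blast
qed

text \<open>A solution is found by maximising \<open>t\<close> over the compact region where \<open>H\<close> is nonpositive.\<close>

lemma ex_crit: "\<exists>t s. 0 < t \<and> 0 < s \<and> \<Psi> t s = 0 \<and> H t s = 0"
proof -
  define R where "R = {z. 0 \<le> fst z \<and> 0 \<le> snd z \<and> H (fst z) (snd z) \<le> 0}"
  define L where "L = ln (3 + 2 * c)"
  have "R \<subseteq> {0..L / (m1 - a)} \<times> {0..L / (m2 - b)}"
  proof
    fix z assume z: "z \<in> R"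
    then have "(m1 - a) * fst z + (m2 - b) * snd z \<le> L" "0 \<le> (m1 - a) * fst z" "0 \<le> (m2 - b) * snd z"
      using H_nonpos_imp_bounded[of "fst z" "snd z"] a b by (auto simp: R_def L_def)
    then have "(m1 - a) * fst z \<le> L" "(m2 - b) * snd z \<le> L" by auto
    then show "z \<in> {0..L / (m1 - a)} \<times> {0..L / (m2 - b)}"
      using z a b by (auto simp: R_def mem_Times_iff field_simps)
  qed
  moreover have "closed R"
    unfolding R_def by (intro closed_Collect_conj closed_Collect_le continuous_intros continuous_H)
  ultimately have "compact R"
    using compact_Int_closed[of "{0..L / (m1 - a)} \<times> {0..L / (m2 - b)}" R]
    by (simp add: compact_Times inf.absorb2)
  obtain s1 t1 where 1: "0 < s1" "0 < t1" "H t1 s1 < 0"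
    using ex_H_neg H_neg_extend by metis
  then have "(t1, s1) \<in> R" by (simp add: R_def)
  then obtain z where z: "z \<in> R" "\<And>y. y \<in> R \<Longrightarrow> fst y \<le> fst z"
    using continuous_attains_sup[OF \<open>compact R\<close> _ continuous_on_fst[OF continuous_on_id]] by blast
  define t s where "t = fst z" and "s = snd z"
  have "t1 \<le> t" using z(2)[OF \<open>(t1, s1) \<in> R\<close>] by (simp add: t_def)
  then have "0 < t" using 1 by simp
  \<comment> \<open>A negative value would persist for slightly larger t, against maximality. So
    \<open>H t\<close> is nonnegative and vanishes at s, which is an interior minimum once s = 0 is
    excluded.\<close>
  have nonneg: "0 \<le> H t r" if r: "0 \<le> r" for r
  proof (rule ccontr)
    assume "\<not> 0 \<le> H t r"
    then obtain t' where "t' > t" "H t' r < 0" using H_neg_extend[of t r] by auto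
    then have "(t', r) \<in> R" using \<open>0 < t\<close> r by (simp add: R_def)
    then show False using z(2) \<open>t' > t\<close> by (fastforce simp: t_def)
  qed
  have H0: "H t s = 0" using nonneg[of s] z(1) by (auto simp: R_def t_def s_def)
  have "s \<noteq> 0"
  proof
    assume "s = 0"
    have "sinh (a * t) < sinh (m1 * t)" using a \<open>0 < t\<close> by simp
    moreover have "0 < sinh (a * t)" "0 < sinh (m1 * t)" using a \<open>0 < t\<close> by simp_all
    then have "sinh (m1 * t) + sinh (a * t) \<noteq> 0" by linarith
    moreover have "sinh (m1 * t) - \<epsilon> * sinh (a * t) = 0" using H0 \<open>s = 0\<close> unfolding H_def by simp
    ultimately show False using eps_cases by (auto simp del: sinh_real_less_iff)
  qed
  then have "0 < s" using z(1) by (simp add: R_def s_def)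
  have "m2 * cosh (m1 * t + m2 * s) - \<epsilon> * b * sinh (a * t) * sinh (b * s) - c * b * cosh (a * t) * cosh (b * s) = 0"
    by (rule DERIV_local_min[OF H_deriv_s[of t s] \<open>0 < s\<close>]) (use nonneg H0 in auto)
  then have "\<Psi> t s = 0" using H0 by (simp add: \<Psi>_eq)
  then show ?thesis using \<open>0 < t\<close> \<open>0 < s\<close> H0 by blast
qed

text \<open>At the smaller of two critical times \<open>H\<close> is nonnegative for every s, so at
  the larger one it is strictly positive and cannot vanish. For equal times, strict monotonicity of
  \<Psi> leaves only one s.\<close>

lemma crit_unique:
  assumes "0 < t" "0 < s" "\<Psi> t s = 0" "H t s = 0"
    and "0 < t'" "0 < s'" "\<Psi> t' s' = 0" "H t' s' = 0"
  shows "t' = t \<and> s' = s"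
proof -
  have "\<not> u < u'" if "0 < u" "0 < r" "\<Psi> u r = 0" "H u r = 0" "0 < u'" "0 < r'" "H u' r' = 0"
    for u r u' r'
    using H_nonneg_of_crit[of u r r'] H_strict_mono_t[of u u' r'] that by auto
  then have "t' = t" using assms by (metis linorder_neqE_linordered_idom)
  then show ?thesis using \<Psi>_strict_mono[of t s s'] \<Psi>_strict_mono[of t s' s] assms
    by (cases s s' rule: linorder_cases) auto
qed

end

section \<open>Inequalities between combinations of hyperbolic sines\<close>

text \<open>The derivative of the ratio has the sign of a function \<open>U\<close> with \<open>U 0 = 0\<close> whose own derivative
  changes sign at most once, from negative to positive.\<close>

lemma sinh_ratio_combination_increasing:
  fixes x y z \<mu> :: real
  assumes xyz: "\<bar>z\<bar> < y" "y < x" and "0 \<le> \<mu>"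
    and t: "0 < t1" "t1 < t2" "t2 < t3"
    and le: "(sinh (x * t1) + \<mu> * sinh (z * t1)) / sinh (y * t1)
           \<le> (sinh (x * t2) + \<mu> * sinh (z * t2)) / sinh (y * t2)"
  shows "(sinh (x * t2) + \<mu> * sinh (z * t2)) / sinh (y * t2)
       < (sinh (x * t3) + \<mu> * sinh (z * t3)) / sinh (y * t3)"
proof -
  define k where "k t = (sinh (x * t) + \<mu> * sinh (z * t)) / sinh (y * t)" for t
  define U where "U t = (x * cosh (x * t) + \<mu> * (z * cosh (z * t))) * sinh (y * t)
      - (sinh (x * t) + \<mu> * sinh (z * t)) * (y * cosh (y * t))" for t
  define p where "p = x\<^sup>2 - y\<^sup>2"
  define q where "q = \<mu> * (y\<^sup>2 - z\<^sup>2)"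
  have "0 < y" using xyz by linarith
  have "y\<^sup>2 < x\<^sup>2" using xyz \<open>0 < y\<close> by (intro power_strict_mono) auto
  then have "0 < p" by (simp add: p_def)
  have "z\<^sup>2 < y\<^sup>2" using xyz \<open>0 < y\<close> using power_strict_mono[of "\<bar>z\<bar>" y 2] by simp
  then have "0 \<le> q" using assms by (simp add: q_def)
  have dU: "(U has_real_derivative sinh (y * t) * (p * sinh (x * t) - q * sinh (z * t))) (at t)" for t
    unfolding U_def p_def q_def by (auto intro!: derivative_eq_intros simp: algebra_simps power2_eq_square)
  have dk: "(k has_real_derivative U t / (sinh (y * t))\<^sup>2) (at t)" if "0 < t" for t
    using that \<open>0 < y\<close> unfolding k_def U_def power2_eq_square
    by (auto intro!: derivative_eq_intros)
  \<comment> \<open>For z > 0 the quotient sinh (x r) / sinh (z r) increases, so the difference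
    cannot return to 0; for z \<le> 0 both of its terms are nonnegative.\<close>
  have increasing: "0 < p * sinh (x * r) - q * sinh (z * r)" if "0 < s" "s < r" "0 \<le> p * sinh (x * s) - q * sinh (z * s)" for s r
  proof (cases "z \<le> 0")
    case True
    then have "sinh (z * r) \<le> 0" using that by (simp add: mult_nonpos_nonneg)
    then have "q * sinh (z * r) \<le> 0" using \<open>0 \<le> q\<close> by (rule mult_nonneg_nonpos[rotated])
    moreover have "0 < p * sinh (x * r)" using that \<open>0 < p\<close> \<open>0 < y\<close> xyz by simp
    ultimately show ?thesis by linarith
  next
    case False
    have "sinh (x * s) / sinh (z * s) < sinh (x * r) / sinh (z * r)"
    proof (rule DERIV_pos_imp_increasing[OF that(2)])
      fix u assume u: "s \<le> u" "u \<le> r"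
      have "0 < x * cosh (x * u) * sinh (z * u) - sinh (x * u) * (z * cosh (z * u))"
      proof -
        have "0 * cosh (x * 0) * sinh (z * 0) - sinh (x * 0) * (z * cosh (z * 0)) 
           < x * cosh (x * u) * sinh (z * u) - sinh (x * u) * (z * cosh (z * u))"
        proof -
          let ?w = "\<lambda>u. x * cosh (x * u) * sinh (z * u) - sinh (x * u) * (z * cosh (z * u))"
          have "?w 0 < ?w u"
          proof (rule DERIV_pos_imp_increasing_open[of 0 u ?w])
            show "0 < u" using u that by simp
            fix v assume v: "0 < v" "v < u"
            have "(?w has_real_derivative (x\<^sup>2 - z\<^sup>2) * (sinh (x * v) * sinh (z * v))) (at v)"
              by (auto intro!: derivative_eq_intros simp: algebra_simps power2_eq_square)
            moreover have "0 < (x\<^sup>2 - z\<^sup>2) * (sinh (x * v) * sinh (z * v))"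
              using \<open>y\<^sup>2 < x\<^sup>2\<close> \<open>z\<^sup>2 < y\<^sup>2\<close> False v xyz by simp
            ultimately show "\<exists>y. (?w has_real_derivative y) (at v) \<and> 0 < y" by blast
          qed (intro continuous_intros)
          then show ?thesis by simp
        qed
        then show ?thesis by simp
      qed
      moreover have "0 < sinh (z * u)" using u that False by simp
      ultimately have "0 < (x * cosh (x * u) * sinh (z * u) - sinh (x * u) * (z * cosh (z * u))) / (sinh (z * u) * sinh (z * u))"
        by simp
      moreover have "((\<lambda>u. sinh (x * u) / sinh (z * u)) has_real_derivative
         (x * cosh (x * u) * sinh (z * u) - sinh (x * u) * (z * cosh (z * u))) / (sinh (z * u) * sinh (z * u))) (at u)"
        using \<open>0 < sinh (z * u)\<close> by (auto intro!: derivative_eq_intros)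
      ultimately show "\<exists>y. ((\<lambda>u. sinh (x * u) / sinh (z * u)) has_real_derivative y) (at u) \<and> 0 < y" by blast
    qed
    moreover have s: "0 < sinh (z * s)" "0 < sinh (z * r)" using that False by simp_all
    moreover have "q \<le> p * (sinh (x * s) / sinh (z * s))" using that(3) s by (simp add: field_simps)
    ultimately have "q < p * (sinh (x * r) / sinh (z * r))"
      using \<open>0 < p\<close> by (smt (verit) mult_strict_left_mono)
    then show ?thesis using s by (simp add: field_simps)
  qed
  \<comment> \<open>The hypothesis is pulled back twice by the mean value theorem: to a point \<xi>
    where \<open>U\<close> is nonnegative, and from there, as \<open>U 0 = 0\<close>, to a point
    \<eta> < \<xi> where the derivative of \<open>U\<close> is nonnegative.\<close>
  obtain \<xi> where \<xi>: "t1 < \<xi>" "\<xi> < t2" "k t2 - k t1 = (t2 - t1) * (U \<xi> / (sinh (y * \<xi>))\<^sup>2)"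
    using MVT2[OF t(2), of k "\<lambda>r. U r / (sinh (y * r))\<^sup>2"] dk t(1) by force
  moreover have "k t1 \<le> k t2" using le by (simp add: k_def)
  ultimately have "0 \<le> (t2 - t1) * (U \<xi> / (sinh (y * \<xi>))\<^sup>2)" by linarith
  moreover have "0 < (sinh (y * \<xi>))\<^sup>2" using \<xi> t \<open>0 < y\<close> by simp
  ultimately have "0 \<le> U \<xi>" using t by (simp add: zero_le_mult_iff zero_le_divide_iff)
  have "0 < \<xi>" using \<xi> t by simp
  obtain \<eta> where \<eta>: "0 < \<eta>" "\<eta> < \<xi>" "U \<xi> - U 0 = (\<xi> - 0) * (sinh (y * \<eta>) * (p * sinh (x * \<eta>) - q * sinh (z * \<eta>)))"
    using MVT2[OF \<open>0 < \<xi>\<close> dU] by blast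
  have "U 0 = 0" by (simp add: U_def)
  then have "0 \<le> \<xi> * (sinh (y * \<eta>) * (p * sinh (x * \<eta>) - q * sinh (z * \<eta>)))" using \<eta> \<open>0 \<le> U \<xi>\<close> by simp
  moreover have "0 < sinh (y * \<eta>)" using \<eta> \<open>0 < y\<close> by simp
  ultimately have g: "0 \<le> p * sinh (x * \<eta>) - q * sinh (z * \<eta>)" using \<open>0 < \<xi>\<close>
    by (simp only: zero_le_mult_iff) auto
  have Upos: "0 < U r" if "\<xi> < r" for r
  proof -
    have "U \<xi> < U r"
    proof (rule DERIV_pos_imp_increasing[OF that])
      fix u assume "\<xi> \<le> u" "u \<le> r"
      then have "0 < sinh (y * u) * (p * sinh (x * u) - q * sinh (z * u))"
        using increasing[of \<eta> u] g \<eta> \<open>0 < y\<close> by simp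
      then show "\<exists>y. (U has_real_derivative y) (at u) \<and> 0 < y" using dU by blast
    qed
    then show ?thesis using \<open>0 \<le> U \<xi>\<close> by linarith
  qed
  have "k t2 < k t3"
  proof (rule DERIV_pos_imp_increasing[OF t(3)])
    fix u assume u: "t2 \<le> u" "u \<le> t3"
    then have "0 < U u / (sinh (y * u))\<^sup>2" using Upos[of u] \<xi> t \<open>0 < y\<close> by simp
    then show "\<exists>y. (k has_real_derivative y) (at u) \<and> 0 < y" using dk[of u] u t by auto
  qed
  then show ?thesis by (simp add: k_def)
qed

lemma sinh_superlinear:
  fixes u x t :: real
  assumes "0 \<le> u" "u \<le> x" "0 < x" "0 \<le> t"
  shows "sinh (u * t) \<le> u / x * sinh (x * t)"
proof -
  have "x * sinh (u * 0) - u * sinh (x * 0) \<ge> x * sinh (u * t) - u * sinh (x * t)"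
  proof (rule DERIV_nonpos_imp_nonincreasing[OF assms(4)])
    fix r assume r: "0 \<le> r" "r \<le> t"
    have "cosh (u * r) \<le> cosh (x * r)" using assms r
      by (subst cosh_real_nonneg_le_iff) (auto intro: mult_right_mono)
    then have "x * u * (cosh (u * r) - cosh (x * r)) \<le> 0" using assms by (simp add: mult_nonneg_nonpos)
    moreover have "((\<lambda>r. x * sinh (u * r) - u * sinh (x * r)) has_real_derivative x * u * (cosh (u * r) - cosh (x * r))) (at r)"
      by (auto intro!: derivative_eq_intros simp: algebra_simps)
    ultimately show "\<exists>y. ((\<lambda>r. x * sinh (u * r) - u * sinh (x * r)) has_real_derivative y) (at r) \<and> y \<le> 0" by blast
  qed
  then show ?thesis using assms by (simp add: field_simps)
qed

lemma convex_on_sinh: "convex_on {0..} (sinh :: real \<Rightarrow> real)"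
  by (rule f''_ge0_imp_convex[where f' = cosh and f'' = sinh])
     (auto intro!: derivative_eq_intros)

text \<open>The inequality between the slopes at 0 propagates to all t. For z \<ge> 0 this is Jensen
  with weights 1 / (1 + \<mu>) and \<mu> / (1 + \<mu>). For z < 0 the point z t leaves the half-line
  where sinh is convex, so sinh (y t) and sinh (-z t) are compared with sinh (x t)
  separately.\<close>

lemma sinh_le_combination:
  fixes x y z \<mu> t :: real
  assumes xyz: "\<bar>z\<bar> < y" "y < x" and "0 \<le> \<mu>" "0 \<le> t" and le: "(1 + \<mu>) * y \<le> x + \<mu> * z"
  shows "(1 + \<mu>) * sinh (y * t) \<le> sinh (x * t) + \<mu> * sinh (z * t)"
proof (cases "0 \<le> z")
  case True
  have "y \<le> (x + \<mu> * z) / (1 + \<mu>)" using le assms by (simp add: pos_le_divide_eq mult.commute)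
  then have "y \<le> (1 / (1 + \<mu>)) * x + (\<mu> / (1 + \<mu>)) * z" by (simp add: add_divide_distrib)
  then have "y * t \<le> ((1 / (1 + \<mu>)) * x + (\<mu> / (1 + \<mu>)) * z) * t" using assms(4) by (rule mult_right_mono)
  also have "\<dots> = (1 / (1 + \<mu>)) * (x * t) + (\<mu> / (1 + \<mu>)) * (z * t)" by (simp add: algebra_simps)
  finally have "sinh (y * t) \<le> sinh ((1 / (1 + \<mu>)) * (x * t) + (\<mu> / (1 + \<mu>)) * (z * t))"
    by simp
  also have "\<dots> \<le> (1 / (1 + \<mu>)) * sinh (x * t) + (\<mu> / (1 + \<mu>)) * sinh (z * t)"
    using convex_onD[OF convex_on_sinh, of "\<mu> / (1 + \<mu>)" "x * t" "z * t"] assms True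
    by (simp add: field_simps)
  also have "\<dots> = (sinh (x * t) + \<mu> * sinh (z * t)) / (1 + \<mu>)" by (simp add: add_divide_distrib)
  finally show ?thesis using assms by (simp add: pos_le_divide_eq mult.commute)
next
  case False
  have "0 < y" "0 < x" using xyz by linarith+
  have "sinh (y * t) \<le> y / x * sinh (x * t)" using sinh_superlinear[of y x t] xyz assms by simp
  then have "(1 + \<mu>) * sinh (y * t) \<le> (1 + \<mu>) * (y / x * sinh (x * t))" 
    using assms by (intro mult_left_mono) auto
  moreover have "sinh (- z * t) \<le> - z / x * sinh (x * t)" using sinh_superlinear[of "-z" x t] xyz False assms by simp
  then have "\<mu> * sinh (- z * t) \<le> \<mu> * (- z / x * sinh (x * t))" using assms by (intro mult_left_mono) auto
  moreover have "((1 + \<mu>) * y - \<mu> * z) / x * sinh (x * t) \<le> 1 * sinh (x * t)"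
    using le \<open>0 < x\<close> assms by (intro mult_right_mono) (auto simp: field_simps)
  ultimately show ?thesis by (simp add: algebra_simps add_divide_distrib diff_divide_distrib)
qed

section \<open>Zeros of the level curve on the diagonal\<close>

context level_curve
begin

text \<open>The addition theorems leave three frequencies with |a - b| < a + b < m1 + m2. Division
  by the middle term yields the ratio of \<open>sinh_ratio_combination_increasing\<close>.\<close>

lemma H_diag:
  "H t t = sinh ((m1 + m2) * t) + (c - \<epsilon>) / 2 * sinh ((a - b) * t) - (c + \<epsilon>) / 2 * sinh ((a + b) * t)"
proof -
  have "sinh ((a + b) * t) = sinh (a * t) * cosh (b * t) + cosh (a * t) * sinh (b * t)"
    "sinh ((a - b) * t) = sinh (a * t) * cosh (b * t) - cosh (a * t) * sinh (b * t)"
    by (simp_all only: distrib_right left_diff_distrib sinh_add sinh_diff)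
  then show ?thesis unfolding H_def distrib_right[of m1 m2 t, symmetric] by (simp only:) (simp add: field_simps)
qed

lemma H_diag_ratio:
  assumes "0 < t"
  shows "H t t = ((sinh ((m1 + m2) * t) + (c - \<epsilon>) / 2 * sinh ((a - b) * t)) / sinh ((a + b) * t)
            - (c + \<epsilon>) / 2) * sinh ((a + b) * t)"
  using assms a b by (simp add: H_diag left_diff_distrib)

text \<open>The zeros are the times at which that ratio equals (c + \<epsilon>) / 2. It is below
  this value at r, so from the first time it reaches the value it increases strictly.\<close>

lemma H_diag_zero_unique:
  assumes "0 < r" "H r r < 0" "r < t" "H t t = 0" "r < t'" "H t' t' = 0"
  shows "t' = t"
proof -
  define k where "k t = (sinh ((m1 + m2) * t) + (c - \<epsilon>) / 2 * sinh ((a - b) * t)) / sinh ((a + b) * t)" for t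
  have pos: "0 < sinh ((a + b) * u)" if "0 < u" for u using that a b by simp
  have kr: "k r < (c + \<epsilon>) / 2"
    using assms(2) H_diag_ratio[OF assms(1), folded k_def] pos[OF assms(1)]
      mult_less_0_iff[of "k r - (c + \<epsilon>) / 2" "sinh ((a + b) * r)"] by linarith
  have k0: "k u = (c + \<epsilon>) / 2" if "r < u" "H u u = 0" for u
    using H_diag_ratio[of u, folded k_def] pos[of u] that assms(1) by (auto simp del: sinh_real_pos_iff)
  have "\<not> u < u'" if "r < u" "H u u = 0" "H u' u' = 0" for u u'
  proof
    assume "u < u'"
    have "\<bar>a - b\<bar> < a + b" "a + b < m1 + m2" "0 \<le> (c - \<epsilon>) / 2" using a b c_gt_1 eps_cases by auto
    moreover have "k r \<le> k u" using kr k0[of u] that by simp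
    ultimately have "k u < k u'"
      using sinh_ratio_combination_increasing[of "a - b" "a + b" "m1 + m2" "(c - \<epsilon>) / 2" r u u', folded k_def]
        assms(1) that \<open>u < u'\<close> by simp
    then show False using k0[of u] k0[of u'] that \<open>u < u'\<close> by simp
  qed
  then show ?thesis using assms by (metis linorder_neqE_linordered_idom)
qed

lemma H_diag_zero_exists:
  assumes "0 < r" "H r r < 0"
  shows "\<exists>t>r. H t t = 0"
proof -
  \<comment> \<open>So far out that \<open>H_nonpos_imp_bounded\<close> rules out a nonpositive
    value; the summand 1 makes the comparison strict.\<close>
  define u where "u = max r (ln (3 + 2 * c) / (m1 - a) + 1)"
  have "u \<ge> 0" "r \<le> u" using assms by (auto simp: u_def)
  have "ln (3 + 2 * c) < (m1 - a) * u"
  proof -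
    have "ln (3 + 2 * c) / (m1 - a) < u" by (auto simp: u_def)
    then show ?thesis using a by (simp add: field_simps)
  qed
  moreover have "0 \<le> (m2 - b) * u" using b \<open>u \<ge> 0\<close> by simp
  ultimately have "0 \<le> H u u" using H_nonpos_imp_bounded[of u u] \<open>u \<ge> 0\<close> by fastforce
  moreover have "continuous_on {r..u} (\<lambda>t. H t t)" unfolding H_def by (intro continuous_intros)
  ultimately obtain t where "r \<le> t" "t \<le> u" "H t t = 0"
    using IVT'[of "\<lambda>t. H t t" r 0 u] assms \<open>r \<le> u\<close> by auto
  then show ?thesis using assms by (metis less_eq_real_def less_irrefl)
qed

text \<open>A nonnegative slope at 0 would make \<open>H t t\<close> nonnegative for all t by
  \<open>sinh_le_combination\<close>. That lemma needs (c + \<epsilon>) / 2 = 1 + (c - \<epsilon>) /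
  2, that is \<epsilon> = 1; it is what gives uniqueness among all t > 0 in case (ii).\<close>

lemma H_diag_neg_near_zero:
  assumes "\<epsilon> = 1" "0 < r" "H r r < 0"
  shows "\<exists>d>0. \<forall>t. 0 < t \<longrightarrow> t < d \<longrightarrow> H t t < 0"
proof -
  define \<mu> where "\<mu> = (c - 1) / 2"
  have D: "H t t = sinh ((m1 + m2) * t) + \<mu> * sinh ((a - b) * t) - (1 + \<mu>) * sinh ((a + b) * t)" for t
    unfolding H_diag unfolding assms(1) \<mu>_def by (simp add: field_simps)
  have "\<bar>a - b\<bar> < a + b" using a b by linarith
  then have "\<not> (1 + \<mu>) * (a + b) \<le> (m1 + m2) + \<mu> * (a - b)"
    using sinh_le_combination[of "a - b" "a + b" "m1 + m2" \<mu> r] a b c_gt_1 assms(2,3) D[of r]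
    by (auto simp: \<mu>_def)
  moreover have "((\<lambda>t. H t t) has_real_derivative (m1 + m2) + \<mu> * (a - b) - (1 + \<mu>) * (a + b)) (at 0)"
    unfolding D by (auto intro!: derivative_eq_intros)
  ultimately obtain d where "d > 0" "\<And>h. 0 < h \<Longrightarrow> h < d \<Longrightarrow> H (0 + h) (0 + h) < H 0 0"
    using DERIV_neg_dec_right[of "\<lambda>t. H t t" "(m1 + m2) + \<mu> * (a - b) - (1 + \<mu>) * (a + b)" 0] by auto
  moreover have "H 0 0 = 0" by (simp add: H_def)
  ultimately show ?thesis by auto
qed

lemma H_diag_zero_unique_pos:
  assumes "\<epsilon> = 1" "0 < r" "H r r < 0" "0 < t" "H t t = 0" "0 < t'" "H t' t' = 0"
  shows "t' = t"
proof -
  obtain d where d: "d > 0" "\<And>u. 0 < u \<Longrightarrow> u < d \<Longrightarrow> H u u < 0"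
    using H_diag_neg_near_zero[OF assms(1-3)] by auto
  define u where "u = min d (min t t') / 2"
  have "0 < u" "u < d" "u < t" "u < t'" using d assms by (auto simp: u_def)
  then show ?thesis using H_diag_zero_unique[of u t t'] d assms by auto
qed

lemma H_crit_diag_neg:
  assumes "0 < s" "s < t" "H t s = 0"
  shows "H s s < 0"
  using H_strict_mono_t[of s t s] assms by force

text \<open>First \<tau> \<le> t, since beyond t everything is positive by criticality. Then
  \<open>H \<tau> s\<close> is nonpositive, for otherwise \<open>H t s\<close> would be positive. At
  fixed \<tau> the quotient thus rises from a nonpositive value at s to 0 at \<tau>, and stays
  positive afterwards.\<close>

lemma H_nonneg_above_diag_zero:
  assumes "0 < s" "s < t" "\<Psi> t s = 0" "H t s = 0" "s < \<tau>" "H \<tau> \<tau> = 0" "\<tau> \<le> s'"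
  shows "0 \<le> H \<tau> s'"
proof (cases "\<tau> = s'")
  case False
  have "\<tau> \<le> t"
    using H_nonneg_of_crit[of t s \<tau>] H_strict_mono_t[of t \<tau> \<tau>] assms by force
  then have "H \<tau> s \<le> 0"
    using H_strict_mono_t[of \<tau> t s] assms by (cases "\<tau> = t") force+
  then show ?thesis using H_pos_beyond[of \<tau> s \<tau> s'] assms False by simp
qed (use assms in simp)

end

section \<open>The equations defining the threshold\<close>

context level_curve
begin

lemma ex_unique_crit:
  "\<exists>t s. is_unique_sol (\<lambda>(t, s). 0 < t \<and> 0 < s \<and> \<Psi> t s = 0 \<and> H t s = 0) (t, s)"
proof -
  obtain t s where "0 < t" "0 < s" "\<Psi> t s = 0" "H t s = 0" using ex_crit by blast
  moreover have "y = (t, s)" if "case y of (t, s) \<Rightarrow> 0 < t \<and> 0 < s \<and> \<Psi> t s = 0 \<and> H t s = 0" for y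
    using crit_unique[OF calculation, of "fst y" "snd y"] that by (cases y) simp
  ultimately have "is_unique_sol (\<lambda>(t, s). 0 < t \<and> 0 < s \<and> \<Psi> t s = 0 \<and> H t s = 0) (t, s)"
    unfolding is_unique_sol_def by blast
  then show ?thesis by blast
qed

text \<open>The number r is the lower end of the range in which the diagonal zero is sought: s in
  case (iii), 0 in case (ii). When s < t, a zero exists because \<open>H s s\<close> is
  negative.\<close>

lemma ex1_threshold:
  assumes "0 < t" "0 < s" "\<Psi> t s = 0" "H t s = 0" and r: "r = s \<or> \<epsilon> = 1 \<and> r = 0"
  shows "\<exists>!\<tau>. (t \<le> s \<longrightarrow> \<tau> = t) \<and> (s < t \<longrightarrow> is_unique_sol (\<lambda>t. r < t \<and> H t t = 0) \<tau>)"
proof (cases "s < t")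
  case True
  have "H s s < 0" using H_crit_diag_neg assms True by blast
  then obtain u where u: "s < u" "H u u = 0" using H_diag_zero_exists assms by blast
  have uniq: "u' = u" if "r < u'" "H u' u' = 0" for u'
    using r
  proof
    assume "r = s"
    then show ?thesis using H_diag_zero_unique[OF \<open>0 < s\<close> \<open>H s s < 0\<close> u] that by simp
  next
    assume "\<epsilon> = 1 \<and> r = 0"
    then show ?thesis using H_diag_zero_unique_pos[OF _ \<open>0 < s\<close> \<open>H s s < 0\<close>, of u u'] that u assms by simp
  qed
  have "r < u" using r u assms by auto
  then have *: "is_unique_sol (\<lambda>t. r < t \<and> H t t = 0) u"
    using u uniq unfolding is_unique_sol_def by blast
  then have "\<tau> = u" if "is_unique_sol (\<lambda>t. r < t \<and> H t t = 0) \<tau>" for \<tau>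
    using that unfolding is_unique_sol_def by blast
  moreover have "\<not> t \<le> s" using True by simp
  ultimately show ?thesis using True * by blast
qed auto

lemma threshold_nonneg:
  assumes "0 < t" "0 < s" "\<Psi> t s = 0" "H t s = 0" "r \<le> s"
    and "t \<le> s \<longrightarrow> \<tau> = t" and "s < t \<longrightarrow> is_unique_sol (\<lambda>t. r < t \<and> H t t = 0) \<tau>"
  shows "0 < \<tau> \<and> (\<forall>s'\<ge>\<tau>. 0 \<le> H \<tau> s')"
proof (cases "s < t")
  case True
  have "H s s < 0" using H_crit_diag_neg assms True by blast
  then obtain u where u: "s < u" "H u u = 0" using H_diag_zero_exists assms by blast
  then have "r < u \<and> H u u = 0" using assms(5) by simp
  then have "\<tau> = u" using True assms(7) unfolding is_unique_sol_def by metis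
  then show ?thesis using H_nonneg_above_diag_zero[OF assms(2) True assms(3,4), of u] u assms by auto
next
  case False
  then show ?thesis using assms H_nonneg_of_crit[of t s] by auto
qed

end

section \<open>The exponential equations in terms of \<open>H\<close> and \<Psi>\<close>

lemma ratio_eq_iff:
  fixes n d x p q :: real
  assumes "0 < d" "0 < p"
  shows "n / d * x = q / p \<longleftrightarrow> p * (n * x) - q * d = 0"
  using assms by (auto simp: field_simps)

text \<open>E and \<alpha> stand for the exponentials of (p1 + q1) t / 2 and (q1 - p1) t / 2, P and
  Q for those of p2 s and q2 s. The left side is the critical equation with its denominator cleared;
  the bracket on the right is 4 \<Psi> for \<epsilon> = 1.\<close>

lemma rational_identity_ii:
  fixes E \<alpha> P Q p2 q2 :: real
  assumes pos: "0 < E" "0 < \<alpha>" "0 < P" "0 < Q"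
  shows "p2 * ((E / \<alpha> - 1 / Q) * (E * \<alpha> + 1 / Q) * (Q / P)) - q2 * ((E / \<alpha> - 1 / P) * (E * \<alpha> + 1 / P))
    = (E / P) * (p2 * (E * Q - 1 / (E * Q)) - q2 * (E * P - 1 / (E * P)) + (q2 - p2) * (\<alpha> - 1 / \<alpha>))"
  using pos by (simp add: divide_simps) algebra

lemma rational_identity_iii:
  fixes E \<alpha> P Q p2 q2 :: real
  assumes pos: "0 < E" "0 < \<alpha>" "0 < P" "0 < Q"
  shows "p2 * ((Q * (E / \<alpha>) + 1) * (Q * (E * \<alpha>) - 1) * (P / Q)) - q2 * ((P * (E / \<alpha>) + 1) * (P * (E * \<alpha>) - 1))
    = (E * P) * (p2 * (E * Q - 1 / (E * Q)) - q2 * (E * P - 1 / (E * P)) - (q2 - p2) * (\<alpha> - 1 / \<alpha>))"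
  using pos by (simp add: divide_simps) algebra

lemma two_sinh: "2 * sinh x = exp x - 1 / exp (x :: real)"
  by (simp add: sinh_field_def exp_minus inverse_eq_divide)

text \<open>The assumption on c says that \<kappa> lies to the right of the interval for \<epsilon>
  = 1 and to its left for \<epsilon> = -1.\<close>

locale hyperbolic_pair =
  fixes p1 q1 p2 q2 \<kappa> \<epsilon> c :: real
  assumes pq1: "0 < p1" "p1 < q1" and pq2: "0 < p2" "p2 < q2"
    and eps: "\<bar>\<epsilon>\<bar> = 1" and kappa: "2 * \<kappa> - 1 = \<epsilon> * c" and c: "p2 + q2 < c * (q2 - p2)"
begin

sublocale level_curve "(p1 + q1) / 2" "(p2 + q2) / 2" "(q1 - p1) / 2" "(q2 - p2) / 2" c \<epsilon>
  by unfold_locales (use pq1 pq2 eps c in auto)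

text \<open>T is the difference of the diagonal entries of a cycle, and R is the square root of its
  determinant. The two identities factor the difference of the two sides of \<open>norm_eq\<close>;
  only the factor with \<open>H\<close> can vanish.\<close>

lemma signed_trace_eqs:
  fixes t s :: real
  defines "T \<equiv> \<kappa> * (exp (- p1 * t - p2 * s) - exp (- q1 * t - q2 * s))
                - (\<kappa> - 1) * (exp (- p1 * t - q2 * s) - exp (- p2 * s - q1 * t))"
    and "R \<equiv> exp (- ((p1 + q1) / 2 * t + (p2 + q2) / 2 * s))"
  shows "1 - exp (- (p1 + q1) * t - (p2 + q2) * s) - \<epsilon> * T = 2 * R * H t s"
    and "1 - exp (- (p1 + q1) * t - (p2 + q2) * s) + \<epsilon> * T
      = 2 * R * (sinh ((p1 + q1) / 2 * t + (p2 + q2) / 2 * s) 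
           + \<epsilon> * sinh ((q1 - p1) / 2 * t) * cosh ((q2 - p2) / 2 * s)
           + c * cosh ((q1 - p1) / 2 * t) * sinh ((q2 - p2) / 2 * s))"
proof -
  define A where "A = (q1 - p1) / 2 * t"
  define B where "B = (q2 - p2) / 2 * s"
  define \<theta> where "\<theta> = (p1 + q1) / 2 * t + (p2 + q2) / 2 * s"
  have R: "R = exp (- \<theta>)" by (simp add: R_def \<theta>_def)
  have e: "exp (- p1 * t - p2 * s) = R * exp (A + B)" "exp (- q1 * t - q2 * s) = R * exp (- (A + B))"
    "exp (- p1 * t - q2 * s) = R * exp (A - B)" "exp (- p2 * s - q1 * t) = R * exp (- (A - B))"
    "exp (- (p1 + q1) * t - (p2 + q2) * s) = R * exp (- \<theta>)"
    by (simp_all add: R A_def B_def \<theta>_def field_simps flip: exp_add)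
  have "R * exp \<theta> = 1" by (simp add: R flip: exp_add)
  then have D: "1 - exp (- (p1 + q1) * t - (p2 + q2) * s) = 2 * R * sinh \<theta>"
    unfolding e sinh_field_def by (simp add: algebra_simps)
  have "T = 2 * R * (\<kappa> * sinh (A + B) - (\<kappa> - 1) * sinh (A - B))"
    unfolding T_def e sinh_field_def by (simp add: field_simps)
  also have "\<dots> = 2 * R * (sinh A * cosh B + (2 * \<kappa> - 1) * (cosh A * sinh B))"
    by (simp add: sinh_add sinh_diff algebra_simps)
  finally have "\<epsilon> * T = 2 * R * (\<epsilon> * (sinh A * cosh B) + (\<epsilon> * \<epsilon>) * c * (cosh A * sinh B))"
    unfolding kappa by (simp add: algebra_simps)
  moreover have "\<epsilon> * \<epsilon> = 1" using eps_cases by auto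
  ultimately have T: "\<epsilon> * T = 2 * R * (\<epsilon> * (sinh A * cosh B) + c * (cosh A * sinh B))" by simp
  show "1 - exp (- (p1 + q1) * t - (p2 + q2) * s) - \<epsilon> * T = 2 * R * H t s"
    "1 - exp (- (p1 + q1) * t - (p2 + q2) * s) + \<epsilon> * T
      = 2 * R * (sinh ((p1 + q1) / 2 * t + (p2 + q2) / 2 * s) 
           + \<epsilon> * sinh ((q1 - p1) / 2 * t) * cosh ((q2 - p2) / 2 * s)
           + c * cosh ((q1 - p1) / 2 * t) * sinh ((q2 - p2) / 2 * s))"
    unfolding D T H_def A_def[symmetric] B_def[symmetric] \<theta>_def[symmetric] by (simp_all add: algebra_simps)
qed

text \<open>Positive rates make \<theta> exceed A + B, so sinh \<theta> alone outweighs sinh A cosh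
  B, the only term that can be negative.\<close>

lemma conjugate_factor_pos:
  assumes "0 \<le> t" "0 < s"
  shows "0 < sinh ((p1 + q1) / 2 * t + (p2 + q2) / 2 * s) 
           + \<epsilon> * sinh ((q1 - p1) / 2 * t) * cosh ((q2 - p2) / 2 * s)
           + c * cosh ((q1 - p1) / 2 * t) * sinh ((q2 - p2) / 2 * s)"
proof -
  define A where "A = (q1 - p1) / 2 * t"
  define B where "B = (q2 - p2) / 2 * s"
  define \<theta> where "\<theta> = (p1 + q1) / 2 * t + (p2 + q2) / 2 * s"
  have AB: "0 \<le> A" "0 < B" using assms pq1 pq2 by (auto simp: A_def B_def)
  have "\<theta> - (A + B) = p1 * t + p2 * s" by (simp add: \<theta>_def A_def B_def field_simps)
  moreover have "0 \<le> p1 * t" "0 < p2 * s" using assms pq1 pq2 by auto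
  ultimately have "A + B < \<theta>" by linarith
  then have "sinh A * cosh B + cosh A * sinh B < sinh \<theta>" by (simp flip: sinh_add)
  moreover have "0 < cosh A * sinh B" using AB by simp
  moreover have "0 < c * (cosh A * sinh B)" using calculation(2) c_gt_1 by simp
  moreover have "0 \<le> sinh A * cosh B" using AB by simp
  ultimately have "0 < sinh \<theta> + \<epsilon> * (sinh A * cosh B) + c * (cosh A * sinh B)"
    using eps_cases by (elim disjE) (hypsubst, linarith)+
  then show ?thesis unfolding A_def B_def \<theta>_def by (simp add: mult.assoc)
qed

text \<open>Here \<delta> plays the role of det M, whose sign disappears in the square.\<close>

lemma norm_eq_iff:
  assumes "0 < t" "0 < s" and \<delta>: "\<bar>\<delta>\<bar> = 1" "ad = \<delta> * \<kappa>" "bc = \<delta> * (\<kappa> - 1)"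
  shows "norm_eq p1 q1 p2 q2 ad bc t s \<longleftrightarrow> H t s = 0"
proof -
  define T where "T = \<kappa> * (exp (- p1 * t - p2 * s) - exp (- q1 * t - q2 * s))
                - (\<kappa> - 1) * (exp (- p1 * t - q2 * s) - exp (- p2 * s - q1 * t))"
  define D where "D = 1 - exp (- (p1 + q1) * t - (p2 + q2) * s)"
  have "\<delta>\<^sup>2 = 1" using \<delta>(1) by (metis one_power2 power2_abs)
  have "\<epsilon>\<^sup>2 = 1" using eps by (metis one_power2 power2_abs)
  have "norm_eq p1 q1 p2 q2 ad bc t s \<longleftrightarrow> (\<delta> * T)\<^sup>2 = (- D)\<^sup>2"
    unfolding norm_eq_def T_def D_def \<delta> by (simp add: algebra_simps)
  also have "\<dots> \<longleftrightarrow> D\<^sup>2 - \<epsilon>\<^sup>2 * T\<^sup>2 = 0"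
    using \<open>\<delta>\<^sup>2 = 1\<close> \<open>\<epsilon>\<^sup>2 = 1\<close> by (auto simp: power_mult_distrib)
  also have "D\<^sup>2 - \<epsilon>\<^sup>2 * T\<^sup>2 = (D - \<epsilon> * T) * (D + \<epsilon> * T)" by algebra
  also have "\<dots> = 0 \<longleftrightarrow> H t s = 0"
    unfolding D_def T_def signed_trace_eqs using conjugate_factor_pos[of t s] assms by simp
  finally show ?thesis .
qed

lemma \<Psi>_exponents:
  "2 * \<Psi> t s = p2 * sinh ((p1 + q1) / 2 * t + q2 * s) - q2 * sinh ((p1 + q1) / 2 * t + p2 * s)
     + \<epsilon> * (q2 - p2) * sinh ((q1 - p1) / 2 * t)"
proof -
  define B where "B = (q2 - p2) / 2 * s"
  define \<theta> where "\<theta> = (p1 + q1) / 2 * t + (p2 + q2) / 2 * s"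
  have 1: "(p1 + q1) / 2 * t + q2 * s = \<theta> + B" "(p1 + q1) / 2 * t + p2 * s = \<theta> - B"
    by (simp_all add: \<theta>_def B_def field_simps)
  show ?thesis unfolding \<Psi>_def 1 B_def[symmetric] \<theta>_def[symmetric] sinh_add sinh_diff
    by (simp add: field_simps)
qed

text \<open>For t, s > 0 the denominator is positive because exp (p1 t) > 1 > exp (-p2 s); clearing
  it leaves a positive multiple of \<Psi>.\<close>

lemma crit_eq_ii_iff:
  assumes "0 < t" "0 < s" "\<epsilon> = 1"
  shows "crit_eq_ii p1 q1 p2 q2 t s \<longleftrightarrow> \<Psi> t s = 0"
proof -
  define E where "E = exp ((p1 + q1) / 2 * t)"
  define \<alpha> where "\<alpha> = exp ((q1 - p1) / 2 * t)"
  define P where "P = exp (p2 * s)"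
  define Q where "Q = exp (q2 * s)"
  have pos: "0 < E" "0 < \<alpha>" "0 < P" "0 < Q" by (simp_all add: E_def \<alpha>_def P_def Q_def)
  have e: "exp (p1 * t) = E / \<alpha>" "exp (q1 * t) = E * \<alpha>" "exp (- q2 * s) = 1 / Q" "exp (- p2 * s) = 1 / P"
    "exp ((q2 - p2) * s) = Q / P"
    by (simp_all add: E_def \<alpha>_def P_def Q_def exp_minus field_simps flip: exp_add exp_diff)
  have S: "4 * \<Psi> t s = p2 * (E * Q - 1 / (E * Q)) - q2 * (E * P - 1 / (E * P)) + (q2 - p2) * (\<alpha> - 1 / \<alpha>)"
  proof -
    have "2 * sinh ((p1 + q1) / 2 * t + q2 * s) = E * Q - 1 / (E * Q)"
      "2 * sinh ((p1 + q1) / 2 * t + p2 * s) = E * P - 1 / (E * P)"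
      "2 * sinh ((q1 - p1) / 2 * t) = \<alpha> - 1 / \<alpha>"
      by (simp_all only: two_sinh E_def \<alpha>_def P_def Q_def exp_add)
    moreover have "4 * \<Psi> t s = p2 * (2 * sinh ((p1 + q1) / 2 * t + q2 * s))
        - q2 * (2 * sinh ((p1 + q1) / 2 * t + p2 * s)) + (q2 - p2) * (2 * sinh ((q1 - p1) / 2 * t))"
    proof -
      have "\<epsilon> * (q2 - p2) = (q2 - p2)" using assms(3) by simp
      with \<Psi>_exponents[of t s]
      have "2 * \<Psi> t s = p2 * sinh ((p1 + q1) / 2 * t + q2 * s) - q2 * sinh ((p1 + q1) / 2 * t + p2 * s)
        + (q2 - p2) * sinh ((q1 - p1) / 2 * t)" by simp
      then show ?thesis by linarith
    qed
    ultimately show ?thesis by (simp only:)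
  qed
  have "1 < exp (p1 * t)" "exp (- p2 * s) < 1" using assms pq1 pq2 by simp_all
  have D: "0 < (E / \<alpha> - 1 / P) * (E * \<alpha> + 1 / P)"
  proof -
    have "1 < E / \<alpha>" "1 / P < 1" using \<open>1 < exp (p1 * t)\<close> \<open>exp (- p2 * s) < 1\<close> by (simp_all only: e)
    then have "0 < E / \<alpha> - 1 / P" by linarith
    moreover have "0 < E * \<alpha> + 1 / P" using pos by (simp add: add_pos_pos)
    ultimately show ?thesis by (rule mult_pos_pos)
  qed
  have "crit_eq_ii p1 q1 p2 q2 t s \<longleftrightarrow>
      p2 * ((E / \<alpha> - 1 / Q) * (E * \<alpha> + 1 / Q) * (Q / P)) - q2 * ((E / \<alpha> - 1 / P) * (E * \<alpha> + 1 / P)) = 0"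
    unfolding crit_eq_ii_def e by (rule ratio_eq_iff[OF D pq2(1)])
  also have "p2 * ((E / \<alpha> - 1 / Q) * (E * \<alpha> + 1 / Q) * (Q / P)) - q2 * ((E / \<alpha> - 1 / P) * (E * \<alpha> + 1 / P))
     = (E / P) * (4 * \<Psi> t s)"
    by (simp only: S rational_identity_ii[OF pos])
  finally show ?thesis using pos by simp
qed

lemma crit_eq_iii_iff:
  assumes "0 < t" "0 < s" "\<epsilon> = -1"
  shows "crit_eq_iii p1 q1 p2 q2 t s \<longleftrightarrow> \<Psi> t s = 0"
proof -
  define E where "E = exp ((p1 + q1) / 2 * t)"
  define \<alpha> where "\<alpha> = exp ((q1 - p1) / 2 * t)"
  define P where "P = exp (p2 * s)"
  define Q where "Q = exp (q2 * s)"
  have pos: "0 < E" "0 < \<alpha>" "0 < P" "0 < Q" by (simp_all add: E_def \<alpha>_def P_def Q_def)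
  have e: "exp (q2 * s + p1 * t) = Q * (E / \<alpha>)" "exp (q2 * s + q1 * t) = Q * (E * \<alpha>)"
    "exp (p2 * s + p1 * t) = P * (E / \<alpha>)" "exp (p2 * s + q1 * t) = P * (E * \<alpha>)"
    "exp (- (q2 - p2) * s) = P / Q"
    by (simp_all add: E_def \<alpha>_def P_def Q_def field_simps flip: exp_add exp_diff)
  have S: "4 * \<Psi> t s = p2 * (E * Q - 1 / (E * Q)) - q2 * (E * P - 1 / (E * P)) - (q2 - p2) * (\<alpha> - 1 / \<alpha>)"
  proof -
    have "2 * sinh ((p1 + q1) / 2 * t + q2 * s) = E * Q - 1 / (E * Q)"
      "2 * sinh ((p1 + q1) / 2 * t + p2 * s) = E * P - 1 / (E * P)"
      "2 * sinh ((q1 - p1) / 2 * t) = \<alpha> - 1 / \<alpha>"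
      by (simp_all only: two_sinh E_def \<alpha>_def P_def Q_def exp_add)
    moreover have "4 * \<Psi> t s = p2 * (2 * sinh ((p1 + q1) / 2 * t + q2 * s))
        - q2 * (2 * sinh ((p1 + q1) / 2 * t + p2 * s)) - (q2 - p2) * (2 * sinh ((q1 - p1) / 2 * t))"
    proof -
      have "\<epsilon> * (q2 - p2) = - (q2 - p2)" using assms(3) by simp
      with \<Psi>_exponents[of t s]
      have "2 * \<Psi> t s = p2 * sinh ((p1 + q1) / 2 * t + q2 * s) - q2 * sinh ((p1 + q1) / 2 * t + p2 * s)
        - (q2 - p2) * sinh ((q1 - p1) / 2 * t)" by (simp only: mult_minus_left)
      then show ?thesis by linarith
    qed
    ultimately show ?thesis by (simp only:)
  qed
  have "1 < exp (p2 * s + q1 * t)" using assms pq1 pq2 by (simp add: add_pos_pos)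
  have D: "0 < (P * (E / \<alpha>) + 1) * (P * (E * \<alpha>) - 1)"
  proof -
    have "0 < P * (E * \<alpha>) - 1" using \<open>1 < exp (p2 * s + q1 * t)\<close> by (simp only: e diff_gt_0_iff_gt)
    moreover have "0 < P * (E / \<alpha>) + 1" using pos by (simp add: add_pos_pos)
    ultimately show ?thesis by (metis mult_pos_pos)
  qed
  have "crit_eq_iii p1 q1 p2 q2 t s \<longleftrightarrow>
      p2 * ((Q * (E / \<alpha>) + 1) * (Q * (E * \<alpha>) - 1) * (P / Q)) - q2 * ((P * (E / \<alpha>) + 1) * (P * (E * \<alpha>) - 1)) = 0"
    unfolding crit_eq_iii_def e by (rule ratio_eq_iff[OF D pq2(1)])
  also have "p2 * ((Q * (E / \<alpha>) + 1) * (Q * (E * \<alpha>) - 1) * (P / Q)) - q2 * ((P * (E / \<alpha>) + 1) * (P * (E * \<alpha>) - 1))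
     = (E * P) * (4 * \<Psi> t s)"
    by (simp only: S rational_identity_iii[OF pos])
  finally show ?thesis using pos by simp
qed

end

section \<open>Solutions in eigencoordinates\<close>

text \<open>The numbers \<beta> and \<gamma> are the off-diagonal entries of the projection. Both
  time intervals are closed, so that consecutive phases match at the switching time.\<close>

definition switched_flow ::
  "real \<Rightarrow> real \<Rightarrow> real \<Rightarrow> real \<Rightarrow> real \<Rightarrow> real \<Rightarrow> real \<Rightarrow> (nat \<Rightarrow> real) \<Rightarrow> (real \<Rightarrow> real) \<Rightarrow> (real \<Rightarrow> real) \<Rightarrow> bool" where
  "switched_flow p1 q1 p2 q2 \<kappa> \<beta> \<gamma> d y1 y2 \<longleftrightarrow>
    (\<forall>j t. d (2 * j) \<le> t \<and> t \<le> d (2 * j + 1) \<longrightarrow>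
       y1 t = exp (- p1 * (t - d (2 * j))) * y1 (d (2 * j)) \<and>
       y2 t = exp (- q1 * (t - d (2 * j))) * y2 (d (2 * j))) \<and>
    (\<forall>j t. d (2 * j + 1) \<le> t \<and> t \<le> d (2 * j + 2) \<longrightarrow>
       (let f = exp (- p2 * (t - d (2 * j + 1))); g = exp (- q2 * (t - d (2 * j + 1)));
            u = y1 (d (2 * j + 1)); v = y2 (d (2 * j + 1))
        in y1 t = (\<kappa> * f + (1 - \<kappa>) * g) * u + \<beta> * (f - g) * v \<and>
           y2 t = \<gamma> * (f - g) * u + ((1 - \<kappa>) * f + \<kappa> * g) * v))"

text \<open>C is chosen before the trajectory; this uniformity is what provides the \<delta> of
  stability.\<close>

definition flow_decays ::
  "real \<Rightarrow> real \<Rightarrow> real \<Rightarrow> real \<Rightarrow> real \<Rightarrow> real \<Rightarrow> real \<Rightarrow> (nat \<Rightarrow> real) \<Rightarrow> bool" where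
  "flow_decays p1 q1 p2 q2 \<kappa> \<beta> \<gamma> d \<longleftrightarrow>
    (\<exists>C\<ge>0. \<forall>y1 y2. switched_flow p1 q1 p2 q2 \<kappa> \<beta> \<gamma> d y1 y2 \<longrightarrow>
       (\<forall>t\<ge>0. \<bar>y1 t\<bar> + \<bar>y2 t\<bar> \<le> C * (\<bar>y1 0\<bar> + \<bar>y2 0\<bar>)) \<and>
       ((\<lambda>t. \<bar>y1 t\<bar> + \<bar>y2 t\<bar>) \<longlongrightarrow> 0) at_top)"

lemma
  fixes P :: "real^'n^'n"
  assumes "invertible P"
  shows matrix_inv_right: "P ** matrix_inv P = mat 1" and matrix_inv_left: "matrix_inv P ** P = mat 1"
  using someI_ex[OF assms[unfolded invertible_def]] unfolding matrix_inv_def by auto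

text \<open>Multiplied by the integrating factor exp (k (s - l)), an eigencoordinate has derivative
  0 on the open interval; continuity carries the constant to the end points, where no derivative is
  assumed.\<close>

lemma eigencoordinates_on_interval:
  fixes A P :: "real^2^2" and x :: "real \<Rightarrow> real^2"
  assumes P: "invertible P" and A: "A = P ** diag_neg p q ** matrix_inv P"
    and cont: "continuous_on {l..r} x"
    and deriv: "\<And>t. l < t \<Longrightarrow> t < r \<Longrightarrow> (x has_vector_derivative A *v x t) (at t)"
    and t: "l \<le> t" "t \<le> r"
  shows "(matrix_inv P *v x t) $ 1 = exp (- p * (t - l)) * (matrix_inv P *v x l) $ 1"
    and "(matrix_inv P *v x t) $ 2 = exp (- q * (t - l)) * (matrix_inv P *v x l) $ 2"
proof -
  have inv: "matrix_inv P ** P = mat 1" using P by (simp add: matrix_inv_left)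
  have "matrix_inv P ** A = diag_neg p q ** matrix_inv P"
    by (simp add: A matrix_mul_assoc inv)
  then have "matrix_inv P *v (A *v v) = diag_neg p q *v (matrix_inv P *v v)" for v
    by (simp add: matrix_vector_mul_assoc)
  then have PA: "(matrix_inv P *v (A *v v)) $ 1 = - p * (matrix_inv P *v v) $ 1"
    "(matrix_inv P *v (A *v v)) $ 2 = - q * (matrix_inv P *v v) $ 2" for v
    by (simp_all add: diag_neg_def matrix_vector_mult_def[of "vector _"] sum_2)
  have main: "(matrix_inv P *v x t) $ i = exp (- k * (t - l)) * (matrix_inv P *v x l) $ i"
    if eig: "\<And>v. (matrix_inv P *v (A *v v)) $ i = - k * (matrix_inv P *v v) $ i" for i :: 2 and k
  proof (cases "t = l")
    case False
    define h where "h s = exp (k * (s - l)) * (matrix_inv P *v x s) $ i" for s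
    have bl: "bounded_linear (\<lambda>v. (matrix_inv P *v v) $ i)"
      by (rule bounded_linear_compose[OF bounded_linear_vec_nth matrix_vector_mul_bounded_linear])
    have "continuous_on {l..r} h"
      unfolding h_def
      by (rule continuous_on_mult[OF _ bounded_linear.continuous_on[OF bl cont]]) (intro continuous_intros)
    then have "continuous_on {l..t} h" by (rule continuous_on_subset) (use t in auto)
    moreover have "(h has_real_derivative 0) (at s)" if "l < s" "s < t" for s
    proof -
      have "((\<lambda>s. (matrix_inv P *v x s) $ i) has_vector_derivative (matrix_inv P *v (A *v x s)) $ i) (at s)"
        using bounded_linear.has_vector_derivative[OF bl deriv[of s]] that t by simp
      then have "((\<lambda>s. (matrix_inv P *v x s) $ i) has_real_derivative - k * (matrix_inv P *v x s) $ i) (at s)"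
        by (simp only: eig has_real_derivative_iff_has_vector_derivative)
      then show ?thesis unfolding h_def
        by (auto intro!: derivative_eq_intros simp: algebra_simps)
    qed
    ultimately have "h t = h l"
      using DERIV_isconst_end[of l t h] t False by auto
    then have "exp (- k * (t - l)) * (exp (k * (t - l)) * (matrix_inv P *v x t) $ i)
        = exp (- k * (t - l)) * (matrix_inv P *v x l) $ i"
      by (simp add: h_def)
    then show ?thesis by (simp add: mult.assoc[symmetric] flip: exp_add)
  qed simp
  show "(matrix_inv P *v x t) $ 1 = exp (- p * (t - l)) * (matrix_inv P *v x l) $ 1"
    "(matrix_inv P *v x t) $ 2 = exp (- q * (t - l)) * (matrix_inv P *v x l) $ 2"
    using main PA by blast+
qed

lemma switching_times_nonneg:
  assumes "switching_times \<sigma> d"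
  shows "0 \<le> d k"
  using assms strict_mono_mono monoD[of d 0 k] unfolding switching_times_def by fastforce

lemma switching_times_signal:
  assumes "switching_times \<sigma> d"
  shows "\<sigma> (d (2 * j)) = 1" "\<sigma> (d (2 * j + 1)) = 2"
proof -
  have step: "\<sigma> (d (Suc k)) \<noteq> \<sigma> (d k)" "\<sigma> (d k) \<in> {1, 2}" for k
    using assms switching_times_nonneg[OF assms, of k] unfolding switching_times_def by blast+
  have "\<sigma> (d (2 * j)) = 1 \<and> \<sigma> (d (2 * j + 1)) = 2"
  proof (induction j)
    case 0
    have "\<sigma> (d 0) = 1" using assms unfolding switching_times_def by simp
    then show ?case using step[of 0] step(2)[of 1] by auto
  next
    case (Suc j)
    then show ?case using step[of "2 * j + 1"] step[of "2 * j + 2"] step(2)[of "2 * j + 3"] 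
      by (auto simp: eval_nat_numeral)
  qed
  then show "\<sigma> (d (2 * j)) = 1" "\<sigma> (d (2 * j + 1)) = 2" by auto
qed

lemma is_solution_on_interval:
  assumes sw: "switching_times \<sigma> d" and sol: "is_solution A1 A2 \<sigma> x"
    and t: "d k < t" "t < d (Suc k)"
  shows "(x has_vector_derivative (if \<sigma> (d k) = 1 then A1 else A2) *v x t) (at t)"
proof -
  have const: "\<sigma> u = \<sigma> (d k)" if "d k \<le> u" "u < d (Suc k)" for u
    using sw that unfolding switching_times_def by blast
  have "\<forall>\<^sub>F u in nhds t. u \<in> {d k <..< d (Suc k)}"
    using t by (intro eventually_nhds_in_open) auto
  then have "\<forall>\<^sub>F u in nhds t. \<sigma> u = \<sigma> (d k)"
    by eventually_elim (rule const, auto)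
  then have "isCont \<sigma> t" using isCont_cong[of \<sigma> "\<lambda>_. \<sigma> (d k)" t] by simp
  moreover have "0 < t" using switching_times_nonneg[OF sw, of k] t by simp
  moreover have "\<sigma> t = \<sigma> (d k)" using const[of t] t by simp
  ultimately show ?thesis using sol unfolding is_solution_def by metis
qed

text \<open>The three constants are entries of the projection M^-1 diag(1, 0) M, where M^-1 is det M
  times the adjugate because det M is its own inverse.\<close>

lemma solution_switched_flow:
  fixes A1 A2 P1 P2 M :: "real^2^2"
  assumes "invertible P1" "invertible P2"
    and A1: "A1 = P1 ** diag_neg p1 q1 ** matrix_inv P1"
    and A2: "A2 = P2 ** diag_neg p2 q2 ** matrix_inv P2"
    and M: "M = matrix_inv P2 ** P1" and det: "\<bar>det M\<bar> = 1"
    and sw: "switching_times \<sigma> d" and sol: "is_solution A1 A2 \<sigma> x"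
  shows "switched_flow p1 q1 p2 q2 (det M * (M $ 1 $ 1 * M $ 2 $ 2)) (det M * (M $ 1 $ 2 * M $ 2 $ 2))
      (- det M * (M $ 1 $ 1 * M $ 2 $ 1)) d (\<lambda>t. (matrix_inv P1 *v x t) $ 1) (\<lambda>t. (matrix_inv P1 *v x t) $ 2)"
proof -
  define a b c e where "a = M $ 1 $ 1" and "b = M $ 1 $ 2" and "c = M $ 2 $ 1" and "e = M $ 2 $ 2"
  have dM: "det M = a * e - b * c" by (simp add: det_2 a_def b_def c_def e_def)
  have d1: "det M * det M = 1" using det by (metis abs_mult_self_eq mult_1)
  define y where "y t = matrix_inv P1 *v x t" for t
  define u where "u t = matrix_inv P2 *v x t" for t
  have "M ** matrix_inv P1 = matrix_inv P2"
    unfolding M using assms(1) by (simp add: matrix_inv_right flip: matrix_mul_assoc)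
  then have "u t = M *v y t" for t
    by (simp add: u_def y_def matrix_vector_mul_assoc)
  then have u: "u t $ 1 = a * y t $ 1 + b * y t $ 2" "u t $ 2 = c * y t $ 1 + e * y t $ 2" for t
    by (simp_all add: matrix_vector_mult_def sum_2 a_def b_def c_def e_def)
  have y: "y t $ 1 = det M * (e * u t $ 1 - b * u t $ 2)" "y t $ 2 = det M * (a * u t $ 2 - c * u t $ 1)" for t
  proof -
    have "e * u t $ 1 - b * u t $ 2 = det M * y t $ 1" "a * u t $ 2 - c * u t $ 1 = det M * y t $ 2"
      by (simp_all add: u dM algebra_simps)
    then show "y t $ 1 = det M * (e * u t $ 1 - b * u t $ 2)" "y t $ 2 = det M * (a * u t $ 2 - c * u t $ 1)"
      using d1 by (simp_all add: mult.assoc[symmetric])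
  qed
  have cont: "continuous_on {d k..r} x" for k r
    using sol switching_times_nonneg[OF sw, of k] unfolding is_solution_def
    by (auto intro: continuous_on_subset)
  note sig = switching_times_signal[OF sw]
  have deriv1: "(x has_vector_derivative A1 *v x t) (at t)" if "d (2 * j) < t" "t < d (2 * j + 1)" for j t
    using is_solution_on_interval[OF sw sol, of "2 * j" t] that sig(1)[of j] by simp
  have deriv2: "(x has_vector_derivative A2 *v x t) (at t)" if "d (2 * j + 1) < t" "t < d (2 * j + 2)" for j t
    using is_solution_on_interval[OF sw sol, of "2 * j + 1" t] that sig(2)[of j] by simp
  have \<kappa>: "det M * (b * c) = det M * (a * e) - 1" using d1 unfolding dM by algebra
  show ?thesis
    unfolding switched_flow_def Let_def
  proof (intro conjI allI impI; (elim conjE)?)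
    fix j t assume t: "d (2 * j) \<le> t" "t \<le> d (2 * j + 1)"
    show "(matrix_inv P1 *v x t) $ 1 = exp (- p1 * (t - d (2 * j))) * (matrix_inv P1 *v x (d (2 * j))) $ 1"
      "(matrix_inv P1 *v x t) $ 2 = exp (- q1 * (t - d (2 * j))) * (matrix_inv P1 *v x (d (2 * j))) $ 2"
      using eigencoordinates_on_interval[OF assms(1) A1 cont deriv1 t] by auto
  next
    fix j t assume t: "d (2 * j + 1) \<le> t" "t \<le> d (2 * j + 2)"
    define l where "l = d (2 * j + 1)"
    define f where "f = exp (- p2 * (t - l))"
    define g where "g = exp (- q2 * (t - l))"
    have ut: "u t $ 1 = f * u l $ 1" "u t $ 2 = g * u l $ 2"
      using eigencoordinates_on_interval[OF assms(2) A2 cont deriv2 t] by (auto simp: u_def l_def f_def g_def)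
    have "y t $ 1 = (det M * (a * e) * f - det M * (b * c) * g) * y l $ 1 + det M * (b * e) * (f - g) * y l $ 2"
      "y t $ 2 = - det M * (a * c) * (f - g) * y l $ 1 + (det M * (a * e) * g - det M * (b * c) * f) * y l $ 2"
      unfolding y(1)[of t] y(2)[of t] ut unfolding u by (simp_all add: algebra_simps)
    then have "y t $ 1 = (det M * (a * e) * f + (1 - det M * (a * e)) * g) * y l $ 1 + det M * (b * e) * (f - g) * y l $ 2"
      "y t $ 2 = - det M * (a * c) * (f - g) * y l $ 1 + ((1 - det M * (a * e)) * f + det M * (a * e) * g) * y l $ 2"
      unfolding \<kappa> by (simp_all add: algebra_simps)
    then show "(matrix_inv P1 *v x t) $ 1 = (det M * (M $ 1 $ 1 * M $ 2 $ 2) * exp (- p2 * (t - d (2 * j + 1))) +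
          (1 - det M * (M $ 1 $ 1 * M $ 2 $ 2)) * exp (- q2 * (t - d (2 * j + 1)))) * (matrix_inv P1 *v x (d (2 * j + 1))) $ 1
        + det M * (M $ 1 $ 2 * M $ 2 $ 2) * (exp (- p2 * (t - d (2 * j + 1))) - exp (- q2 * (t - d (2 * j + 1))))
          * (matrix_inv P1 *v x (d (2 * j + 1))) $ 2"
      "(matrix_inv P1 *v x t) $ 2 = - det M * (M $ 1 $ 1 * M $ 2 $ 1)
          * (exp (- p2 * (t - d (2 * j + 1))) - exp (- q2 * (t - d (2 * j + 1)))) * (matrix_inv P1 *v x (d (2 * j + 1))) $ 1
        + ((1 - det M * (M $ 1 $ 1 * M $ 2 $ 2)) * exp (- p2 * (t - d (2 * j + 1))) +
          det M * (M $ 1 $ 1 * M $ 2 $ 2) * exp (- q2 * (t - d (2 * j + 1)))) * (matrix_inv P1 *v x (d (2 * j + 1))) $ 2"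
      unfolding a_def b_def c_def e_def f_def g_def l_def y_def by blast+
  qed
qed

lemma asymp_stable_for_if_flow_decays:
  fixes A1 A2 P1 P2 M :: "real^2^2"
  assumes "invertible P1" "invertible P2"
    and A1: "A1 = P1 ** diag_neg p1 q1 ** matrix_inv P1"
    and A2: "A2 = P2 ** diag_neg p2 q2 ** matrix_inv P2"
    and M: "M = matrix_inv P2 ** P1" and det: "\<bar>det M\<bar> = 1"
    and sw: "switching_times \<sigma> d"
    and dec: "flow_decays p1 q1 p2 q2 (det M * (M $ 1 $ 1 * M $ 2 $ 2)) (det M * (M $ 1 $ 2 * M $ 2 $ 2))
      (- det M * (M $ 1 $ 1 * M $ 2 $ 1)) d"
  shows "asymp_stable_for A1 A2 \<sigma>"
proof -
  note flow = solution_switched_flow[OF assms(1-6) sw]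
  define y where "y x t = matrix_inv P1 *v x t" for x :: "real \<Rightarrow> real^2" and t
  obtain C where C: "0 \<le> C"
    and bound: "\<And>x t. is_solution A1 A2 \<sigma> x \<Longrightarrow> 0 \<le> t \<Longrightarrow>
      \<bar>y x t $ 1\<bar> + \<bar>y x t $ 2\<bar> \<le> C * (\<bar>y x 0 $ 1\<bar> + \<bar>y x 0 $ 2\<bar>)"
    and lim: "\<And>x. is_solution A1 A2 \<sigma> x \<Longrightarrow> ((\<lambda>t. \<bar>y x t $ 1\<bar> + \<bar>y x t $ 2\<bar>) \<longlongrightarrow> 0) at_top"
    using dec flow unfolding flow_decays_def y_def by blast
  obtain K where K: "0 < K" "\<And>v. norm (P1 *v v) \<le> norm v * K"
    using bounded_linear.pos_bounded[OF matrix_vector_mul_bounded_linear[of P1]] by blast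
  obtain L where L: "0 < L" "\<And>v. norm (matrix_inv P1 *v v) \<le> norm v * L"
    using bounded_linear.pos_bounded[OF matrix_vector_mul_bounded_linear[of "matrix_inv P1"]] by blast
  have x: "norm (x t) \<le> (\<bar>y x t $ 1\<bar> + \<bar>y x t $ 2\<bar>) * K" for x t
  proof -
    have "x t = P1 *v y x t"
      using assms(1) by (simp add: y_def matrix_vector_mul_assoc matrix_inv_right)
    then have "norm (x t) \<le> norm (y x t) * K" using K(2) by metis
    also have "norm (y x t) \<le> \<bar>y x t $ 1\<bar> + \<bar>y x t $ 2\<bar>"
      using norm_le_l1_cart[of "y x t"] by (simp add: sum_2)
    finally show ?thesis using K(1) by simp
  qed
  have y0: "\<bar>y x 0 $ 1\<bar> + \<bar>y x 0 $ 2\<bar> \<le> 2 * L * norm (x 0)" for x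
    using L(2)[of "x 0"] component_le_norm_cart[of "y x 0" 1] component_le_norm_cart[of "y x 0" 2]
    by (simp add: y_def algebra_simps)
  have total: "norm (x t) \<le> (C * (2 * L) * K) * norm (x 0)" if "is_solution A1 A2 \<sigma> x" "0 \<le> t" for x t
  proof -
    have "\<bar>y x t $ 1\<bar> + \<bar>y x t $ 2\<bar> \<le> C * (2 * L * norm (x 0))"
      using bound[OF that] mult_left_mono[OF y0[of x] C] by linarith
    then have "(\<bar>y x t $ 1\<bar> + \<bar>y x t $ 2\<bar>) * K \<le> C * (2 * L * norm (x 0)) * K"
      using K(1) by simp
    then show ?thesis using x[of x t] by (simp add: mult_ac)
  qed
  \<comment> \<open>The summand 1 makes B positive, so that \<epsilon> / B can serve as the required
    radius.\<close>
  define B where "B = C * (2 * L) * K + 1"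
  have "0 < B" using C K L by (simp add: B_def add_nonneg_pos)
  have total: "norm (x t) \<le> B * norm (x 0)" if "is_solution A1 A2 \<sigma> x" "0 \<le> t" for x t
    using total[OF that] by (simp add: B_def distrib_right add_increasing2)
  have "stable_for A1 A2 \<sigma>"
    unfolding stable_for_def
  proof (intro allI impI)
    fix \<epsilon> :: real assume "0 < \<epsilon>"
    show "\<exists>\<delta>>0. \<forall>x. is_solution A1 A2 \<sigma> x \<longrightarrow> norm (x 0) < \<delta> \<longrightarrow> (\<forall>t>0. norm (x t) < \<epsilon>)"
    proof (intro exI[of _ "\<epsilon> / B"] conjI allI impI)
      show "0 < \<epsilon> / B" using \<open>0 < \<epsilon>\<close> \<open>0 < B\<close> by simp
      fix x and t :: real
      assume *: "is_solution A1 A2 \<sigma> x" "norm (x 0) < \<epsilon> / B" "0 < t"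
      then have "norm (x t) \<le> B * norm (x 0)" using total by simp
      also have "\<dots> < \<epsilon>" using *(2) \<open>0 < B\<close> by (simp add: field_simps)
      finally show "norm (x t) < \<epsilon>" .
    qed
  qed
  moreover have "((\<lambda>t. norm (x t)) \<longlongrightarrow> 0) at_top" if "is_solution A1 A2 \<sigma> x" for x
  proof (rule tendsto_sandwich[OF _ _ tendsto_const])
    show "((\<lambda>t. (\<bar>y x t $ 1\<bar> + \<bar>y x t $ 2\<bar>) * K) \<longlongrightarrow> 0) at_top"
      using tendsto_mult_right[OF lim[OF that], of K] by simp
  qed (use x in auto)
  ultimately show ?thesis unfolding asymp_stable_for_def by blast
qed

section \<open>Decay for arbitrary signals\<close>

lemma ex_switching_interval:
  assumes "switching_times \<sigma> d" "d K \<le> t"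
  shows "\<exists>k\<ge>K. d k \<le> t \<and> t \<le> d (Suc k)"
proof -
  have "filterlim d at_top sequentially" "mono d"
    using assms unfolding switching_times_def by (auto intro: strict_mono_mono)
  then obtain n where n: "t < d n"
    unfolding filterlim_at_top_dense eventually_sequentially by blast
  define k where "k = (LEAST n. t < d n)"
  have k: "t < d k" unfolding k_def by (rule LeastI[of _ n]) (rule n)
  have "K < k"
  proof (rule ccontr)
    assume "\<not> K < k"
    then have "d k \<le> d K" using \<open>mono d\<close> by (simp add: monoD)
    then show False using k assms(2) by linarith
  qed
  then obtain k' where k': "k = Suc k'" "K \<le> k'" by (cases k) auto
  then have "\<not> t < d k'" using not_less_Least[of k' "\<lambda>n. t < d n"] by (simp add: k_def)
  then show ?thesis using k k' by (intro exI[of _ k']) auto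
qed

text \<open>The value q / (q - p) is the one for which the mixture has slope 0 at s = 0; beyond it
  the mixture would first rise above 1. This is the origin of the upper end of the interval.\<close>

lemma expconvex_le_1:
  fixes p q \<kappa> s :: real
  assumes "0 < p" "p < q" "\<bar>\<kappa>\<bar> \<le> q / (q - p)" "0 \<le> s"
  shows "\<bar>\<kappa> * exp (- p * s) + (1 - \<kappa>) * exp (- q * s)\<bar> \<le> 1"
proof -
  define f where "f = exp (- p * s)"
  define g where "g = exp (- q * s)"
  have "p * s \<le> q * s" using assms by (intro mult_right_mono) auto
  then have fg: "0 < g" "g \<le> f" by (simp_all add: f_def g_def)
  have "p * (1 - exp (- q * s)) - q * (1 - exp (- p * s)) \<le> p * (1 - exp (- q * 0)) - q * (1 - exp (- p * 0))"
  proof (rule DERIV_nonpos_imp_nonincreasing[OF assms(4)])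
    fix r assume r: "0 \<le> r" "r \<le> s"
    have "p * r \<le> q * r" using assms r by (intro mult_right_mono) auto
    then have "p * q * (exp (- q * r) - exp (- p * r)) \<le> 0"
      using assms by (intro mult_nonneg_nonpos) auto
    moreover have "((\<lambda>s. p * (1 - exp (- q * s)) - q * (1 - exp (- p * s))) has_real_derivative
        p * q * (exp (- q * r) - exp (- p * r))) (at r)"
      by (auto intro!: derivative_eq_intros simp: algebra_simps)
    ultimately show "\<exists>y. ((\<lambda>s. p * (1 - exp (- q * s)) - q * (1 - exp (- p * s))) has_real_derivative y) (at r) \<and> y \<le> 0"
      by blast
  qed
  then have "q * (f - g) + (q - p) * g \<le> q - p" by (simp add: f_def g_def algebra_simps)
  then have R: "q / (q - p) * (f - g) + g \<le> 1" using assms by (simp add: field_simps)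
  have "\<bar>\<kappa>\<bar> * (f - g) \<le> q / (q - p) * (f - g)" using fg assms by (intro mult_right_mono) auto
  moreover have "\<bar>\<kappa> * (f - g)\<bar> = \<bar>\<kappa>\<bar> * (f - g)" using fg by (simp add: abs_mult)
  moreover have "\<kappa> * f + (1 - \<kappa>) * g = \<kappa> * (f - g) + g" by (simp add: algebra_simps)
  ultimately have "\<bar>\<kappa> * f + (1 - \<kappa>) * g\<bar> \<le> 1" using R fg by linarith
  then show ?thesis by (simp add: f_def g_def)
qed

text \<open>A small weight is harmless up to a fixed time, after which the decay of \<open>h\<close> absorbs it.\<close>

lemma ex_weight:
  fixes h :: "real \<Rightarrow> real" and C A B p :: real
  assumes "0 < p" "0 < A" "A < B" "1 \<le> B" and h: "\<And>s. 0 \<le> s \<Longrightarrow> h s \<le> A" "\<And>s. 0 \<le> s \<Longrightarrow> h s \<le> C * exp (- p * s)"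
  shows "\<exists>\<omega>0>0. \<forall>\<omega>. 0 \<le> \<omega> \<longrightarrow> \<omega> \<le> \<omega>0 \<longrightarrow> (\<forall>s\<ge>0. exp (\<omega> * s) * h s \<le> B)"
proof -
  define K where "K = max C 1"
  \<comment> \<open>After time L the rate p / 2 has brought K exp (-(p / 2) s) down to 1. Until then
    the weight stays below B / A; the summand 1 keeps L positive when K = 1.\<close>
  define L where "L = 2 * ln K / p + 1"
  have "1 \<le> K" by (simp add: K_def)
  then have "0 < L" using assms by (simp add: L_def add_nonneg_pos)
  have "0 < ln (B / A)" using assms by simp
  define \<omega>0 where "\<omega>0 = min (p / 2) (ln (B / A) / L)"
  have "0 < \<omega>0" using \<open>0 < ln (B / A)\<close> \<open>0 < L\<close> assms by (simp add: \<omega>0_def)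
  moreover have "exp (\<omega> * s) * h s \<le> B" if \<omega>: "0 \<le> \<omega>" "\<omega> \<le> \<omega>0" and s: "0 \<le> s" for \<omega> s
  proof (cases "s \<le> L")
    case True
    have "\<omega> * s \<le> ln (B / A) / L * L" using that True \<open>0 < L\<close> \<open>0 < ln (B / A)\<close>
      by (intro mult_mono) (auto simp: \<omega>0_def)
    then have "exp (\<omega> * s) \<le> exp (ln (B / A))" using \<open>0 < L\<close> by simp
    also have "\<dots> = B / A" using assms by simp
    finally have "exp (\<omega> * s) * A \<le> B" using assms by (simp add: field_simps)
    moreover have "exp (\<omega> * s) * h s \<le> exp (\<omega> * s) * A" using h(1)[OF s] by simp
    ultimately show ?thesis by linarith
  next
    case False
    have "exp (\<omega> * s) * h s \<le> exp (\<omega> * s) * (K * exp (- p * s))"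
    proof -
      have "C * exp (- p * s) \<le> K * exp (- p * s)" by (simp add: K_def)
      from order_trans[OF h(2)[OF s] this] show ?thesis by (intro mult_left_mono) auto
    qed
    also have "\<dots> = K * exp ((\<omega> - p) * s)" by (simp add: algebra_simps flip: exp_add)
    also have "\<dots> \<le> K * exp (- (p / 2) * L)"
    proof -
      have "(p / 2) * L \<le> (p - \<omega>) * s" using False \<omega> \<open>0 < L\<close> assms
        by (intro mult_mono) (auto simp: \<omega>0_def)
      then show ?thesis using \<open>1 \<le> K\<close> by (simp add: algebra_simps)
    qed
    also have "\<dots> \<le> K * exp (- ln K)"
      using \<open>1 \<le> K\<close> assms by (simp add: L_def field_simps)
    also have "\<dots> = 1" using \<open>1 \<le> K\<close> by (simp add: exp_minus)
    finally show ?thesis using assms by simp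
  qed
  ultimately show ?thesis by blast
qed

text \<open>With this \<delta> the left side has slope -p / 2 at t = 0: half of the slow rate pays
  for the factor 1 + \<delta>, the other half remains as decay.\<close>

lemma exp_mixture_le:
  fixes p q t :: real
  assumes "0 < p" "p < q" "0 \<le> t"
  defines "\<delta> \<equiv> p / (2 * (q - p))"
  shows "(exp (- p * t) - exp (- q * t)) * (1 + \<delta>) + exp (- q * t) \<le> exp (- (p / 2) * t)"
proof -
  have "1 - (q - p) * t \<le> exp (- ((q - p) * t))" using exp_ge_add_one_self[of "- ((q - p) * t)"] by simp
  then have "\<delta> * (1 - exp (- ((q - p) * t))) \<le> \<delta> * ((q - p) * t)"
    using assms by (intro mult_left_mono) auto
  also have "\<dots> = p / 2 * t" using assms by (simp add: field_simps)
  finally have "1 + \<delta> * (1 - exp (- ((q - p) * t))) \<le> exp (p / 2 * t)"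
    using exp_ge_add_one_self[of "p / 2 * t"] by linarith
  then have "exp (- p * t) * (1 + \<delta> * (1 - exp (- ((q - p) * t)))) \<le> exp (- p * t) * exp (p / 2 * t)"
    by simp
  moreover have "exp (- q * t) = exp (- p * t) * exp (- ((q - p) * t))" by (simp add: algebra_simps flip: exp_add)
  moreover have "exp (- (p / 2) * t) = exp (- p * t) * exp (p / 2 * t)" by (simp add: algebra_simps flip: exp_add)
  ultimately show ?thesis by (simp add: algebra_simps)
qed

section \<open>The second flow and the supremum norm along its trajectories\<close>

locale flow_data =
  fixes p1 q1 p2 q2 \<kappa> \<beta> \<gamma> :: real
  assumes pq1: "0 < p1" "p1 < q1" and pq2: "0 < p2" "p2 < q2"
    and proj: "\<beta> * \<gamma> = \<kappa> * (1 - \<kappa>)"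
begin

definition W1 :: "real \<Rightarrow> real \<Rightarrow> real \<Rightarrow> real" where
  "W1 s u v = (\<kappa> * exp (- p2 * s) + (1 - \<kappa>) * exp (- q2 * s)) * u + \<beta> * (exp (- p2 * s) - exp (- q2 * s)) * v"

definition W2 :: "real \<Rightarrow> real \<Rightarrow> real \<Rightarrow> real" where
  "W2 s u v = \<gamma> * (exp (- p2 * s) - exp (- q2 * s)) * u + ((1 - \<kappa>) * exp (- p2 * s) + \<kappa> * exp (- q2 * s)) * v"

text \<open>The relation \<open>proj\<close> says that the matrix with rows (\<kappa>, \<beta>) and
  (\<gamma>, 1 - \<kappa>) has determinant 0. Its trace is 1, so it is idempotent, which gives the
  semigroup law.\<close>

lemma W_add:
  "W1 s (W1 r u v) (W2 r u v) = W1 (s + r) u v" "W2 s (W1 r u v) (W2 r u v) = W2 (s + r) u v"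
proof -
  have e: "exp (- p2 * (s + r)) = exp (- p2 * s) * exp (- p2 * r)" "exp (- q2 * (s + r)) = exp (- q2 * s) * exp (- q2 * r)"
    by (simp_all add: algebra_simps flip: exp_add)
  show "W1 s (W1 r u v) (W2 r u v) = W1 (s + r) u v" "W2 s (W1 r u v) (W2 r u v) = W2 (s + r) u v"
    unfolding W1_def W2_def e using proj by algebra+
qed

lemma W_0 [simp]: "W1 0 u v = u" "W2 0 u v = v"
  by (simp_all add: W1_def W2_def algebra_simps)

lemma W_linear:
  "W1 s (a * u + b * u') (a * v + b * v') = a * W1 s u v + b * W1 s u' v'"
  "W2 s (a * u + b * u') (a * v + b * v') = a * W2 s u v + b * W2 s u' v'"
  by (simp_all add: W1_def W2_def algebra_simps)

lemma exp_order: "0 \<le> s \<Longrightarrow> exp (- q2 * s) \<le> exp (- p2 * s)"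
  using pq2 by (simp add: mult_right_mono)

lemma W_bound:
  assumes "0 \<le> s"
  shows "\<bar>W1 s u v\<bar> \<le> exp (- p2 * s) * ((\<bar>\<kappa>\<bar> + \<bar>1 - \<kappa>\<bar> + \<bar>\<beta>\<bar>) * (\<bar>u\<bar> + \<bar>v\<bar>))"
    and "\<bar>W2 s u v\<bar> \<le> exp (- p2 * s) * ((\<bar>\<kappa>\<bar> + \<bar>1 - \<kappa>\<bar> + \<bar>\<gamma>\<bar>) * (\<bar>u\<bar> + \<bar>v\<bar>))"
proof -
  define f where "f = exp (- p2 * s)"
  define g where "g = exp (- q2 * s)"
  have fg: "0 < g" "g \<le> f" "0 < f" using exp_order[OF assms] by (simp_all add: f_def g_def)
  have mix: "\<bar>k * f + l * g\<bar> \<le> (\<bar>k\<bar> + \<bar>l\<bar>) * f" for k l :: real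
  proof -
    have "\<bar>k * f + l * g\<bar> \<le> \<bar>k\<bar> * f + \<bar>l\<bar> * g" using fg by (metis abs_mult abs_of_pos abs_triangle_ineq)
    also have "\<bar>l\<bar> * g \<le> \<bar>l\<bar> * f" using fg by (intro mult_left_mono) auto
    finally show ?thesis by (simp add: algebra_simps)
  qed
  have dif: "\<bar>k * (f - g)\<bar> \<le> \<bar>k\<bar> * f" for k :: real
    using fg by (simp add: abs_mult mult_left_mono)
  have comb: "\<bar>a * u + b * v\<bar> \<le> f * ((A + B) * (\<bar>u\<bar> + \<bar>v\<bar>))" if "\<bar>a\<bar> \<le> A * f" "\<bar>b\<bar> \<le> B * f" "0 \<le> A" "0 \<le> B" for a b A B
  proof -
    have "\<bar>a * u + b * v\<bar> \<le> \<bar>a\<bar> * \<bar>u\<bar> + \<bar>b\<bar> * \<bar>v\<bar>" by (metis abs_mult abs_triangle_ineq)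
    also have "\<bar>a\<bar> * \<bar>u\<bar> \<le> A * f * (\<bar>u\<bar> + \<bar>v\<bar>)" using that fg by (intro mult_mono) auto
    also have "\<bar>b\<bar> * \<bar>v\<bar> \<le> B * f * (\<bar>u\<bar> + \<bar>v\<bar>)" using that fg by (intro mult_mono) auto
    finally show ?thesis by (simp add: algebra_simps)
  qed
  show "\<bar>W1 s u v\<bar> \<le> exp (- p2 * s) * ((\<bar>\<kappa>\<bar> + \<bar>1 - \<kappa>\<bar> + \<bar>\<beta>\<bar>) * (\<bar>u\<bar> + \<bar>v\<bar>))"
    using comb[OF mix[of \<kappa> "1 - \<kappa>"] dif[of \<beta>]] unfolding W1_def f_def[symmetric] g_def[symmetric] by simp
  show "\<bar>W2 s u v\<bar> \<le> exp (- p2 * s) * ((\<bar>\<kappa>\<bar> + \<bar>1 - \<kappa>\<bar> + \<bar>\<gamma>\<bar>) * (\<bar>u\<bar> + \<bar>v\<bar>))"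
    using comb[OF dif[of \<gamma>] mix[of "1 - \<kappa>" \<kappa>]] unfolding W2_def f_def[symmetric] g_def[symmetric]
    by (simp add: add_ac)
qed

lemma switched_flow_iff:
  "switched_flow p1 q1 p2 q2 \<kappa> \<beta> \<gamma> d y1 y2 \<longleftrightarrow>
    (\<forall>j t. d (2 * j) \<le> t \<and> t \<le> d (2 * j + 1) \<longrightarrow>
       y1 t = exp (- p1 * (t - d (2 * j))) * y1 (d (2 * j)) \<and>
       y2 t = exp (- q1 * (t - d (2 * j))) * y2 (d (2 * j))) \<and>
    (\<forall>j t. d (2 * j + 1) \<le> t \<and> t \<le> d (2 * j + 2) \<longrightarrow>
       y1 t = W1 (t - d (2 * j + 1)) (y1 (d (2 * j + 1))) (y2 (d (2 * j + 1))) \<and>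
       y2 t = W2 (t - d (2 * j + 1)) (y1 (d (2 * j + 1))) (y2 (d (2 * j + 1))))"
  unfolding switched_flow_def W1_def W2_def Let_def ..

text \<open>\<open>c\<close> bounds the norm \<open>sup e\<^sup>\<omega>\<^sup>s (\<bar>W1 s\<bar> + \<eta> \<bar>W2 s\<bar>)\<close>, the supremum being taken along the trajectory of
  the second subsystem. It contracts under the second subsystem by construction, and under the first
  one because that flow is a multiple of a mixture of the identity and the projection to the slow
  eigendirection.\<close>

definition orbit_bound :: "real \<Rightarrow> real \<Rightarrow> real \<Rightarrow> real \<Rightarrow> real \<Rightarrow> bool" where
  "orbit_bound \<omega> \<eta> c u v \<longleftrightarrow> (\<forall>s\<ge>0. exp (\<omega> * s) * (\<bar>W1 s u v\<bar> + \<eta> * \<bar>W2 s u v\<bar>) \<le> c)"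

lemma orbit_bound_W:
  assumes "orbit_bound \<omega> \<eta> c u v" "0 \<le> r"
  shows "orbit_bound \<omega> \<eta> (c * exp (- \<omega> * r)) (W1 r u v) (W2 r u v)"
  unfolding orbit_bound_def W_add
proof (intro allI impI)
  fix s :: real assume "0 \<le> s"
  then have "exp (\<omega> * (s + r)) * (\<bar>W1 (s + r) u v\<bar> + \<eta> * \<bar>W2 (s + r) u v\<bar>) \<le> c"
    using assms unfolding orbit_bound_def by simp
  then have "exp (\<omega> * (s + r)) * (\<bar>W1 (s + r) u v\<bar> + \<eta> * \<bar>W2 (s + r) u v\<bar>) * exp (- \<omega> * r) \<le> c * exp (- \<omega> * r)"
    by simp
  moreover have "exp (\<omega> * s) = exp (\<omega> * (s + r)) * exp (- \<omega> * r)" by (simp add: algebra_simps flip: exp_add)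
  ultimately show "exp (\<omega> * s) * (\<bar>W1 (s + r) u v\<bar> + \<eta> * \<bar>W2 (s + r) u v\<bar>) \<le> c * exp (- \<omega> * r)"
    by (simp add: mult_ac)
qed

text \<open>At s = 0 the bound gives |u| \<le> c. So the slow part (a u, 0) of the image contributes
  at most a c (1 + \<delta>) and the rest b (u, v) at most b c; \<open>exp_mixture_le\<close> bounds
  the sum.\<close>

lemma orbit_bound_D:
  assumes "orbit_bound \<omega> \<eta> c u v" "0 \<le> t" "0 \<le> \<eta>" "\<omega> \<le> p1 / 2"
    and slow: "orbit_bound \<omega> \<eta> (1 + p1 / (2 * (q1 - p1))) 1 0"
  shows "orbit_bound \<omega> \<eta> (c * exp (- \<omega> * t)) (exp (- p1 * t) * u) (exp (- q1 * t) * v)"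
  unfolding orbit_bound_def
proof (intro allI impI)
  fix s :: real assume s: "0 \<le> s"
  define E where "E = exp (\<omega> * s)"
  define a where "a = exp (- p1 * t) - exp (- q1 * t)"
  define b where "b = exp (- q1 * t)"
  define \<delta> where "\<delta> = p1 / (2 * (q1 - p1))"
  have "p1 * t \<le> q1 * t" using pq1 assms by (intro mult_right_mono) auto
  then have ab: "0 \<le> a" "0 \<le> b" "0 \<le> E" by (simp_all add: a_def b_def E_def)
  have uc: "\<bar>u\<bar> \<le> c"
  proof -
    have "\<bar>u\<bar> + \<eta> * \<bar>v\<bar> \<le> c" using assms(1) unfolding orbit_bound_def by (auto dest: spec[of _ 0])
    then show ?thesis using assms(3) by (smt (verit) mult_nonneg_nonneg abs_ge_zero)
  qed
  have dec: "exp (- p1 * t) * u = (a * u) * 1 + b * u" "exp (- q1 * t) * v = (a * u) * 0 + b * v"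
    by (simp_all add: a_def b_def algebra_simps)
  have "\<bar>W1 s (exp (- p1 * t) * u) (exp (- q1 * t) * v)\<bar> + \<eta> * \<bar>W2 s (exp (- p1 * t) * u) (exp (- q1 * t) * v)\<bar>
    \<le> (a * \<bar>u\<bar> * \<bar>W1 s 1 0\<bar> + b * \<bar>W1 s u v\<bar>) + \<eta> * (a * \<bar>u\<bar> * \<bar>W2 s 1 0\<bar> + b * \<bar>W2 s u v\<bar>)"
    unfolding dec W_linear using ab assms(3)
    by (intro add_mono mult_left_mono) (auto simp: abs_mult intro: order_trans[OF abs_triangle_ineq])
  then have "E * (\<bar>W1 s (exp (- p1 * t) * u) (exp (- q1 * t) * v)\<bar> + \<eta> * \<bar>W2 s (exp (- p1 * t) * u) (exp (- q1 * t) * v)\<bar>)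
    \<le> E * ((a * \<bar>u\<bar> * \<bar>W1 s 1 0\<bar> + b * \<bar>W1 s u v\<bar>) + \<eta> * (a * \<bar>u\<bar> * \<bar>W2 s 1 0\<bar> + b * \<bar>W2 s u v\<bar>))"
    using ab by (intro mult_left_mono)
  also have "\<dots> = a * \<bar>u\<bar> * (E * (\<bar>W1 s 1 0\<bar> + \<eta> * \<bar>W2 s 1 0\<bar>)) + b * (E * (\<bar>W1 s u v\<bar> + \<eta> * \<bar>W2 s u v\<bar>))"
    by (simp add: algebra_simps)
  also have "\<dots> \<le> a * c * (1 + \<delta>) + b * c"
  proof (intro add_mono mult_mono)
    show "E * (\<bar>W1 s 1 0\<bar> + \<eta> * \<bar>W2 s 1 0\<bar>) \<le> 1 + \<delta>"
      using slow s unfolding orbit_bound_def \<delta>_def E_def by blast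
    show "E * (\<bar>W1 s u v\<bar> + \<eta> * \<bar>W2 s u v\<bar>) \<le> c"
      using assms(1) s unfolding orbit_bound_def E_def by blast
  qed (use ab uc assms(3) in auto)
  also have "\<dots> = (a * (1 + \<delta>) + b) * c" by (simp add: algebra_simps)
  also have "\<dots> \<le> exp (- \<omega> * t) * c"
  proof (rule mult_right_mono)
    have "a * (1 + \<delta>) + b \<le> exp (- (p1 / 2) * t)"
      using exp_mixture_le[OF pq1 assms(2)] by (simp add: a_def b_def \<delta>_def)
    also have "\<dots> \<le> exp (- \<omega> * t)"
      using mult_right_mono[OF assms(4,2)] by simp
    finally show "a * (1 + \<delta>) + b \<le> exp (- \<omega> * t)" .
    show "0 \<le> c" using uc by linarith
  qed
  finally show "exp (\<omega> * s) * (\<bar>W1 s (exp (- p1 * t) * u) (exp (- q1 * t) * v)\<bar>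
      + \<eta> * \<bar>W2 s (exp (- p1 * t) * u) (exp (- q1 * t) * v)\<bar>) \<le> c * exp (- \<omega> * t)"
    by (simp add: E_def mult.commute)
qed

lemma ex_orbit_bound_slow:
  assumes "\<bar>\<kappa>\<bar> \<le> q2 / (q2 - p2)"
  shows "\<exists>\<omega> \<eta>. 0 < \<omega> \<and> 0 < \<eta> \<and> \<omega> \<le> p1 / 2 \<and> \<omega> \<le> p2 \<and> orbit_bound \<omega> \<eta> (1 + p1 / (2 * (q1 - p1))) 1 0"
proof -
  define \<delta> where "\<delta> = p1 / (2 * (q1 - p1))"
  have "0 < \<delta>" using pq1 by (simp add: \<delta>_def)
  \<comment> \<open>Small enough for the second coordinate to use only half of the margin \<delta>;
    the other half is left to the exponential weight.\<close>
  define \<eta> where "\<eta> = \<delta> / (2 * (\<bar>\<gamma>\<bar> + 1))"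
  have "0 < \<eta>" using \<open>0 < \<delta>\<close> by (simp add: \<eta>_def)
  have "\<eta> * \<bar>\<gamma>\<bar> \<le> \<delta> / 2"
  proof -
    have "\<eta> * \<bar>\<gamma>\<bar> \<le> \<eta> * (\<bar>\<gamma>\<bar> + 1)" using \<open>0 < \<eta>\<close> by simp
    also have "\<dots> = \<delta> / 2" by (simp add: \<eta>_def field_simps)
    finally show ?thesis .
  qed
  define C where "C = (\<bar>\<kappa>\<bar> + \<bar>1 - \<kappa>\<bar> + \<bar>\<beta>\<bar>) + \<eta> * (\<bar>\<kappa>\<bar> + \<bar>1 - \<kappa>\<bar> + \<bar>\<gamma>\<bar>)"
  have "\<exists>\<omega>0>0. \<forall>\<omega>. 0 \<le> \<omega> \<longrightarrow> \<omega> \<le> \<omega>0 \<longrightarrow> (\<forall>s\<ge>0. exp (\<omega> * s) * (\<bar>W1 s 1 0\<bar> + \<eta> * \<bar>W2 s 1 0\<bar>) \<le> 1 + \<delta>)"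
  proof (rule ex_weight[of p2 "1 + \<delta> / 2"])
    fix s :: real assume s: "0 \<le> s"
    have "\<bar>W1 s 1 0\<bar> \<le> 1" using expconvex_le_1[OF pq2 assms s] by (simp add: W1_def)
    moreover have "\<bar>W2 s 1 0\<bar> \<le> \<bar>\<gamma>\<bar>"
    proof -
      have "exp (- p2 * s) \<le> 1" using pq2 s by simp
      then have "\<bar>exp (- p2 * s) - exp (- q2 * s)\<bar> \<le> 1" using exp_order[OF s] exp_gt_zero[of "- q2 * s"] by linarith
      then have "\<bar>\<gamma>\<bar> * \<bar>exp (- p2 * s) - exp (- q2 * s)\<bar> \<le> \<bar>\<gamma>\<bar> * 1" by (intro mult_left_mono) auto
      then show ?thesis by (simp add: W2_def abs_mult)
    qed
    then have "\<eta> * \<bar>W2 s 1 0\<bar> \<le> \<eta> * \<bar>\<gamma>\<bar>" using \<open>0 < \<eta>\<close> by simp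
    ultimately show "\<bar>W1 s 1 0\<bar> + \<eta> * \<bar>W2 s 1 0\<bar> \<le> 1 + \<delta> / 2"
      using \<open>\<eta> * \<bar>\<gamma>\<bar> \<le> \<delta> / 2\<close> by linarith
    show "\<bar>W1 s 1 0\<bar> + \<eta> * \<bar>W2 s 1 0\<bar> \<le> C * exp (- p2 * s)"
      using W_bound(1)[OF s, of 1 0] mult_left_mono[OF W_bound(2)[OF s, of 1 0], of \<eta>] \<open>0 < \<eta>\<close>
      by (simp add: C_def algebra_simps)
  qed (use pq2 \<open>0 < \<delta>\<close> in auto)
  then obtain \<omega>0 where \<omega>0: "0 < \<omega>0" "\<And>\<omega>. 0 \<le> \<omega> \<Longrightarrow> \<omega> \<le> \<omega>0 \<Longrightarrow> orbit_bound \<omega> \<eta> (1 + \<delta>) 1 0"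
    unfolding orbit_bound_def by blast
  \<comment> \<open>The weight may exceed neither p1 / 2, the decay kept by the first subsystem, nor
    p2, the decay of the second flow.\<close>
  define \<omega> where "\<omega> = min \<omega>0 (min (p1 / 2) p2)"
  have "0 < \<omega>" "\<omega> \<le> \<omega>0" "\<omega> \<le> p1 / 2" "\<omega> \<le> p2" using \<omega>0(1) pq1 pq2 by (auto simp: \<omega>_def)
  then show ?thesis using \<omega>0(2)[of \<omega>] \<open>0 < \<eta>\<close> unfolding \<delta>_def by (intro exI[of _ \<omega>] exI[of _ \<eta>]) auto
qed

theorem flow_decays_all_signals:
  assumes "\<bar>\<kappa>\<bar> \<le> q2 / (q2 - p2)" "switching_times \<sigma> d"
  shows "flow_decays p1 q1 p2 q2 \<kappa> \<beta> \<gamma> d"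
proof -
  obtain \<omega> \<eta> where \<omega>: "0 < \<omega>" "\<omega> \<le> p1 / 2" "\<omega> \<le> p2" and \<eta>: "0 < \<eta>"
    and slow: "orbit_bound \<omega> \<eta> (1 + p1 / (2 * (q1 - p1))) 1 0"
    using ex_orbit_bound_slow[OF assms(1)] by blast
  define C where "C = (\<bar>\<kappa>\<bar> + \<bar>1 - \<kappa>\<bar> + \<bar>\<beta>\<bar>) + \<eta> * (\<bar>\<kappa>\<bar> + \<bar>1 - \<kappa>\<bar> + \<bar>\<gamma>\<bar>)"
  have "0 \<le> C" using \<eta> by (simp add: C_def)
  \<comment> \<open>Since \<omega> \<le> p2, the weighted supremum is finite for every vector and
    comparable to its size.\<close>
  have start: "orbit_bound \<omega> \<eta> (C * (\<bar>u\<bar> + \<bar>v\<bar>)) u v" for u v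
    unfolding orbit_bound_def
  proof (intro allI impI)
    fix s :: real assume s: "0 \<le> s"
    have "\<bar>W1 s u v\<bar> + \<eta> * \<bar>W2 s u v\<bar> \<le> exp (- p2 * s) * (C * (\<bar>u\<bar> + \<bar>v\<bar>))"
      using W_bound(1)[OF s, of u v] mult_left_mono[OF W_bound(2)[OF s, of u v], of \<eta>] \<eta>
      by (simp add: C_def algebra_simps)
    then have "exp (\<omega> * s) * (\<bar>W1 s u v\<bar> + \<eta> * \<bar>W2 s u v\<bar>) \<le> exp (\<omega> * s) * (exp (- p2 * s) * (C * (\<bar>u\<bar> + \<bar>v\<bar>)))"
      by (intro mult_left_mono) auto
    also have "\<dots> = exp ((\<omega> - p2) * s) * (C * (\<bar>u\<bar> + \<bar>v\<bar>))"
      by (simp add: algebra_simps flip: exp_add)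
    also have "\<dots> \<le> 1 * (C * (\<bar>u\<bar> + \<bar>v\<bar>))"
      using \<open>0 \<le> C\<close> \<omega>(3) s by (intro mult_right_mono) (auto simp: mult_nonpos_nonneg)
    finally show "exp (\<omega> * s) * (\<bar>W1 s u v\<bar> + \<eta> * \<bar>W2 s u v\<bar>) \<le> C * (\<bar>u\<bar> + \<bar>v\<bar>)" by simp
  qed
  have d: "d 0 = 0" "mono d" using assms(2) unfolding switching_times_def by (auto intro: strict_mono_mono)
  have main: "\<bar>y1 t\<bar> + \<eta> * \<bar>y2 t\<bar> \<le> C * (\<bar>y1 0\<bar> + \<bar>y2 0\<bar>) * exp (- \<omega> * t)"
    if fl: "switched_flow p1 q1 p2 q2 \<kappa> \<beta> \<gamma> d y1 y2" and "0 \<le> t" for y1 y2 t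
  proof -
    define c where "c = C * (\<bar>y1 0\<bar> + \<bar>y2 0\<bar>)"
    have step: "orbit_bound \<omega> \<eta> (c * exp (- \<omega> * t)) (y1 t) (y2 t)"
      if k: "orbit_bound \<omega> \<eta> (c * exp (- \<omega> * d k)) (y1 (d k)) (y2 (d k))" and t: "d k \<le> t" "t \<le> d (Suc k)" for k t
    proof -
      have e: "c * exp (- \<omega> * d k) * exp (- \<omega> * (t - d k)) = c * exp (- \<omega> * t)"
        by (simp add: algebra_simps flip: exp_add)
      consider j where "k = 2 * j" | j where "k = 2 * j + 1" by (metis evenE oddE)
      then show ?thesis
      proof cases
        case 1
        then have "y1 t = exp (- p1 * (t - d k)) * y1 (d k)" "y2 t = exp (- q1 * (t - d k)) * y2 (d k)"
          using fl t unfolding switched_flow_iff by auto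
        then show ?thesis
          using orbit_bound_D[OF k _ less_imp_le[OF \<eta>] \<omega>(2) slow, of "t - d k"] t unfolding e by simp
      next
        case 2
        then have "y1 t = W1 (t - d k) (y1 (d k)) (y2 (d k))" "y2 t = W2 (t - d k) (y1 (d k)) (y2 (d k))"
          using fl t unfolding switched_flow_iff by auto
        then show ?thesis
          using orbit_bound_W[OF k, of "t - d k"] t unfolding e by simp
      qed
    qed
    have "orbit_bound \<omega> \<eta> (c * exp (- \<omega> * d k)) (y1 (d k)) (y2 (d k))" for k
    proof (induction k)
      case 0
      then show ?case using start d by (simp add: c_def)
    next
      case (Suc k)
      then show ?case using step[OF Suc] d(2) by (simp add: monoD)
    qed
    moreover obtain k where "d k \<le> t" "t \<le> d (Suc k)"
      using ex_switching_interval[OF assms(2), of 0 t] \<open>0 \<le> t\<close> d(1) by auto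
    ultimately have "orbit_bound \<omega> \<eta> (c * exp (- \<omega> * t)) (y1 t) (y2 t)" using step by blast
    then show ?thesis unfolding orbit_bound_def c_def by (auto dest: spec[of _ 0])
  qed
  define B where "B = (1 + 1 / \<eta>) * C"
  have "0 \<le> B" using \<eta> \<open>0 \<le> C\<close> by (simp add: B_def)
  have total: "\<bar>y1 t\<bar> + \<bar>y2 t\<bar> \<le> B * (\<bar>y1 0\<bar> + \<bar>y2 0\<bar>) * exp (- \<omega> * t)"
    if fl: "switched_flow p1 q1 p2 q2 \<kappa> \<beta> \<gamma> d y1 y2" and "0 \<le> t" for y1 y2 t
  proof -
    have "\<bar>y1 t\<bar> + \<bar>y2 t\<bar> \<le> (1 + 1 / \<eta>) * (\<bar>y1 t\<bar> + \<eta> * \<bar>y2 t\<bar>)"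
      using \<eta> by (simp add: field_simps)
    also have "\<dots> \<le> (1 + 1 / \<eta>) * (C * (\<bar>y1 0\<bar> + \<bar>y2 0\<bar>) * exp (- \<omega> * t))"
      using main[OF that] \<eta> by (intro mult_left_mono) auto
    finally show ?thesis by (simp add: B_def mult_ac)
  qed
  show ?thesis unfolding flow_decays_def
  proof (intro exI[of _ B] conjI allI impI)
    fix y1 y2 :: "real \<Rightarrow> real"
    assume fl: "switched_flow p1 q1 p2 q2 \<kappa> \<beta> \<gamma> d y1 y2"
    show "\<bar>y1 t\<bar> + \<bar>y2 t\<bar> \<le> B * (\<bar>y1 0\<bar> + \<bar>y2 0\<bar>)" if "0 \<le> t" for t
    proof -
      have "B * (\<bar>y1 0\<bar> + \<bar>y2 0\<bar>) * exp (- \<omega> * t) \<le> B * (\<bar>y1 0\<bar> + \<bar>y2 0\<bar>) * 1"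
        using \<open>0 \<le> B\<close> \<omega>(1) that by (intro mult_left_mono) auto
      then show ?thesis using total[OF fl that] by linarith
    qed
    have lim: "((\<lambda>t. B * (\<bar>y1 0\<bar> + \<bar>y2 0\<bar>) * exp (- \<omega> * t)) \<longlongrightarrow> 0) at_top"
      using \<omega>(1) by real_asymp
    show "((\<lambda>t. \<bar>y1 t\<bar> + \<bar>y2 t\<bar>) \<longlongrightarrow> 0) at_top"
      by (rule tendsto_sandwich[OF _ _ tendsto_const lim])
         (use total[OF fl] in \<open>auto intro: eventually_mono[OF eventually_ge_at_top[of 0]]\<close>)
  qed (rule \<open>0 \<le> B\<close>)
qed

end

section \<open>Decay for signals with a dwell time\<close>

text \<open>The image of a maximal vector is its mirror image up to sign, so no vector stays maximal
  twice in a row.\<close>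

lemma signed_balanced_contraction:
  fixes x y z \<epsilon> u v :: real
  defines "D \<equiv> x * z + y\<^sup>2" and "u' \<equiv> x * u + y * v" and "v' \<equiv> - y * u + z * v"
  assumes "0 < y" "0 < D" "D < 1" "\<bar>\<epsilon>\<bar> = 1" and T: "\<epsilon> * (x - z) \<le> 1 - D" "- \<epsilon> * (x - z) < 1 - D"
  shows "u'\<^sup>2 + v'\<^sup>2 \<le> u\<^sup>2 + v\<^sup>2"
    and "u'\<^sup>2 + v'\<^sup>2 = u\<^sup>2 + v\<^sup>2 \<Longrightarrow> (u, v) \<noteq> (0, 0) \<Longrightarrow> 0 < \<epsilon> * u * v \<and> \<epsilon> * u' * v' < 0"
proof -
  \<comment> \<open>For N with rows (x, y) and (-y, z), the matrix 1 - N^T N has diagonal entries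
    \<alpha>, \<gamma> and off-diagonal entry -y T; d is its determinant. Positivity follows by
    completing the square.\<close>
  define \<alpha> where "\<alpha> = 1 - x\<^sup>2 - y\<^sup>2"
  define \<gamma> where "\<gamma> = 1 - y\<^sup>2 - z\<^sup>2"
  define T where "T = x - z"
  define d where "d = (1 - D)\<^sup>2 - T\<^sup>2"
  have eps: "\<epsilon> = 1 \<or> \<epsilon> = -1" using assms by linarith
  then have T_abs: "\<bar>T\<bar> \<le> 1 - D" using T by (auto simp: T_def)
  have "T\<^sup>2 \<le> (1 - D)\<^sup>2" using T_abs abs_le_square_iff[of T "1 - D"] by simp
  then have d: "0 \<le> d" by (simp add: d_def)
  have disc: "\<alpha> * \<gamma> - (y * T)\<^sup>2 = d"
    unfolding \<alpha>_def \<gamma>_def T_def d_def D_def by algebra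
  have "\<alpha> + \<gamma> = (1 - D) * (1 + D) + d"
    unfolding \<alpha>_def \<gamma>_def T_def d_def D_def by algebra
  moreover have "0 < (1 - D) * (1 + D)" using assms by simp
  ultimately have tr: "0 < \<alpha> + \<gamma>" using d by linarith
  have "0 < \<alpha>"
  proof (rule ccontr)
    assume "\<not> 0 < \<alpha>"
    then have "\<alpha> \<le> 0" "0 < \<gamma>" using tr by auto
    then have "\<alpha> * \<gamma> \<le> 0" by (simp add: mult_nonpos_nonneg)
    then have "(y * T)\<^sup>2 = 0" "d = 0" using disc d zero_le_power2[of "y * T"] by linarith+
    then have "T = 0" using \<open>0 < y\<close> by simp
    then have "(1 - D)\<^sup>2 = 0" using \<open>d = 0\<close> by (simp add: d_def)
    then show False using assms by simp
  qed
  have form: "\<alpha> * (u\<^sup>2 + v\<^sup>2 - (u'\<^sup>2 + v'\<^sup>2)) = (\<alpha> * u - y * T * v)\<^sup>2 + d * v\<^sup>2"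
    unfolding disc[symmetric] \<alpha>_def \<gamma>_def T_def u'_def v'_def by algebra
  then have "0 \<le> \<alpha> * (u\<^sup>2 + v\<^sup>2 - (u'\<^sup>2 + v'\<^sup>2))" using d by simp
  then show "u'\<^sup>2 + v'\<^sup>2 \<le> u\<^sup>2 + v\<^sup>2" using \<open>0 < \<alpha>\<close> by (simp add: zero_le_mult_iff)
  assume eq: "u'\<^sup>2 + v'\<^sup>2 = u\<^sup>2 + v\<^sup>2" and nz: "(u, v) \<noteq> (0, 0)"
  have "(\<alpha> * u - y * T * v)\<^sup>2 + d * v\<^sup>2 = 0" using form eq by simp
  moreover have "0 \<le> d * v\<^sup>2" using d by simp
  ultimately have au: "\<alpha> * u = y * T * v" and dv: "d * v\<^sup>2 = 0"
    using zero_le_power2[of "\<alpha> * u - y * T * v"] by (smt (verit) power2_eq_square mult_eq_0_iff)+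
  have "v \<noteq> 0" using au nz \<open>0 < \<alpha>\<close> by auto
  then have "d = 0" using dv by simp
  moreover have "(T - (1 - D)) * (T + (1 - D)) = - d" unfolding d_def by algebra
  ultimately have "(T - (1 - D)) * (T + (1 - D)) = 0" by simp
  then have "T = 1 - D \<or> T = - (1 - D)" by auto
  \<comment> \<open>Preserved length forces d = 0, hence T = 1 - D or T = -(1 - D), and the strict
    trace inequality excludes one of the signs.\<close>
  then have TD: "T = \<epsilon> * (1 - D)" using eps T unfolding T_def[symmetric] by auto
  have "\<alpha> * (\<epsilon> * u * v) = y * (1 - D) * v\<^sup>2"
  proof -
    have "\<alpha> * (\<epsilon> * u * v) = \<epsilon> * (\<alpha> * u) * v" by simp
    also have "\<dots> = (\<epsilon> * \<epsilon>) * (y * (1 - D) * v\<^sup>2)" unfolding au TD by (simp add: power2_eq_square)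
    also have "\<epsilon> * \<epsilon> = 1" using eps by auto
    finally show ?thesis by simp
  qed
  also have "\<dots> > 0" using assms \<open>v \<noteq> 0\<close> by simp
  finally have pos: "0 < \<epsilon> * u * v" using \<open>0 < \<alpha>\<close> by (simp only: zero_less_mult_iff) auto
  \<comment> \<open>At this value of T, y^2 splits into linear factors, (1 - x) (1 + z) or (1 + x)
    (1 - z), and the image becomes \<epsilon> (u, -v).\<close>
  have "u' * v' = - (u * v)"
    using eps
  proof
    assume e: "\<epsilon> = 1"
    then have y2: "y\<^sup>2 = (1 - x) * (1 + z)" using TD by (simp add: T_def D_def algebra_simps power2_eq_square)
    have "T \<noteq> 0" using TD e assms by simp
    have "\<alpha> = (1 - x) * T" unfolding \<alpha>_def y2 T_def by algebra
    then have "T * ((1 - x) * u) = T * (y * v)" using au by (simp add: mult_ac)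
    then have 1: "(1 - x) * u = y * v" using \<open>T \<noteq> 0\<close> by simp
    then have "u' = u" by (simp add: u'_def algebra_simps)
    moreover have "y * v' = y * (- v)"
    proof -
      have "y * v' = - (1 + z) * ((1 - x) * u) + z * (y * v)" unfolding v'_def using y2 by algebra
      then show ?thesis unfolding 1 by (simp add: algebra_simps)
    qed
    then have "v' = - v" using \<open>0 < y\<close> mult_left_cancel[of y v' "- v"] by linarith
    ultimately show ?thesis by simp
  next
    assume e: "\<epsilon> = -1"
    then have y2: "y\<^sup>2 = (1 + x) * (1 - z)" using TD unfolding T_def D_def by algebra
    have "T \<noteq> 0" using TD e assms by simp
    have "\<alpha> = - (1 + x) * T" unfolding \<alpha>_def y2 T_def by algebra
    then have "T * (- (1 + x) * u) = T * (y * v)" using au by (simp add: mult_ac)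
    then have "- (1 + x) * u = y * v" using \<open>T \<noteq> 0\<close> mult_left_cancel by blast
    then have 1: "(1 + x) * u = - (y * v)" by linarith
    then have "u' = - u" by (simp add: u'_def algebra_simps)
    moreover have "y * v' = y * v"
    proof -
      have "y * v' = - (1 - z) * ((1 + x) * u) + z * (y * v)" unfolding v'_def using y2 by algebra
      then show ?thesis unfolding 1 by (simp add: algebra_simps)
    qed
    then have "v' = v" using \<open>0 < y\<close> mult_left_cancel[of y v' v] by linarith
    ultimately show ?thesis by simp
  qed
  then have "\<epsilon> * u' * v' = - (\<epsilon> * u * v)" by (simp add: mult.assoc)
  then show "0 < \<epsilon> * u * v \<and> \<epsilon> * u' * v' < 0" using pos by simp
qed

section \<open>Uniform contraction over two cycles\<close>

text \<open>One period of the switched flow: \<open>e1, e2\<close> are the factors of the first subsystem over the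
  time \<open>\<tau>\<close>, balanced against \<open>\<beta>, \<gamma>\<close>; the remaining time in the first subsystem is a diagonal
  contraction \<open>(\<delta>1, \<delta>2)\<close>, and \<open>(f, g)\<close> are the factors of the second subsystem.\<close>

locale balanced_flow = flow_data +
  fixes \<epsilon> \<tau> :: real
  assumes eps: "\<bar>\<epsilon>\<bar> = 1" and tau: "0 < \<tau>" and beta: "0 < \<beta>"
    and balanced: "\<beta> * exp (- q1 * \<tau>) = - \<gamma> * exp (- p1 * \<tau>)"
    and trace: "\<And>s. \<tau> \<le> s \<Longrightarrow>
      \<epsilon> * ((\<kappa> * exp (- p2 * s) + (1 - \<kappa>) * exp (- q2 * s)) * exp (- p1 * \<tau>)
           - ((1 - \<kappa>) * exp (- p2 * s) + \<kappa> * exp (- q2 * s)) * exp (- q1 * \<tau>))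
        \<le> 1 - exp (- p1 * \<tau>) * exp (- q1 * \<tau>) * (exp (- p2 * s) * exp (- q2 * s))"
      "\<And>s. \<tau> \<le> s \<Longrightarrow>
      - \<epsilon> * ((\<kappa> * exp (- p2 * s) + (1 - \<kappa>) * exp (- q2 * s)) * exp (- p1 * \<tau>)
           - ((1 - \<kappa>) * exp (- p2 * s) + \<kappa> * exp (- q2 * s)) * exp (- q1 * \<tau>))
        < 1 - exp (- p1 * \<tau>) * exp (- q1 * \<tau>) * (exp (- p2 * s) * exp (- q2 * s))"
begin

definition cycle :: "(real \<times> real) \<times> (real \<times> real) \<Rightarrow> real \<times> real \<Rightarrow> real \<times> real" where
  "cycle k w =
    (let \<delta>1 = fst (fst k); \<delta>2 = snd (fst k); f = fst (snd k); g = snd (snd k);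
         u = exp (- p1 * \<tau>) * (\<delta>1 * fst w); v = exp (- q1 * \<tau>) * (\<delta>2 * snd w)
     in ((\<kappa> * f + (1 - \<kappa>) * g) * u + \<beta> * (f - g) * v, \<gamma> * (f - g) * u + ((1 - \<kappa>) * f + \<kappa> * g) * v))"

text \<open>The durations s \<ge> \<tau> form an unbounded set. In the variable x = exp (-s) they
  become a bounded interval, compact once x = 0 is added for an infinite stay in the second
  subsystem.\<close>

definition params :: "((real \<times> real) \<times> (real \<times> real)) set" where
  "params = ({0..1} \<times> {0..1}) \<times> (\<lambda>x. (x powr p2, x powr q2)) ` {0..exp (- \<tau>)}"

lemma compact_params: "compact params"
proof -
  have "continuous_on {0..exp (- \<tau>)} (\<lambda>x :: real. x powr p)" if "0 < p" for p
    using that by (intro continuous_on_powr' continuous_intros) auto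
  then show ?thesis
    unfolding params_def using pq2
    by (intro compact_Times compact_continuous_image continuous_on_Pair) auto
qed

lemma exp_in_params:
  assumes "0 \<le> \<delta>1" "\<delta>1 \<le> 1" "0 \<le> \<delta>2" "\<delta>2 \<le> 1" "\<tau> \<le> s"
  shows "((\<delta>1, \<delta>2), (exp (- p2 * s), exp (- q2 * s))) \<in> params"
proof -
  have "(exp (- p2 * s), exp (- q2 * s)) = (exp (- s) powr p2, exp (- s) powr q2)"
    by (simp add: powr_def)
  then show ?thesis using assms unfolding params_def by (auto intro!: image_eqI[of _ _ "exp (- s)"])
qed

lemma params_cases:
  assumes "k \<in> params"
  obtains \<delta>1 \<delta>2 where "k = ((\<delta>1, \<delta>2), (0, 0))" "\<delta>1 \<in> {0..1}" "\<delta>2 \<in> {0..1}"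
  | \<delta>1 \<delta>2 s where "k = ((\<delta>1, \<delta>2), (exp (- p2 * s), exp (- q2 * s)))" "\<delta>1 \<in> {0..1}" "\<delta>2 \<in> {0..1}" "\<tau> \<le> s"
proof -
  obtain \<delta>1 \<delta>2 x where k: "k = ((\<delta>1, \<delta>2), (x powr p2, x powr q2))" "\<delta>1 \<in> {0..1}" "\<delta>2 \<in> {0..1}"
    "0 \<le> x" "x \<le> exp (- \<tau>)"
    using assms unfolding params_def by auto
  show ?thesis
  proof (cases "x = 0")
    case True
    then show ?thesis using k that(1) by simp
  next
    case False
    then have "ln x \<le> ln (exp (- \<tau>))" using k(4,5) by (subst ln_le_cancel_iff) auto
    then have "\<tau> \<le> - ln x" by simp
    moreover have "x powr p2 = exp (- p2 * (- ln x))" "x powr q2 = exp (- q2 * (- ln x))"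
      using False by (simp_all add: powr_def)
    ultimately show ?thesis using k(1-3) that(2)[of \<delta>1 \<delta>2 "- ln x"] by simp
  qed
qed

lemma norm_prod: "(norm (w :: real \<times> real))\<^sup>2 = (fst w)\<^sup>2 + (snd w)\<^sup>2"
  by (cases w) (simp add: norm_Pair)

text \<open>The surplus factors lie in [0, 1]: they do not lengthen a vector, and they do not
  reverse the sign of the product of its coordinates. So equality for w forces equality for (u, v),
  and the sign of u v carries back to w.\<close>

lemma cycle_contraction:
  assumes "k \<in> params"
  shows "norm (cycle k w) \<le> norm w"
    and "norm (cycle k w) = norm w \<Longrightarrow> w \<noteq> 0 \<Longrightarrow> 0 < \<epsilon> * fst w * snd w \<and> \<epsilon> * fst (cycle k w) * snd (cycle k w) < 0"
proof -
  have "norm (cycle k w) \<le> norm w \<and> (norm (cycle k w) = norm w \<longrightarrow> w \<noteq> 0 \<longrightarrow> 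
      0 < \<epsilon> * fst w * snd w \<and> \<epsilon> * fst (cycle k w) * snd (cycle k w) < 0)"
    using assms
  proof (cases rule: params_cases)
    case 1
    then have "cycle k w = 0" by (simp add: cycle_def zero_prod_def)
    then show ?thesis by simp
  next
    case (2 \<delta>1 \<delta>2 s)
    define f where "f = exp (- p2 * s)"
    define g where "g = exp (- q2 * s)"
    define e1 where "e1 = exp (- p1 * \<tau>)"
    define e2 where "e2 = exp (- q1 * \<tau>)"
    define x where "x = (\<kappa> * f + (1 - \<kappa>) * g) * e1"
    define z where "z = ((1 - \<kappa>) * f + \<kappa> * g) * e2"
    define y where "y = \<beta> * (f - g) * e2"
    define u where "u = \<delta>1 * fst w"
    define v where "v = \<delta>2 * snd w"
    have bal: "\<beta> * e2 = - \<gamma> * e1" using balanced by (simp add: e1_def e2_def)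
    then have y': "- y = \<gamma> * (f - g) * e1" unfolding y_def by algebra
    have cyc: "cycle k w = (x * u + y * v, - y * u + z * v)"
      unfolding y' unfolding 2(1) cycle_def Let_def x_def y_def z_def u_def v_def
      by (simp add: f_def g_def e1_def e2_def mult_ac)
    have "p2 * s < q2 * s" using pq2 tau 2 by simp
    then have fg: "0 < g" "g < f" "f < 1" "g < 1" using pq2 tau 2 by (auto simp: f_def g_def mult_pos_pos)
    have e: "0 < e1" "e1 < 1" "0 < e2" "e2 < 1" using pq1 tau by (auto simp: e1_def e2_def)
    have "0 < y" using beta fg e by (simp add: y_def)
    have D: "x * z + y\<^sup>2 = e1 * e2 * (f * g)"
    proof -
      have "y\<^sup>2 = - (\<beta> * \<gamma>) * (f - g)\<^sup>2 * e1 * e2"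
        using bal unfolding y_def by algebra
      also have "\<dots> = - (\<kappa> * (1 - \<kappa>)) * (f - g)\<^sup>2 * e1 * e2" by (simp only: proj)
      finally show ?thesis unfolding x_def z_def by algebra
    qed
    have "0 < x * z + y\<^sup>2" unfolding D using fg e by simp
    moreover have "x * z + y\<^sup>2 < 1"
    proof -
      have "e1 * e2 < 1 * 1" using e by (intro mult_strict_mono') auto
      moreover have "f * g < 1 * 1" using fg by (intro mult_strict_mono') auto
      ultimately have "e1 * e2 * (f * g) < 1 * 1" using fg e by (intro mult_strict_mono') auto
      then show ?thesis unfolding D by simp
    qed
    moreover have "\<epsilon> * (x - z) \<le> 1 - (x * z + y\<^sup>2)" "- \<epsilon> * (x - z) < 1 - (x * z + y\<^sup>2)"
      using trace[OF 2(4), folded f_def g_def e1_def e2_def, folded x_def z_def] unfolding D by simp_all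
    ultimately have contr: "(x * u + y * v)\<^sup>2 + (- y * u + z * v)\<^sup>2 \<le> u\<^sup>2 + v\<^sup>2"
      and strict: "(x * u + y * v)\<^sup>2 + (- y * u + z * v)\<^sup>2 = u\<^sup>2 + v\<^sup>2 \<Longrightarrow> (u, v) \<noteq> (0, 0) \<Longrightarrow>
         0 < \<epsilon> * u * v \<and> \<epsilon> * (x * u + y * v) * (- y * u + z * v) < 0"
      using signed_balanced_contraction[OF \<open>0 < y\<close> _ _ eps, of x z u v] by auto
    have uv: "u\<^sup>2 \<le> (fst w)\<^sup>2" "v\<^sup>2 \<le> (snd w)\<^sup>2"
      using 2(2,3) mult_right_mono[OF power_le_one[of _ 2], of _ "(fst w)\<^sup>2"]
        mult_right_mono[OF power_le_one[of _ 2], of _ "(snd w)\<^sup>2"]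
      by (auto simp: u_def v_def power_mult_distrib)
    have sq: "(norm (cycle k w))\<^sup>2 = (x * u + y * v)\<^sup>2 + (- y * u + z * v)\<^sup>2"
      unfolding norm_prod cyc by simp
    have "(norm (cycle k w))\<^sup>2 \<le> (norm w)\<^sup>2"
      unfolding sq norm_prod[of w] using contr uv by linarith
    then have le: "norm (cycle k w) \<le> norm w" by (simp add: power2_le_iff_abs_le)
    moreover have "0 < \<epsilon> * fst w * snd w \<and> \<epsilon> * fst (cycle k w) * snd (cycle k w) < 0"
      if eq: "norm (cycle k w) = norm w" and "w \<noteq> 0"
    proof -
      have "(x * u + y * v)\<^sup>2 + (- y * u + z * v)\<^sup>2 = (fst w)\<^sup>2 + (snd w)\<^sup>2"
        using sq eq by (simp add: norm_prod)
      then have "(x * u + y * v)\<^sup>2 + (- y * u + z * v)\<^sup>2 = u\<^sup>2 + v\<^sup>2" "u\<^sup>2 = (fst w)\<^sup>2" "v\<^sup>2 = (snd w)\<^sup>2"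
        using contr uv by linarith+
      moreover have "(u, v) \<noteq> (0, 0)"
        using calculation(2,3) \<open>w \<noteq> 0\<close> by (auto simp: zero_prod_def prod_eq_iff)
      ultimately have s: "0 < \<epsilon> * u * v" "\<epsilon> * (x * u + y * v) * (- y * u + z * v) < 0" using strict by auto
      have "0 < (\<delta>1 * \<delta>2) * (\<epsilon> * fst w * snd w)" using s(1) by (simp add: u_def v_def mult_ac)
      moreover have "0 \<le> \<delta>1 * \<delta>2" using 2(2,3) by simp
      ultimately have "0 < \<epsilon> * fst w * snd w" by (simp add: zero_less_mult_iff)
      then show ?thesis using s(2) by (simp add: cyc)
    qed
    ultimately show ?thesis by blast
  qed
  then show "norm (cycle k w) \<le> norm w"
    "norm (cycle k w) = norm w \<Longrightarrow> w \<noteq> 0 \<Longrightarrow> 0 < \<epsilon> * fst w * snd w \<and> \<epsilon> * fst (cycle k w) * snd (cycle k w) < 0"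
    by auto
qed

lemma two_cycles_strict:
  assumes "k \<in> params" "k' \<in> params" "w \<noteq> 0"
  shows "norm (cycle k' (cycle k w)) < norm w"
proof (rule ccontr)
  assume "\<not> norm (cycle k' (cycle k w)) < norm w"
  then have eq: "norm (cycle k' (cycle k w)) = norm (cycle k w)" "norm (cycle k w) = norm w"
    using cycle_contraction(1)[OF assms(1), of w] cycle_contraction(1)[OF assms(2), of "cycle k w"] by auto
  then have "cycle k w \<noteq> 0" using assms(3) by auto
  then show False
    using cycle_contraction(2)[OF assms(1) eq(2) assms(3)] cycle_contraction(2)[OF assms(2) eq(1)] by auto
qed

lemma cycle_scaleR: "cycle k (r *\<^sub>R w) = r *\<^sub>R cycle k w"
  by (simp add: cycle_def Let_def algebra_simps)

lemma two_cycles_uniform: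
  "\<exists>\<rho>. 0 \<le> \<rho> \<and> \<rho> < 1 \<and> (\<forall>k\<in>params. \<forall>k'\<in>params. \<forall>w. norm (cycle k' (cycle k w)) \<le> \<rho> * norm w)"
proof -
  let ?K = "params \<times> params \<times> sphere (0 :: real \<times> real) 1"
  let ?F = "\<lambda>z. norm (cycle (fst (snd z)) (cycle (fst z) (snd (snd z))))"
  have "compact ?K" by (intro compact_Times compact_params) simp
  moreover have "((1, 1), (exp (- p2 * \<tau>), exp (- q2 * \<tau>))) \<in> params" by (rule exp_in_params) auto
  then have "?K \<noteq> {}" using norm_Pair[of "1::real" "0::real"] by (auto intro!: exI[of _ 1] exI[of _ 0])
  moreover have "continuous_on ?K ?F"
    unfolding cycle_def Let_def by (intro continuous_intros)
  ultimately obtain z where z: "z \<in> ?K" "\<And>y. y \<in> ?K \<Longrightarrow> ?F y \<le> ?F z"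
    using continuous_attains_sup[of ?K ?F] by blast
  have "norm (snd (snd z)) = 1" using z(1) by (auto simp: mem_Times_iff)
  then have "snd (snd z) \<noteq> 0" by (metis norm_zero zero_neq_one)
  then have "?F z < 1"
    using two_cycles_strict[of "fst z" "fst (snd z)" "snd (snd z)"] z(1) \<open>norm (snd (snd z)) = 1\<close>
    by (simp add: mem_Times_iff)
  moreover have "norm (cycle k' (cycle k w)) \<le> ?F z * norm w" if "k \<in> params" "k' \<in> params" for k k' w
  proof (cases "w = 0")
    case True
    then have "cycle k' (cycle k w) = 0" by (simp add: cycle_def zero_prod_def)
    then show ?thesis using True by simp
  next
    case False
    define v where "v = (1 / norm w) *\<^sub>R w"
    have "norm v = 1" using False by (simp add: v_def)
    then have "norm (cycle k' (cycle k v)) \<le> ?F z" using z(2)[of "(k, k', v)"] that by simp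
    moreover have "w = norm w *\<^sub>R v" using False by (simp add: v_def)
    then have "norm (cycle k' (cycle k w)) = norm w * norm (cycle k' (cycle k v))"
      by (metis cycle_scaleR norm_scaleR abs_norm_cancel)
    ultimately show ?thesis by (simp add: mult.commute mult_left_mono)
  qed
  ultimately show ?thesis by (intro exI[of _ "?F z"]) auto
qed

text \<open>The norm can fail to decrease over one cycle, hence the exponents \<open>j div 2\<close>.\<close>

theorem flow_decays_dwell:
  assumes sw: "switching_times \<sigma> d" and dwell: "\<And>j. 1 \<le> j \<Longrightarrow> \<tau> \<le> dur1 d j \<and> \<tau> \<le> dur2 d j"
  shows "flow_decays p1 q1 p2 q2 \<kappa> \<beta> \<gamma> d"
proof -
  obtain \<rho> where \<rho>: "0 \<le> \<rho>" "\<rho> < 1"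
    and two: "\<And>k k' w. k \<in> params \<Longrightarrow> k' \<in> params \<Longrightarrow> norm (cycle k' (cycle k w)) \<le> \<rho> * norm w"
    using two_cycles_uniform by blast
  have d: "d 0 = 0" "mono d" using sw unfolding switching_times_def by (auto intro: strict_mono_mono)
  define C where "C = (\<bar>\<kappa>\<bar> + \<bar>1 - \<kappa>\<bar> + \<bar>\<beta>\<bar>) + (\<bar>\<kappa>\<bar> + \<bar>1 - \<kappa>\<bar> + \<bar>\<gamma>\<bar>)"
  have "1 \<le> \<bar>\<kappa>\<bar> + \<bar>1 - \<kappa>\<bar>" by linarith
  then have "1 \<le> C" unfolding C_def by linarith
  have main: "\<bar>y1 t\<bar> + \<bar>y2 t\<bar> \<le> C * (2 * (\<rho> ^ (j div 2) * norm (y1 0, y2 0)))"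
    if fl: "switched_flow p1 q1 p2 q2 \<kappa> \<beta> \<gamma> d y1 y2" and t: "d (2 * j) \<le> t" "t \<le> d (2 * j + 2)" for y1 y2 j t
  proof -
    define w where "w j = (y1 (d (2 * j)), y2 (d (2 * j)))" for j
    note fl1 = fl[unfolded switched_flow_iff, THEN conjunct1, rule_format]
    note fl2 = fl[unfolded switched_flow_iff, THEN conjunct2, rule_format]
    have dm: "d (2 * j) \<le> d (2 * j + 1)" "d (2 * j + 1) \<le> d (2 * j + 2)" for j
      using d(2) by (auto simp: monoD)
    have cyc: "\<exists>k\<in>params. w (Suc j) = cycle k (w j)" for j
    proof -
      define t1 where "t1 = d (2 * j + 1) - d (2 * j)"
      define s1 where "s1 = d (2 * j + 2) - d (2 * j + 1)"
      \<comment> \<open>Durations are counted from 1 and cycles from 0, hence the index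
        \<open>Suc j\<close>.\<close>
      have "\<tau> \<le> t1" "\<tau> \<le> s1" using dwell[of "Suc j"] by (auto simp: dur1_def dur2_def t1_def s1_def)
      let ?k = "((exp (- p1 * (t1 - \<tau>)), exp (- q1 * (t1 - \<tau>))), (exp (- p2 * s1), exp (- q2 * s1)))"
      have "?k \<in> params" using \<open>\<tau> \<le> t1\<close> \<open>\<tau> \<le> s1\<close> pq1 by (intro exp_in_params) auto
      moreover have "w (Suc j) = cycle ?k (w j)"
      proof -
        have e: "exp (- p1 * \<tau>) * (exp (- p1 * (t1 - \<tau>)) * u) = exp (- p1 * t1) * u"
          "exp (- q1 * \<tau>) * (exp (- q1 * (t1 - \<tau>)) * u) = exp (- q1 * t1) * u" for u
          by (simp_all add: mult.assoc[symmetric] algebra_simps flip: exp_add)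
        have y: "y1 (d (2 * j + 1)) = exp (- p1 * t1) * y1 (d (2 * j))" "y2 (d (2 * j + 1)) = exp (- q1 * t1) * y2 (d (2 * j))"
          "y1 (d (2 * j + 2)) = W1 s1 (y1 (d (2 * j + 1))) (y2 (d (2 * j + 1)))"
          "y2 (d (2 * j + 2)) = W2 s1 (y1 (d (2 * j + 1))) (y2 (d (2 * j + 1)))"
          unfolding t1_def s1_def using fl1[of j "d (2 * j + 1)"] fl2[of j "d (2 * j + 2)"] dm[of j] by blast+
        have "w (Suc j) = (y1 (d (2 * j + 2)), y2 (d (2 * j + 2)))" by (simp add: w_def)
        then show ?thesis
          unfolding y w_def cycle_def Let_def W1_def W2_def fst_conv snd_conv e .
      qed
      ultimately show ?thesis by blast
    qed
    have wn: "norm (w j) \<le> \<rho> ^ (j div 2) * norm (w 0)" for j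
    proof (induction j rule: induct_nat_012)
      case 1
      obtain k where "k \<in> params" "w (Suc 0) = cycle k (w 0)" using cyc[of 0] by blast
      then show ?case using cycle_contraction(1)[of k "w 0"] by simp
    next
      case (ge2 n)
      obtain k where k: "k \<in> params" "w (Suc n) = cycle k (w n)" using cyc[of n] by blast
      obtain k' where k': "k' \<in> params" "w (Suc (Suc n)) = cycle k' (w (Suc n))" using cyc[of "Suc n"] by blast
      have "norm (w (Suc (Suc n))) \<le> \<rho> * norm (w n)" using two[OF k(1) k'(1)] by (simp only: k k')
      also have "\<dots> \<le> \<rho> * (\<rho> ^ (n div 2) * norm (w 0))" using ge2(1) \<rho>(1) by (rule mult_left_mono)
      finally show ?case by simp
    qed simp
    have l1: "\<bar>a\<bar> + \<bar>b\<bar> \<le> 2 * norm (a, b)" for a b :: real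
      using norm_fst_le[where x = a and y = b] norm_snd_le[where x = a and y = b] by simp
    have D: "\<bar>exp (- p1 * r) * u\<bar> \<le> \<bar>u\<bar>" "\<bar>exp (- q1 * r) * u\<bar> \<le> \<bar>u\<bar>" if "0 \<le> r" for r u :: real
      using that pq1 by (auto simp: abs_mult intro!: mult_left_le_one_le)
    have first: "\<bar>y1 t\<bar> + \<bar>y2 t\<bar> \<le> \<bar>fst (w j)\<bar> + \<bar>snd (w j)\<bar>" if "d (2 * j) \<le> t" "t \<le> d (2 * j + 1)" for t
      using fl1[of j t] that D(1)[of "t - d (2 * j)" "fst (w j)"] D(2)[of "t - d (2 * j)" "snd (w j)"]
      by (simp add: w_def)
    have "\<bar>y1 t\<bar> + \<bar>y2 t\<bar> \<le> C * (\<bar>fst (w j)\<bar> + \<bar>snd (w j)\<bar>)"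
    proof (cases "t \<le> d (2 * j + 1)")
      case True
      have "1 * (\<bar>fst (w j)\<bar> + \<bar>snd (w j)\<bar>) \<le> C * (\<bar>fst (w j)\<bar> + \<bar>snd (w j)\<bar>)"
        using \<open>1 \<le> C\<close> by (intro mult_right_mono) auto
      then show ?thesis using first[of t] t True by simp
    next
      case False
      define s where "s = t - d (2 * j + 1)"
      define u where "u = y1 (d (2 * j + 1))"
      define v where "v = y2 (d (2 * j + 1))"
      have s: "0 \<le> s" using False by (simp add: s_def)
      have "y1 t = W1 s u v" "y2 t = W2 s u v" using fl2[of j t] False t by (simp_all add: s_def u_def v_def)
      then have "\<bar>y1 t\<bar> + \<bar>y2 t\<bar> \<le> exp (- p2 * s) * (C * (\<bar>u\<bar> + \<bar>v\<bar>))"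
        using W_bound[OF s, of u v] by (simp add: C_def algebra_simps)
      also have "\<dots> \<le> 1 * (C * (\<bar>u\<bar> + \<bar>v\<bar>))"
        using s pq2 \<open>1 \<le> C\<close> by (intro mult_right_mono) auto
      also have "\<dots> \<le> C * (\<bar>fst (w j)\<bar> + \<bar>snd (w j)\<bar>)"
        using first[of "d (2 * j + 1)"] dm[of j] \<open>1 \<le> C\<close> by (simp add: u_def v_def)
      finally show ?thesis .
    qed
    also have "\<dots> \<le> C * (2 * norm (w j))"
      using l1[of "fst (w j)" "snd (w j)"] \<open>1 \<le> C\<close> by simp
    also have "\<dots> \<le> C * (2 * (\<rho> ^ (j div 2) * norm (w 0)))"
      using wn[of j] \<open>1 \<le> C\<close> by simp
    finally show ?thesis using d(1) by (simp add: w_def)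
  qed
  \<comment> \<open>The time \<open>d (2 * (2 * i))\<close> ends the first 2 i cycles, that is, i
    pairs, each worth a factor \<rho>.\<close>
  have from_interval: "\<bar>y1 t\<bar> + \<bar>y2 t\<bar> \<le> C * (2 * (\<rho> ^ i * norm (y1 0, y2 0)))"
    if fl: "switched_flow p1 q1 p2 q2 \<kappa> \<beta> \<gamma> d y1 y2" and t: "d (2 * (2 * i)) \<le> t" for y1 y2 i t
  proof -
    obtain k where k: "2 * (2 * i) \<le> k" "d k \<le> t" "t \<le> d (Suc k)"
      using ex_switching_interval[OF sw t] by blast
    define j where "j = k div 2"
    have "2 * j \<le> k" "Suc k \<le> 2 * j + 2" "i \<le> j div 2" using k(1) by (auto simp: j_def)
    then have "d (2 * j) \<le> t" "t \<le> d (2 * j + 2)"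
      using k monoD[OF d(2), of "2 * j" k] monoD[OF d(2), of "Suc k" "2 * j + 2"] by linarith+
    then have "\<bar>y1 t\<bar> + \<bar>y2 t\<bar> \<le> C * (2 * (\<rho> ^ (j div 2) * norm (y1 0, y2 0)))" using main[OF fl] by blast
    also have "\<dots> \<le> C * (2 * (\<rho> ^ i * norm (y1 0, y2 0)))"
      using \<rho> \<open>i \<le> j div 2\<close> \<open>1 \<le> C\<close> by (intro mult_left_mono mult_right_mono power_decreasing) auto
    finally show ?thesis .
  qed
  show ?thesis unfolding flow_decays_def
  proof (intro exI[of _ "2 * C"] conjI allI impI)
    fix y1 y2 :: "real \<Rightarrow> real"
    assume fl: "switched_flow p1 q1 p2 q2 \<kappa> \<beta> \<gamma> d y1 y2"
    show "\<bar>y1 t\<bar> + \<bar>y2 t\<bar> \<le> 2 * C * (\<bar>y1 0\<bar> + \<bar>y2 0\<bar>)" if "0 \<le> t" for t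
    proof -
      have "\<bar>y1 t\<bar> + \<bar>y2 t\<bar> \<le> C * (2 * norm (y1 0, y2 0))"
        using from_interval[OF fl, of 0 t] that d(1) by simp
      also have "\<dots> \<le> C * (2 * (\<bar>y1 0\<bar> + \<bar>y2 0\<bar>))"
        using norm_Pair_le[of "y1 0" "y2 0"] \<open>1 \<le> C\<close> by simp
      also have "\<dots> = 2 * C * (\<bar>y1 0\<bar> + \<bar>y2 0\<bar>)" by (simp only: mult_ac)
      finally show ?thesis .
    qed
    show "((\<lambda>t. \<bar>y1 t\<bar> + \<bar>y2 t\<bar>) \<longlongrightarrow> 0) at_top"
    proof (rule order_tendstoI)
      fix a :: real assume "a < 0"
      then show "\<forall>\<^sub>F t in at_top. a < \<bar>y1 t\<bar> + \<bar>y2 t\<bar>" by (intro always_eventually allI) linarith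
    next
      fix a :: real assume "0 < a"
      have "(\<lambda>i. C * (2 * (\<rho> ^ i * norm (y1 0, y2 0)))) \<longlonglongrightarrow> C * (2 * (0 * norm (y1 0, y2 0)))"
        using \<rho> by (intro tendsto_intros LIMSEQ_power_zero) auto
      then have "\<forall>\<^sub>F i in sequentially. C * (2 * (\<rho> ^ i * norm (y1 0, y2 0))) < a"
        using \<open>0 < a\<close> by (intro order_tendstoD(2)) auto
      then obtain i where "C * (2 * (\<rho> ^ i * norm (y1 0, y2 0))) < a"
        unfolding eventually_sequentially by blast
      then have "\<bar>y1 t\<bar> + \<bar>y2 t\<bar> < a" if "d (2 * (2 * i)) \<le> t" for t
        using from_interval[OF fl that] by linarith
      then show "\<forall>\<^sub>F t in at_top. \<bar>y1 t\<bar> + \<bar>y2 t\<bar> < a"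
        unfolding eventually_at_top_linorder by blast
    qed
  qed (use \<open>1 \<le> C\<close> in simp)
qed

end

section \<open>Balancing coordinates and the threshold\<close>

lemma flow_decays_rescale:
  assumes "\<nu> \<noteq> 0" and dec: "flow_decays p1 q1 p2 q2 \<kappa> (\<nu> * \<beta>) (\<gamma> / \<nu>) d"
  shows "flow_decays p1 q1 p2 q2 \<kappa> \<beta> \<gamma> d"
proof -
  \<comment> \<open>Scaling the first coordinate by \<nu> multiplies \<beta> and divides \<gamma>,
    leaving \<kappa> and the product \<beta> \<gamma> unchanged.\<close>
  have fl: "switched_flow p1 q1 p2 q2 \<kappa> (\<nu> * \<beta>) (\<gamma> / \<nu>) d (\<lambda>t. \<nu> * y1 t) y2"
    if "switched_flow p1 q1 p2 q2 \<kappa> \<beta> \<gamma> d y1 y2" for y1 y2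
    unfolding switched_flow_def Let_def
  proof (intro conjI allI impI)
    fix j t assume t: "d (2 * j) \<le> t \<and> t \<le> d (2 * j + 1)"
    show "\<nu> * y1 t = exp (- p1 * (t - d (2 * j))) * (\<nu> * y1 (d (2 * j)))"
      "y2 t = exp (- q1 * (t - d (2 * j))) * y2 (d (2 * j))"
      using that t unfolding switched_flow_def by auto
  next
    fix j t assume t: "d (2 * j + 1) \<le> t \<and> t \<le> d (2 * j + 2)"
    define f where "f = exp (- p2 * (t - d (2 * j + 1)))"
    define g where "g = exp (- q2 * (t - d (2 * j + 1)))"
    define u where "u = y1 (d (2 * j + 1))"
    define v where "v = y2 (d (2 * j + 1))"
    have "y1 t = (\<kappa> * f + (1 - \<kappa>) * g) * u + \<beta> * (f - g) * v"
      "y2 t = \<gamma> * (f - g) * u + ((1 - \<kappa>) * f + \<kappa> * g) * v"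
      using that t unfolding switched_flow_def Let_def f_def g_def u_def v_def by blast+
    note eqs = this
    have "\<nu> * y1 t = (\<kappa> * f + (1 - \<kappa>) * g) * (\<nu> * u) + \<nu> * \<beta> * (f - g) * v"
      "y2 t = \<gamma> / \<nu> * (f - g) * (\<nu> * u) + ((1 - \<kappa>) * f + \<kappa> * g) * v"
      unfolding eqs using assms(1) by (simp_all add: field_simps)
    then show "\<nu> * y1 t = (\<kappa> * exp (- p2 * (t - d (2 * j + 1))) + (1 - \<kappa>) * exp (- q2 * (t - d (2 * j + 1)))) * (\<nu> * y1 (d (2 * j + 1)))
         + \<nu> * \<beta> * (exp (- p2 * (t - d (2 * j + 1))) - exp (- q2 * (t - d (2 * j + 1)))) * y2 (d (2 * j + 1))"
      "y2 t = \<gamma> / \<nu> * (exp (- p2 * (t - d (2 * j + 1))) - exp (- q2 * (t - d (2 * j + 1)))) * (\<nu> * y1 (d (2 * j + 1)))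
         + ((1 - \<kappa>) * exp (- p2 * (t - d (2 * j + 1))) + \<kappa> * exp (- q2 * (t - d (2 * j + 1)))) * y2 (d (2 * j + 1))"
      unfolding f_def g_def u_def v_def by blast+
  qed
  define m where "m = min \<bar>\<nu>\<bar> 1"
  define B where "B = max \<bar>\<nu>\<bar> 1"
  have m: "0 < m" "m \<le> \<bar>\<nu>\<bar>" "m \<le> 1" and B: "\<bar>\<nu>\<bar> \<le> B" "1 \<le> B" using assms(1) by (auto simp: m_def B_def)
  have up: "\<bar>\<nu> * u\<bar> + \<bar>v\<bar> \<le> B * (\<bar>u\<bar> + \<bar>v\<bar>)" for u v
    using mult_right_mono[OF B(1), of "\<bar>u\<bar>"] mult_right_mono[OF B(2), of "\<bar>v\<bar>"] by (simp add: abs_mult algebra_simps)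
  have low: "\<bar>u\<bar> + \<bar>v\<bar> \<le> (\<bar>\<nu> * u\<bar> + \<bar>v\<bar>) / m" for u v
    using mult_right_mono[OF m(2), of "\<bar>u\<bar>"] mult_right_mono[OF m(3), of "\<bar>v\<bar>"] m(1)
    by (simp add: abs_mult algebra_simps pos_le_divide_eq)
  obtain C where C: "0 \<le> C"
    and b: "\<And>y1 y2 t. switched_flow p1 q1 p2 q2 \<kappa> (\<nu> * \<beta>) (\<gamma> / \<nu>) d y1 y2 \<Longrightarrow> 0 \<le> t \<Longrightarrow>
      \<bar>y1 t\<bar> + \<bar>y2 t\<bar> \<le> C * (\<bar>y1 0\<bar> + \<bar>y2 0\<bar>)"
    and l: "\<And>y1 y2. switched_flow p1 q1 p2 q2 \<kappa> (\<nu> * \<beta>) (\<gamma> / \<nu>) d y1 y2 \<Longrightarrow>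
      ((\<lambda>t. \<bar>y1 t\<bar> + \<bar>y2 t\<bar>) \<longlongrightarrow> 0) at_top"
    using dec unfolding flow_decays_def by blast
  show ?thesis unfolding flow_decays_def
  proof (intro exI[of _ "C * B / m"] conjI allI impI)
    fix y1 y2 :: "real \<Rightarrow> real"
    assume y: "switched_flow p1 q1 p2 q2 \<kappa> \<beta> \<gamma> d y1 y2"
    show "\<bar>y1 t\<bar> + \<bar>y2 t\<bar> \<le> C * B / m * (\<bar>y1 0\<bar> + \<bar>y2 0\<bar>)" if "0 \<le> t" for t
    proof -
      have "\<bar>\<nu> * y1 t\<bar> + \<bar>y2 t\<bar> \<le> C * (\<bar>\<nu> * y1 0\<bar> + \<bar>y2 0\<bar>)" using b[OF fl[OF y] that] .
      also have "\<dots> \<le> C * (B * (\<bar>y1 0\<bar> + \<bar>y2 0\<bar>))" using up C by (rule mult_left_mono)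
      finally have "(\<bar>\<nu> * y1 t\<bar> + \<bar>y2 t\<bar>) / m \<le> C * (B * (\<bar>y1 0\<bar> + \<bar>y2 0\<bar>)) / m"
        using m(1) by (simp add: divide_right_mono)
      then show ?thesis using low[of "y1 t" "y2 t"] by simp
    qed
    have lim: "((\<lambda>t. (\<bar>\<nu> * y1 t\<bar> + \<bar>y2 t\<bar>) / m) \<longlongrightarrow> 0) at_top"
      using tendsto_divide[OF l[OF fl[OF y]] tendsto_const, of m] m(1) by simp
    show "((\<lambda>t. \<bar>y1 t\<bar> + \<bar>y2 t\<bar>) \<longlongrightarrow> 0) at_top"
      by (rule tendsto_sandwich[OF _ _ tendsto_const lim]) (use low in auto)
  qed (use C B m in simp)
qed

context hyperbolic_pair
begin

text \<open>The trace conditions of \<open>balanced_flow\<close> are the identities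
  \<open>signed_trace_eqs\<close> at t = \<tau>: nonnegativity of \<open>H\<close> yields the weak
  one, the conjugate factor the strict one.\<close>

lemma dwell_flow_decays:
  assumes "0 < \<tau>" and H: "\<And>s. \<tau> \<le> s \<Longrightarrow> 0 \<le> H \<tau> s" and proj: "\<beta> * \<gamma> = \<kappa> * (1 - \<kappa>)"
    and sw: "switching_times \<sigma> d" and dwell: "\<And>j. 1 \<le> j \<Longrightarrow> \<tau> \<le> dur1 d j \<and> \<tau> \<le> dur2 d j"
  shows "flow_decays p1 q1 p2 q2 \<kappa> \<beta> \<gamma> d"
proof -
  define e1 where "e1 = exp (- p1 * \<tau>)"
  define e2 where "e2 = exp (- q1 * \<tau>)"
  have e: "0 < e1" "0 < e2" by (simp_all add: e1_def e2_def)
  have "(2 * \<kappa> - 1)\<^sup>2 = c\<^sup>2" using kappa eps_cases by (auto simp: power_mult_distrib)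
  moreover have "1 < c\<^sup>2" using c_gt_1 by (simp add: one_less_power)
  \<comment> \<open>The product is \<kappa> (1 - \<kappa>) = (1 - c^2) / 4.\<close>
  ultimately have "\<beta> * \<gamma> < 0" unfolding proj by (simp add: power2_eq_square algebra_simps)
  then have "\<beta> \<noteq> 0" by auto
  \<comment> \<open>The square is dictated by \<nu> \<beta> e2 = -(\<gamma> / \<nu>) e1, which makes
    the off-diagonal entries opposite; the sign makes \<nu> \<beta> positive.\<close>
  define \<nu> where "\<nu> = sgn \<beta> * sqrt (- \<gamma> * e1 / (\<beta> * e2))"
  have "0 < - \<gamma> / \<beta>" using \<open>\<beta> * \<gamma> < 0\<close> by (auto simp: mult_less_0_iff divide_less_0_iff)
  then have pos: "0 < - \<gamma> * e1 / (\<beta> * e2)"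
    using e by (metis divide_pos_pos mult_pos_pos times_divide_times_eq)
  then have "0 < sqrt (- \<gamma> * e1 / (\<beta> * e2))" by (rule real_sqrt_gt_zero)
  then have "\<nu> \<noteq> 0" unfolding \<nu>_def using \<open>\<beta> \<noteq> 0\<close> by (metis mult_eq_0_iff less_irrefl sgn_eq_0_iff)
  have \<nu>2: "\<nu> * \<nu> = - \<gamma> * e1 / (\<beta> * e2)"
  proof -
    have "sgn \<beta> * sgn \<beta> = 1" using \<open>\<beta> \<noteq> 0\<close> by (auto simp: sgn_if)
    moreover have "\<nu> * \<nu> = (sgn \<beta> * sgn \<beta>) * (sqrt (- \<gamma> * e1 / (\<beta> * e2)) * sqrt (- \<gamma> * e1 / (\<beta> * e2)))"
      by (simp only: \<nu>_def mult_ac)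
    moreover have "sqrt (- \<gamma> * e1 / (\<beta> * e2)) * sqrt (- \<gamma> * e1 / (\<beta> * e2)) = - \<gamma> * e1 / (\<beta> * e2)"
      unfolding real_sqrt_mult_self by (rule abs_of_pos[OF pos])
    ultimately show ?thesis by (simp only: mult_1)
  qed
  interpret balanced_flow p1 q1 p2 q2 \<kappa> "\<nu> * \<beta>" "\<gamma> / \<nu>" \<epsilon> \<tau>
  proof unfold_locales
    show "\<nu> * \<beta> * (\<gamma> / \<nu>) = \<kappa> * (1 - \<kappa>)" using \<open>\<nu> \<noteq> 0\<close> proj by simp
    show "0 < \<nu> * \<beta>"
    proof -
      have "0 < sgn \<beta> * \<beta>" using \<open>\<beta> \<noteq> 0\<close> by (simp add: mult.commute flip: abs_sgn)
      from this \<open>0 < sqrt (- \<gamma> * e1 / (\<beta> * e2))\<close> have "0 < (sgn \<beta> * \<beta>) * sqrt (- \<gamma> * e1 / (\<beta> * e2))" by (rule mult_pos_pos)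
      then show ?thesis by (simp only: \<nu>_def mult_ac)
    qed
    have "\<nu> * \<nu> * (\<beta> * e2) = - \<gamma> * e1" using \<nu>2 \<open>\<beta> \<noteq> 0\<close> e by simp
    then show "\<nu> * \<beta> * exp (- q1 * \<tau>) = - (\<gamma> / \<nu>) * exp (- p1 * \<tau>)"
      using \<open>\<nu> \<noteq> 0\<close> by (simp add: e1_def e2_def field_simps)
  next
    fix s assume s: "\<tau> \<le> s"
    define f where "f = exp (- p2 * s)"
    define g where "g = exp (- q2 * s)"
    have ex: "exp (- p1 * \<tau> - p2 * s) = e1 * f" "exp (- q1 * \<tau> - q2 * s) = e2 * g"
      "exp (- p1 * \<tau> - q2 * s) = e1 * g" "exp (- p2 * s - q1 * \<tau>) = e2 * f"
      "exp (- (p1 + q1) * \<tau> - (p2 + q2) * s) = e1 * e2 * (f * g)"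
      by (simp_all add: e1_def e2_def f_def g_def algebra_simps flip: exp_add)
    have T: "\<kappa> * (e1 * f - e2 * g) - (\<kappa> - 1) * (e1 * g - e2 * f)
       = (\<kappa> * f + (1 - \<kappa>) * g) * e1 - ((1 - \<kappa>) * f + \<kappa> * g) * e2"
      by (simp add: algebra_simps)
    note eqs = signed_trace_eqs[of \<tau> s, unfolded ex T]
    have "0 \<le> 2 * exp (- ((p1 + q1) / 2 * \<tau> + (p2 + q2) / 2 * s)) * H \<tau> s" using H[OF s] by simp
    then show "\<epsilon> * ((\<kappa> * exp (- p2 * s) + (1 - \<kappa>) * exp (- q2 * s)) * exp (- p1 * \<tau>)
           - ((1 - \<kappa>) * exp (- p2 * s) + \<kappa> * exp (- q2 * s)) * exp (- q1 * \<tau>))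
        \<le> 1 - exp (- p1 * \<tau>) * exp (- q1 * \<tau>) * (exp (- p2 * s) * exp (- q2 * s))"
      using eqs(1) unfolding e1_def[symmetric] e2_def[symmetric] f_def[symmetric] g_def[symmetric] by linarith
    have "0 < 2 * exp (- ((p1 + q1) / 2 * \<tau> + (p2 + q2) / 2 * s)) *
       (sinh ((p1 + q1) / 2 * \<tau> + (p2 + q2) / 2 * s) 
           + \<epsilon> * sinh ((q1 - p1) / 2 * \<tau>) * cosh ((q2 - p2) / 2 * s)
           + c * cosh ((q1 - p1) / 2 * \<tau>) * sinh ((q2 - p2) / 2 * s))"
      using conjugate_factor_pos[of \<tau> s] assms(1) s by (intro mult_pos_pos) auto
    then show "- \<epsilon> * ((\<kappa> * exp (- p2 * s) + (1 - \<kappa>) * exp (- q2 * s)) * exp (- p1 * \<tau>)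
           - ((1 - \<kappa>) * exp (- p2 * s) + \<kappa> * exp (- q2 * s)) * exp (- q1 * \<tau>))
        < 1 - exp (- p1 * \<tau>) * exp (- q1 * \<tau>) * (exp (- p2 * s) * exp (- q2 * s))"
      using eqs(2) unfolding e1_def[symmetric] e2_def[symmetric] f_def[symmetric] g_def[symmetric]
      by (simp only: mult_minus_left)
  qed (use pq1 pq2 eps assms(1) in auto)
  show ?thesis
    by (rule flow_decays_rescale[OF \<open>\<nu> \<noteq> 0\<close> flow_decays_dwell[OF sw dwell]])
qed

text \<open>The common form of the two nontrivial clauses of \<open>is_tau12\<close>; r sends s_sol
  to the lower end of the range for the diagonal zero.\<close>

definition is_threshold :: "(real \<Rightarrow> real \<Rightarrow> bool) \<Rightarrow> (real \<Rightarrow> real \<Rightarrow> bool) \<Rightarrow> (real \<Rightarrow> real) \<Rightarrow> real \<Rightarrow> bool" where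
  "is_threshold crit nrm r \<tau> \<longleftrightarrow>
    (\<exists>t s. is_unique_sol (\<lambda>(t, s). t > 0 \<and> s > 0 \<and> crit t s \<and> nrm t s) (t, s) \<and>
       (s \<ge> t \<longrightarrow> \<tau> = t) \<and> (s < t \<longrightarrow> is_unique_sol (\<lambda>t. t > r s \<and> nrm t t) \<tau>))"

lemma is_threshold_unique_nonneg:
  assumes crit: "\<And>t s. 0 < t \<Longrightarrow> 0 < s \<Longrightarrow> crit t s \<longleftrightarrow> \<Psi> t s = 0"
    and nrm: "\<And>t s. 0 < t \<Longrightarrow> 0 < s \<Longrightarrow> nrm t s \<longleftrightarrow> H t s = 0"
    and r: "(\<forall>s. r s = s) \<or> \<epsilon> = 1 \<and> (\<forall>s. r s = 0)"
  shows "\<exists>!\<tau>. is_threshold crit nrm r \<tau>"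
    and "is_threshold crit nrm r \<tau> \<Longrightarrow> 0 < \<tau> \<and> (\<forall>s\<ge>\<tau>. 0 \<le> H \<tau> s)"
proof -
  have sys: "(\<lambda>(t, s). t > 0 \<and> s > 0 \<and> crit t s \<and> nrm t s) = (\<lambda>(t, s). 0 < t \<and> 0 < s \<and> \<Psi> t s = 0 \<and> H t s = 0)"
    using crit nrm by (auto simp: fun_eq_iff)
  obtain t s where ts: "is_unique_sol (\<lambda>(t, s). 0 < t \<and> 0 < s \<and> \<Psi> t s = 0 \<and> H t s = 0) (t, s)"
    using ex_unique_crit by blast
  then have sol: "0 < t" "0 < s" "\<Psi> t s = 0" "H t s = 0" unfolding is_unique_sol_def by auto
  have "0 \<le> r s" "r s \<le> s" using r sol(2) by auto
  then have diag: "(\<lambda>t. t > r s \<and> nrm t t) = (\<lambda>t. r s < t \<and> H t t = 0)"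
    using nrm by (auto simp: fun_eq_iff)
  have eq: "is_threshold crit nrm r \<tau> \<longleftrightarrow>
      (t \<le> s \<longrightarrow> \<tau> = t) \<and> (s < t \<longrightarrow> is_unique_sol (\<lambda>t. r s < t \<and> H t t = 0) \<tau>)" for \<tau>
  proof -
    have "is_unique_sol P (t', s') \<longleftrightarrow> t' = t \<and> s' = s" if "is_unique_sol P (t, s)" for P t' s'
      using that unfolding is_unique_sol_def by blast
    note unique = this[OF ts]
    show ?thesis unfolding is_threshold_def sys unique diag[symmetric] by blast
  qed
  show "\<exists>!\<tau>. is_threshold crit nrm r \<tau>"
    unfolding eq using ex1_threshold[OF sol, of "r s"] r by blast
  show "is_threshold crit nrm r \<tau> \<Longrightarrow> 0 < \<tau> \<and> (\<forall>s\<ge>\<tau>. 0 \<le> H \<tau> s)"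
    unfolding eq using threshold_nonneg[OF sol \<open>r s \<le> s\<close>, of \<tau>] by blast
qed

end

theorem theorem3p14:
  fixes A1 A2 P1 P2 M :: "real^2^2" and p1 q1 p2 q2 :: real
  assumes "0 < p1" and "p1 < q1" and "0 < p2" and "p2 < q2"
    and "invertible P1" and "invertible P2"
    and "A1 = P1 ** diag_neg p1 q1 ** matrix_inv P1"
    and "A2 = P2 ** diag_neg p2 q2 ** matrix_inv P2"
    and "M = matrix_inv P2 ** P1"
    and "det M = 1 \<or> det M = -1"
  shows "(M $ 1 $ 1 * M $ 2 $ 2 \<in> interval_I p2 q2 \<longrightarrow>
            (\<forall>\<sigma>\<in>signals. stable_for A1 A2 \<sigma>) \<and>
            (\<forall>\<sigma>\<in>S_dwell' 0. asymp_stable_for A1 A2 \<sigma>)) \<and>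
         (det M * (M $ 1 $ 1 * M $ 2 $ 2) \<in> interval_I p2 q2 \<longrightarrow>
            (\<forall>\<sigma>\<in>signals. stable_for A1 A2 \<sigma>)) \<and>
         (\<exists>!\<tau>. is_tau12 p1 q1 p2 q2 M \<tau>) \<and>
         (\<forall>\<tau>. is_tau12 p1 q1 p2 q2 M \<tau> \<longrightarrow>
            (\<forall>\<sigma>\<in>S_dwell \<tau>. stable_for A1 A2 \<sigma>) \<and>
            (\<forall>\<sigma>\<in>S_dwell' \<tau>. asymp_stable_for A1 A2 \<sigma>))"
proof -
  define ad where "ad = M $ 1 $ 1 * M $ 2 $ 2"
  define bc where "bc = M $ 1 $ 2 * M $ 2 $ 1"
  define \<kappa> where "\<kappa> = det M * ad"
  define \<beta> where "\<beta> = det M * (M $ 1 $ 2 * M $ 2 $ 2)"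
  define \<gamma> where "\<gamma> = - det M * (M $ 1 $ 1 * M $ 2 $ 1)"
  define R where "R = q2 / (q2 - p2)"
  have det: "\<bar>det M\<bar> = 1" "det M * det M = 1" using assms(10) by auto
  have detM: "det M = ad - bc" by (simp add: det_2 ad_def bc_def)
  have \<kappa>_bc: "det M * bc = \<kappa> - 1" using det(2) unfolding \<kappa>_def detM by algebra
  have adbc: "ad = det M * \<kappa>" "bc = det M * (\<kappa> - 1)"
    using det(2) unfolding \<kappa>_bc[symmetric] unfolding \<kappa>_def by (simp_all add: mult.assoc[symmetric])
  have proj: "\<beta> * \<gamma> = \<kappa> * (1 - \<kappa>)"
  proof -
    have "\<beta> * \<gamma> = - ((det M * ad) * (det M * bc))" by (simp add: \<beta>_def \<gamma>_def ad_def bc_def)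
    also have "\<dots> = \<kappa> * (1 - \<kappa>)" unfolding \<kappa>_bc \<kappa>_def[symmetric] by (simp add: algebra_simps)
    finally show ?thesis .
  qed
  interpret flow_data p1 q1 p2 q2 \<kappa> \<beta> \<gamma>
    by unfold_locales (use assms proj in auto)
  have asymp: "asymp_stable_for A1 A2 \<sigma>" if "switching_times \<sigma> d" "flow_decays p1 q1 p2 q2 \<kappa> \<beta> \<gamma> d" for \<sigma> d
    using asymp_stable_for_if_flow_decays[OF assms(5-9) det(1) that(1)] that(2)
    unfolding \<kappa>_def ad_def \<beta>_def \<gamma>_def by blast
  have I: "interval_I p2 q2 = {1 - R..R}"
    using assms(4) by (simp add: interval_I_def R_def field_simps)
  have "1 < R" using assms(3,4) by (simp add: R_def)
  \<comment> \<open>Since R > 1, the interval lies in [-R, R], and |\<kappa>| = |ad|. Both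
    alternatives therefore give |\<kappa>| \<le> R, a condition blind to the sign of det M.\<close>
  have all: "asymp_stable_for A1 A2 \<sigma>" if *: "ad \<in> interval_I p2 q2 \<or> \<kappa> \<in> interval_I p2 q2" "\<sigma> \<in> signals" for \<sigma>
  proof -
    obtain d where d: "switching_times \<sigma> d" using *(2) unfolding signals_def by blast
    have "\<bar>\<kappa>\<bar> = \<bar>ad\<bar>" using det(1) by (simp add: \<kappa>_def abs_mult)
    then have "\<bar>\<kappa>\<bar> \<le> R" using *(1) \<open>1 < R\<close> unfolding I by auto
    then show ?thesis using asymp[OF d] flow_decays_all_signals[OF _ d] unfolding R_def by blast
  qed
  have stable: "stable_for A1 A2 \<sigma>" if "asymp_stable_for A1 A2 \<sigma>" for \<sigma>
    using that unfolding asymp_stable_for_def by blast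
  have sub: "S_dwell' \<tau> \<subseteq> S_dwell \<tau>" "S_dwell \<tau> \<subseteq> signals" for \<tau>
    unfolding S_dwell'_def S_dwell_def signals_def by blast+
  have main: "(\<exists>!\<tau>. is_tau12 p1 q1 p2 q2 M \<tau>) \<and>
      (\<forall>\<tau>. is_tau12 p1 q1 p2 q2 M \<tau> \<longrightarrow> (\<forall>\<sigma>\<in>S_dwell \<tau>. asymp_stable_for A1 A2 \<sigma>))"
  proof -
    have tau: "is_tau12 p1 q1 p2 q2 M \<tau> \<longleftrightarrow> (\<kappa> \<in> interval_I p2 q2 \<longrightarrow> \<tau> = 0) \<and>
      (\<kappa> > R \<longrightarrow> (\<exists>t_sol s_sol.
          is_unique_sol (\<lambda>(t, s). t > 0 \<and> s > 0 \<and> crit_eq_ii p1 q1 p2 q2 t s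
                                  \<and> norm_eq p1 q1 p2 q2 ad bc t s) (t_sol, s_sol) \<and>
          (s_sol \<ge> t_sol \<longrightarrow> \<tau> = t_sol) \<and>
          (s_sol < t_sol \<longrightarrow>
            is_unique_sol (\<lambda>t. t > 0 \<and> norm_eq p1 q1 p2 q2 ad bc t t) \<tau>))) \<and>
      (\<kappa> < 1 - R \<longrightarrow> (\<exists>t_sol s_sol.
          is_unique_sol (\<lambda>(t, s). t > 0 \<and> s > 0 \<and> crit_eq_iii p1 q1 p2 q2 t s
                                  \<and> norm_eq p1 q1 p2 q2 ad bc t s) (t_sol, s_sol) \<and>
          (s_sol \<ge> t_sol \<longrightarrow> \<tau> = t_sol) \<and>
          (s_sol < t_sol \<longrightarrow>
            is_unique_sol (\<lambda>t. t > s_sol \<and> norm_eq p1 q1 p2 q2 ad bc t t) \<tau>)))" for \<tau>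
    proof -
      have "- (p2 / (q2 - p2)) = 1 - R" using assms(4) by (simp add: R_def field_simps)
      then show ?thesis
        unfolding is_tau12_def Let_def ad_def[symmetric] bc_def[symmetric] \<kappa>_def[symmetric] R_def[symmetric]
        by (simp only:)
    qed
    consider "\<kappa> \<in> interval_I p2 q2" | "\<kappa> > R" | "\<kappa> < 1 - R" unfolding I by fastforce
    then show ?thesis
    proof cases
      case 1
      then have eq: "is_tau12 p1 q1 p2 q2 M \<tau> \<longleftrightarrow> \<tau> = 0" for \<tau>
        unfolding tau by (auto simp: I)
      show ?thesis unfolding eq using all 1 sub(2) by blast
    next
      case 2
      \<comment> \<open>As 2 R - 1 = (p2 + q2) / (q2 - p2), the case condition is the assumption on
        c for \<epsilon> = 1.\<close>
      then have "p2 + q2 < (2 * \<kappa> - 1) * (q2 - p2)" using assms(4) by (simp add: R_def field_simps)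
      then interpret hp: hyperbolic_pair p1 q1 p2 q2 \<kappa> 1 "2 * \<kappa> - 1"
        by unfold_locales (use assms in auto)
      have eq: "is_tau12 p1 q1 p2 q2 M \<tau> \<longleftrightarrow>
          hp.is_threshold (crit_eq_ii p1 q1 p2 q2) (norm_eq p1 q1 p2 q2 ad bc) (\<lambda>s. 0) \<tau>" for \<tau>
        unfolding tau hp.is_threshold_def using 2 \<open>1 < R\<close> by (auto simp: I)
      note thr = hp.is_threshold_unique_nonneg[of "crit_eq_ii p1 q1 p2 q2" "norm_eq p1 q1 p2 q2 ad bc" "\<lambda>s. 0",
          OF hp.crit_eq_ii_iff hp.norm_eq_iff[OF _ _ det(1) adbc]]
      show ?thesis
      proof (intro conjI allI impI ballI)
        show "\<exists>!\<tau>. is_tau12 p1 q1 p2 q2 M \<tau>" unfolding eq using thr(1) by simp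
        fix \<tau> \<sigma> assume "is_tau12 p1 q1 p2 q2 M \<tau>" "\<sigma> \<in> S_dwell \<tau>"
        then show "asymp_stable_for A1 A2 \<sigma>"
          using thr(2)[of \<tau>] hp.dwell_flow_decays[OF _ _ proj, of \<tau>] asymp unfolding eq S_dwell_def by auto
      qed
    next
      case 3
      then have "p2 + q2 < (1 - 2 * \<kappa>) * (q2 - p2)" using assms(4) by (simp add: R_def field_simps)
      then interpret hp: hyperbolic_pair p1 q1 p2 q2 \<kappa> "-1" "1 - 2 * \<kappa>"
        by unfold_locales (use assms in auto)
      have eq: "is_tau12 p1 q1 p2 q2 M \<tau> \<longleftrightarrow>
          hp.is_threshold (crit_eq_iii p1 q1 p2 q2) (norm_eq p1 q1 p2 q2 ad bc) (\<lambda>s. s) \<tau>" for \<tau>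
        unfolding tau hp.is_threshold_def using 3 \<open>1 < R\<close> by (auto simp: I)
      note thr = hp.is_threshold_unique_nonneg[of "crit_eq_iii p1 q1 p2 q2" "norm_eq p1 q1 p2 q2 ad bc" "\<lambda>s. s",
          OF hp.crit_eq_iii_iff hp.norm_eq_iff[OF _ _ det(1) adbc]]
      show ?thesis
      proof (intro conjI allI impI ballI)
        show "\<exists>!\<tau>. is_tau12 p1 q1 p2 q2 M \<tau>" unfolding eq using thr(1) by simp
        fix \<tau> \<sigma> assume "is_tau12 p1 q1 p2 q2 M \<tau>" "\<sigma> \<in> S_dwell \<tau>"
        then show "asymp_stable_for A1 A2 \<sigma>"
          using thr(2)[of \<tau>] hp.dwell_flow_decays[OF _ _ proj, of \<tau>] asymp unfolding eq S_dwell_def by auto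
      qed
    qed
  qed
  show ?thesis
    unfolding ad_def[symmetric] \<kappa>_def[symmetric]
    using all stable main sub by blast
qed

end
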